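(* Let $\lambda>0$, $\alpha>2$, $\omega>0$, $\sigma^2>0$, $\rho>0$, $0\le\epsilon<1$, and let $M,K$ be positive integers with $M\ge K+1$. In the downlink Poisson network model with zero-forcing beamforming described in the context, the average (over both the channel fading and the point process $\Psi_\lambda$) of the ergodic achievable spectral efficiency of the typical user satisfies $$\mathbb{E}\left\{\log_2\left(1+\frac{(1-\epsilon^2)\,|\mathbf{h}_{0,k}^H\mathbf{w}_0^{\mathrm{ZF}}|^2}{\sum_{i\in\Psi_\lambda\setminus\{\mathrm{AP}_0\}}\|\mathbf{h}_{i,k}^H\mathbf{W}_i^{\mathrm{ZF}}\|^2+\epsilon^2|\mathbf{h}_{0,k}^H\mathbf{w}_0^{\mathrm{ZF}}|^2+\frac{\sigma^2}{\rho}}\right)\right\}\;\ge\;\widetilde{\mathrm{SE}},$$ where $$\widetilde{\mathrm{SE}}=\log_2\left(1+\frac{(1-\epsilon^2)(M-K)}{\frac{2K}{\alpha-2}+\epsilon^2(M-K)+\frac{\Gamma(\alpha/2+1)}{(\pi\lambda)^{\alpha/2}}\frac{\omega\sigma^2}{\rho}}\right).$$ That is, $\widetilde{\mathrm{SE}}$ is an achievable lower bound on the average spectral efficiency (in bit/symbol/user) of the network.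
   Context: Model. Access points (APs) are located at the points of a homogeneous Poisson point process $\Psi_\lambda$ in $\mathbb{R}^2$ of intensity $\lambda$. Each AP has $M$ antennas and serves $K$ single-antenna users located in its Voronoi cell. The typical user (with index $k$) is placed at the origin and is served by $\mathrm{AP}_0$, the AP of $\Psi_\lambda$ closest to it. Let $d_{i,k}$ be the distance from $\mathrm{AP}_i$ to the typical user; thus $d_{i,k}\ge d_{0,k}$ for all $i$. Channels. Conditionally on the distances, the channel from $\mathrm{AP}_i$ to the typical user is $\mathbf{h}_{i,k}\sim\mathcal{CN}(\mathbf{0},\omega^{-1}d_{i,k}^{-\alpha}\mathbf{I}_M)$, independent over $i$. The channels $\mathbf{h}_{0,j}$ ($j\ne k$) from $\mathrm{AP}_0$ to its other $K-1$ users are also circularly symmetric complex Gaussian with covariance a positive multiple (depending on the distance) of $\mathbf{I}_M$, independent of each other and of $\mathbf{h}_{0,k}$. Zero-forcing beamforming. Each AP $i$ uses a beamforming matrix $\mathbf{W}_i^{\mathrm{ZF}}\in\mathbb{C}^{M\times K}$ with unit-norm columns, computed only from the channels to the $K$ users in its own cell. The vector $\mathbf{w}_0^{\mathrm{ZF}}$ is the column of $\mathbf{W}_0^{\mathrm{ZF}}$ intended for the typical user: the unit-norm vector in the direction of the orthogonal projection of $\mathbf{h}_{0,k}$ onto the orthogonal complement of the span of $\{\mathbf{h}_{0,j}: j\neq k\}$. For $i\ne0$, $\mathbf{W}_i^{\mathrm{ZF}}$ is independent of $\mathbf{h}_{i,k}$. The parameter $\epsilon$ models hardware impairments, $\rho$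 is the transmit energy per symbol, and $\sigma^2$ is the noise energy per symbol. $\Gamma$ is the Gamma function and $\|\cdot\|$ the Euclidean norm. *)

theory Defs
  imports "HOL-Probability.Probability"
begin

definition homogeneous_ppp ::
    "'w measure \<Rightarrow> real \<Rightarrow> ('w \<Rightarrow> 'a::euclidean_space set) \<Rightarrow> bool" where
  "homogeneous_ppp M lam \<Psi> \<longleftrightarrow>
     (\<forall>\<xi>\<in>space M. \<forall>B. bounded B \<longrightarrow> finite (\<Psi> \<xi> \<inter> B)) \<and>
     (\<forall>B\<in>sets borel. bounded B \<longrightarrow>
        (\<lambda>\<xi>. card (\<Psi> \<xi> \<inter> B)) \<in> M \<rightarrow>\<^sub>M count_space UNIV \<and>
        (\<forall>n. measure M {\<xi>\<in>space M. card (\<Psi> \<xi> \<inter> B) = n} =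
             (lam * measure lborel B) ^ n / fact n * exp (- (lam * measure lborel B)))) \<and>
     (\<forall>(I :: nat set) B. finite I \<longrightarrow> disjoint_family_on B I \<longrightarrow>
        (\<forall>i\<in>I. B i \<in> sets borel \<and> bounded (B i)) \<longrightarrow>
        prob_space.indep_vars M (\<lambda>_. count_space UNIV) (\<lambda>i \<xi>. card (\<Psi> \<xi> \<inter> B i)) I)"

definition voronoi_cell :: "'a::metric_space set \<Rightarrow> 'a \<Rightarrow> 'a set" where
  "voronoi_cell P x = {u. \<forall>y\<in>P. dist u x \<le> dist u y}"

text \<open>Throughout, \<open>F\<close> is a sub-sigma-algebra of \<open>M\<close>.\<close>

definition has_cond_distr ::
    "'w measure \<Rightarrow> 'w measure \<Rightarrow> 'b measure \<Rightarrow> ('w \<Rightarrow> 'b) \<Rightarrow> ('w \<Rightarrow> 'b measure) \<Rightarrow> bool" where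
  "has_cond_distr M F N X \<kappa> \<longleftrightarrow>
     X \<in> M \<rightarrow>\<^sub>M N \<and>
     (\<forall>B\<in>sets N. AE \<xi> in M.
        real_cond_exp M F (indicator (X -` B \<inter> space M)) \<xi> = measure (\<kappa> \<xi>) B)"

definition cond_indep_sets ::
    "'w measure \<Rightarrow> 'w measure \<Rightarrow> ('i \<Rightarrow> 'w set set) \<Rightarrow> 'i set \<Rightarrow> bool" where
  "cond_indep_sets M F A I \<longleftrightarrow>
     (\<forall>i\<in>I. A i \<subseteq> sets M) \<and>
     (\<forall>J\<subseteq>I. J \<noteq> {} \<longrightarrow> finite J \<longrightarrow> (\<forall>B\<in>Pi J A. AE \<xi> in M.
        real_cond_exp M F (indicator (\<Inter>j\<in>J. B j)) \<xi> =
        (\<Prod>j\<in>J. real_cond_exp M F (indicator (B j)) \<xi>)))"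

text \<open>\<open>hdot h w\<close> is \<open>h\<^sup>H w\<close>, conjugate-linear in the first argument, and
  \<open>hrow h W\<close> is the row vector \<open>h\<^sup>H W\<close>.\<close>

definition hdot :: "complex^'m \<Rightarrow> complex^'m \<Rightarrow> complex" where
  "hdot h w = (\<Sum>i\<in>UNIV. cnj (h $ i) * w $ i)"

definition hrow :: "complex^'m \<Rightarrow> complex^'k^'m \<Rightarrow> complex^'k" where
  "hrow h W = (\<chi> j. hdot h (column j W))"

definition orth_complement :: "(complex^'m) set \<Rightarrow> (complex^'m) set" where
  "orth_complement S = {w. \<forall>v\<in>S. hdot v w = 0}"

definition orth_projection :: "(complex^'m) set \<Rightarrow> complex^'m \<Rightarrow> complex^'m" where
  "orth_projection V h = (THE p. p \<in> V \<and> h - p \<in> orth_complement V)"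

text \<open>\<open>G $ j\<close> is the channel vector to user \<open>j\<close> of the cell. Since \<open>sgn 0 = 0\<close>, a column
  whose projected channel vanishes is \<open>0\<close> instead of a unit vector.\<close>

definition zf_column :: "complex^'m^'k \<Rightarrow> 'k \<Rightarrow> complex^'m" where
  "zf_column G j =
     sgn (orth_projection (orth_complement (vec.span {G $ l | l. l \<noteq> j})) (G $ j))"

definition zf_matrix :: "complex^'m^'k \<Rightarrow> complex^'k^'m" where
  "zf_matrix G = (\<chi> a j. zf_column G j $ a)"

text \<open>The law \<open>CN(0, v I)\<close>: real and imaginary parts of all coordinates are independent
  centred Gaussians of variance \<open>v/2\<close>, where \<open>v > 0\<close>.\<close>

definition cscg :: "real \<Rightarrow> (complex^'m) measure" where
  "cscg v = density lborel (\<lambda>z. ennreal (exp (- (norm z)\<^sup>2 / v) / (pi * v) ^ CARD('m)))"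

text \<open>\<open>X i\<close> is the position of access point \<open>i\<close> and \<open>U i j\<close> that of user \<open>j\<close> in its cell.
  The typical user is at the origin.\<close>

definition distance_algebra ::
    "'w measure \<Rightarrow> (nat \<Rightarrow> 'w \<Rightarrow> real^2) \<Rightarrow> (nat \<Rightarrow> 'k \<Rightarrow> 'w \<Rightarrow> real^2) \<Rightarrow> 'w measure" where
  "distance_algebra M X U = sigma (space M)
     ({(\<lambda>\<xi>. norm (X i \<xi>)) -` B \<inter> space M | i B. B \<in> sets borel} \<union>
      {(\<lambda>\<xi>. dist (X i \<xi>) (U i j \<xi>)) -` B \<inter> space M | i j B. B \<in> sets borel})"

text \<open>\<open>h i\<close> is the channel from access point \<open>i\<close> to the typical user, and \<open>H i \<xi> $ j\<close> the
  channel from access point \<open>i\<close> to user \<open>j\<close> of its own cell. The channels inside a cell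
  other than the home cell \<open>0\<close> form a single block whose joint law is left unspecified.\<close>

datatype 'k channel_block = To_typical nat | Home_user 'k | Other_cell nat

fun block_events ::
    "'w measure \<Rightarrow> (nat \<Rightarrow> 'w \<Rightarrow> complex^'m) \<Rightarrow> (nat \<Rightarrow> 'w \<Rightarrow> complex^'m^'k) \<Rightarrow>
     'k channel_block \<Rightarrow> 'w set set" where
  "block_events M h H (To_typical i) = sets (vimage_algebra (space M) (h i) borel)"
| "block_events M h H (Home_user j) = sets (vimage_algebra (space M) (\<lambda>\<xi>. H 0 \<xi> $ j) borel)"
| "block_events M h H (Other_cell i) = sets (vimage_algebra (space M) (H i) borel)"

locale poisson_zf_network = prob_space M
  for M :: "'w measure"
    and lam \<alpha> \<omega> :: real
    and \<Psi> :: "'w \<Rightarrow> (real^2) set"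
    and X :: "nat \<Rightarrow> 'w \<Rightarrow> real^2"
    and U :: "nat \<Rightarrow> 'k::finite \<Rightarrow> 'w \<Rightarrow> real^2"
    and k :: 'k
    and h :: "nat \<Rightarrow> 'w \<Rightarrow> complex^'m::finite"
    and H :: "nat \<Rightarrow> 'w \<Rightarrow> complex^'m^'k"
    and \<gamma> :: "real \<Rightarrow> real" +
  assumes ppp: "homogeneous_ppp M lam \<Psi>"
    and X_measurable: "\<And>i. X i \<in> borel_measurable M"
    and X_enumerates: "AE \<xi> in M. bij_betw (\<lambda>i. X i \<xi>) UNIV (\<Psi> \<xi>)"
    and X0_closest: "AE \<xi> in M. \<forall>y\<in>\<Psi> \<xi>. norm (X 0 \<xi>) \<le> norm y"
    and U_measurable: "\<And>i j. U i j \<in> borel_measurable M"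
    and U_voronoi: "AE \<xi> in M. \<forall>i j. U i j \<xi> \<in> voronoi_cell (\<Psi> \<xi>) (X i \<xi>)"
    and typical_user: "AE \<xi> in M. U 0 k \<xi> = 0 \<and> H 0 \<xi> $ k = h 0 \<xi>"
    and H_measurable: "\<And>i. H i \<in> borel_measurable M"
    and h_distr: "\<And>i. has_cond_distr M (distance_algebra M X U) borel (h i)
          (\<lambda>\<xi>. cscg (inverse \<omega> * norm (X i \<xi>) powr (- \<alpha>)))"
    and \<gamma>_measurable: "\<gamma> \<in> borel_measurable borel"
    and \<gamma>_pos: "\<And>j. j \<noteq> k \<Longrightarrow> AE \<xi> in M. \<gamma> (dist (X 0 \<xi>) (U 0 j \<xi>)) > 0"
    and home_distr: "\<And>j. j \<noteq> k \<Longrightarrow>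
          has_cond_distr M (distance_algebra M X U) borel (\<lambda>\<xi>. H 0 \<xi> $ j)
            (\<lambda>\<xi>. cscg (\<gamma> (dist (X 0 \<xi>) (U 0 j \<xi>))))"
    and channels_indep: "\<And>i. i \<noteq> 0 \<Longrightarrow>
          cond_indep_sets M (distance_algebra M X U) (block_events M h H)
            (range To_typical \<union> Home_user ` (- {k}) \<union> {Other_cell i})"
    and unit_columns: "\<And>i j. AE \<xi> in M. norm (column j (zf_matrix (H i \<xi>))) = 1"

end

theory Submission
  imports Defs "HOL-Real_Asymp.Real_Asymp"
begin

text \<open>
  Write \<open>S\<close> for the signal power, \<open>I\<close> for the total interference and \<open>c = \<sigma>\<^sup>2 / \<rho>\<close>. The spectral
  efficiency is a convex decreasing function of \<open>Y = (I + c) / S\<close>, so Jensen's inequality reduces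
  the claim to an upper bound on the expectation of \<open>Y\<close>. Given the distances, the interfering
  channels, the home channels of the other users and \<open>h 0\<close> are independent. Integrating out
  \<open>h i\<close> replaces the interference of access point \<open>i\<close> by \<open>K\<close> times its path gain. The signal power
  is the squared norm of the projection of a Gaussian vector onto a space of complex dimension at
  least \<open>M - K + 1\<close>, whose inverse has mean at most \<open>1 / (M - K)\<close> over the path gain. What remains is the
  mean of \<open>d\<^sub>0\<close> to the power \<open>\<alpha>\<close>, where \<open>d\<^sub>0\<^sup>2\<close> is exponentially distributed, and of the sum of
  \<open>(d\<^sub>0 / d\<^sub>i)\<close> to the power \<open>\<alpha>\<close>. The latter follows from the fact that the ball of radius
  \<open>s d\<^sub>0\<close> contains on average at most \<open>s\<^sup>2 - 1\<close> points besides the nearest one.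
\<close>

section \<open>Orthogonal invariance of Lebesgue measure\<close>

text \<open>A conditional law is given only as one almost sure identity per Borel set, whereas
  signal and interference depend jointly on several channels. The identities are therefore
  integrated over cylinder sets and extended to the generated sigma-algebra; only then can one
  channel be integrated against its Gaussian law with the others held fixed. In an interference term
  \<open>h i\<close> goes first: the signal power belongs to the fixed data at that moment, so its
  inverse can be averaged afterwards.

  The inverse mean comes from a Gamma law: a complex Gaussian projected onto complex dimension n has
  a squared norm of shape n, whose inverse has mean 1 / (n - 1) in units of the path gain. The
  constant \<open>2 / (\<alpha> - 2)\<close> is the integral of
  \<open>u powr (- 2 / \<alpha>) - 1\<close> over the unit interval, the ball count being applied
  with \<open>s = u powr (- 1 / \<alpha>)\<close>.

  The count is not derived from the law of the process conditioned on its nearest point;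
  discretising the distance of that point takes its place.

  Infinite sums and expectations have default values at divergence, so almost sure finiteness of the
  interference and integrability of the logarithm have to be proved.\<close>

text \<open>Both sides are values of the double integral of \<open>f (x + y) * g y\<close>; since \<open>N\<close> is an arbitrary
  translation invariant measure, this gives the uniqueness of Lebesgue measure up to a factor.\<close>

lemma haar_swap:
  fixes N :: "'a::euclidean_space measure" and f g :: "'a \<Rightarrow> ennreal"
  assumes sets[measurable_cong]: "sets N = sets borel" and fin: "sigma_finite_measure N"
    and inv: "\<And>a (p :: 'a \<Rightarrow> ennreal). p \<in> borel_measurable borel \<Longrightarrow> (\<integral>\<^sup>+x. p (a + x) \<partial>N) = (\<integral>\<^sup>+x. p x \<partial>N)"
    and f[measurable]: "f \<in> borel_measurable borel" and g[measurable]: "g \<in> borel_measurable borel"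
  shows "(\<integral>\<^sup>+x. f x \<partial>lborel) * (\<integral>\<^sup>+x. g x \<partial>N) = (\<integral>\<^sup>+x. g (- x) \<partial>lborel) * (\<integral>\<^sup>+x. f x \<partial>N)"
proof -
  interpret N: sigma_finite_measure N by fact
  interpret P: pair_sigma_finite "lborel :: 'a measure" N ..
  have L: "(\<integral>\<^sup>+x. p (a + x) \<partial>lborel) = (\<integral>\<^sup>+x. p x \<partial>lborel)" if [measurable]: "p \<in> borel_measurable borel"
    for p :: "'a \<Rightarrow> ennreal" and a
    by (subst (2) lborel_distr_plus[symmetric, of a]) (simp add: nn_integral_distr)
  have "(\<integral>\<^sup>+x. f x \<partial>lborel) * (\<integral>\<^sup>+x. g x \<partial>N) = (\<integral>\<^sup>+y. (\<integral>\<^sup>+x. f x \<partial>lborel) * g y \<partial>N)"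
    by (simp add: nn_integral_cmult)
  also have "\<dots> = (\<integral>\<^sup>+y. (\<integral>\<^sup>+x. f (y + x) * g y \<partial>lborel) \<partial>N)"
    by (simp add: nn_integral_multc L)
  also have "\<dots> = (\<integral>\<^sup>+x. (\<integral>\<^sup>+y. f (y + x) * g y \<partial>N) \<partial>lborel)"
    by (rule P.Fubini') simp
  also have "\<dots> = (\<integral>\<^sup>+x. (\<integral>\<^sup>+y. f y * g (y - x) \<partial>N) \<partial>lborel)"
  proof (rule nn_integral_cong)
    fix x :: 'a
    show "(\<integral>\<^sup>+y. f (y + x) * g y \<partial>N) = (\<integral>\<^sup>+y. f y * g (y - x) \<partial>N)"
      using inv[of "\<lambda>y. f y * g (y - x)" x] by (simp add: add.commute)
  qed
  also have "\<dots> = (\<integral>\<^sup>+y. (\<integral>\<^sup>+x. f y * g (y - x) \<partial>lborel) \<partial>N)"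
    by (rule P.Fubini'[symmetric]) simp
  also have "\<dots> = (\<integral>\<^sup>+y. f y * (\<integral>\<^sup>+x. g (- x) \<partial>lborel) \<partial>N)"
  proof (rule nn_integral_cong)
    fix y :: 'a
    show "(\<integral>\<^sup>+x. f y * g (y - x) \<partial>lborel) = f y * (\<integral>\<^sup>+x. g (- x) \<partial>lborel)"
      using L[of "\<lambda>x. g (y - x)" y] by (simp add: nn_integral_cmult)
  qed
  finally show ?thesis by (simp add: nn_integral_multc mult.commute)
qed

section \<open>Gaussian integrals on the real line\<close>

text \<open>Normal density of variance \<open>v / 2\<close>, the law of each of the
  \<open>2 * CARD('m)\<close> real coordinates under \<open>cscg v\<close>.\<close>

definition gauss :: "real \<Rightarrow> real \<Rightarrow> real" where
  "gauss v x = exp (- x\<^sup>2 / v) / sqrt (pi * v)"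

lemma gauss_nonneg [simp]: "v > 0 \<Longrightarrow> 0 \<le> gauss v x"
  by (simp add: gauss_def)

lemma gauss_measurable [measurable]: "gauss v \<in> borel_measurable borel"
  unfolding gauss_def by measurable

lemma gauss_eq_normal_density: "v > 0 \<Longrightarrow> gauss v x = normal_density 0 (sqrt (v / 2)) x"
  by (simp add: gauss_def normal_density_def)

lemma nn_integral_gauss [simp]:
  assumes "v > 0" shows "(\<integral>\<^sup>+x. gauss v x \<partial>lborel) = 1"
proof -
  interpret prob_space "density lborel (normal_density 0 (sqrt (v / 2)))"
    by (rule prob_space_normal_density) (use assms in simp)
  show ?thesis
    using emeasure_space_1 assms by (simp add: emeasure_density gauss_eq_normal_density)
qed

lemma nn_integral_gauss_square:
  assumes "v > 0" shows "(\<integral>\<^sup>+x. gauss v x * x\<^sup>2 \<partial>lborel) = v / 2"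
proof -
  have "has_bochner_integral lborel (\<lambda>x. normal_density 0 (sqrt (v / 2)) x * (x - 0) ^ (2 * 1))
      (fact (2 * 1) / ((2 / (sqrt (v / 2))\<^sup>2) ^ 1 * fact 1))"
    by (rule normal_moment_even) (use assms in simp)
  then have "has_bochner_integral lborel (\<lambda>x. gauss v x * x\<^sup>2) (v / 2)"
    using assms by (simp add: gauss_eq_normal_density field_simps power2_eq_square)
  then have "(\<integral>\<^sup>+x. ennreal (gauss v x * x\<^sup>2) \<partial>lborel) = ennreal (v / 2)"
    by (subst nn_integral_eq_integral) (use assms in \<open>auto simp: has_bochner_integral_iff\<close>)
  then show ?thesis .
qed

text \<open>The exponential factor keeps the density Gaussian and only changes its parameter to
  \<open>w\<close>, where 1 / w = 1 / v + t. What remains is the ratio of the two normalising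
  constants.\<close>

lemma nn_integral_gauss_exp:
  assumes "v > 0" "t \<ge> 0"
  shows "(\<integral>\<^sup>+x. gauss v x * exp (- t * x\<^sup>2) \<partial>lborel) = 1 / sqrt (1 + t * v)"
proof -
  define w where "w = v / (1 + t * v)"
  have pos: "1 + t * v > 0" using assms by (simp add: add_pos_nonneg)
  have w: "w > 0" using assms pos by (simp add: w_def)
  have iw: "inverse w = inverse v + t" using assms pos by (simp add: w_def field_simps)
  have "gauss v x * exp (- t * x\<^sup>2) = 1 / sqrt (1 + t * v) * gauss w x" for x
  proof -
    have "exp (- x\<^sup>2 / w) = exp (- x\<^sup>2 / v) * exp (- t * x\<^sup>2)"
      unfolding divide_inverse iw by (simp add: algebra_simps flip: exp_add)
    moreover have "sqrt (pi * w) * sqrt (1 + t * v) = sqrt (pi * v)"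
      using pos by (simp add: w_def flip: real_sqrt_mult)
    ultimately show ?thesis using w assms pos by (simp add: gauss_def field_simps)
  qed
  then have "(\<integral>\<^sup>+x. gauss v x * exp (- t * x\<^sup>2) \<partial>lborel) = (\<integral>\<^sup>+x. ennreal (1 / sqrt (1 + t * v)) * gauss w x \<partial>lborel)"
    using pos w by (simp only: ennreal_mult[symmetric] gauss_nonneg zero_le_divide_iff)
       (simp add: ennreal_mult[symmetric])
  then show ?thesis using w by (simp add: nn_integral_cmult)
qed

text \<open>The image of Lebesgue measure under \<open>T\<close> is again translation invariant, a
  shift by \<open>T b\<close> being a shift by \<open>b\<close> before \<open>T\<close>. So it is a
  multiple of Lebesgue measure, and the unit ball, which \<open>T\<close> preserves and which has
  finite positive volume, shows that the factor is 1.\<close>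

lemma nn_integral_lborel_orthogonal:
  fixes T :: "'a::euclidean_space \<Rightarrow> 'a" and p :: "'a \<Rightarrow> ennreal"
  assumes T: "orthogonal_transformation T" and [measurable]: "p \<in> borel_measurable borel"
  shows "(\<integral>\<^sup>+x. p (T x) \<partial>lborel) = (\<integral>\<^sup>+x. p x \<partial>lborel)"
proof -
  have lin: "linear T" and norm_T: "\<And>x. norm (T x) = norm x"
    using T by (auto simp: orthogonal_transformation)
  have [measurable]: "T \<in> borel_measurable borel"
    by (intro borel_measurable_continuous_onI linear_continuous_on)
      (simp add: lin linear_conv_bounded_linear[symmetric])
  define N where "N = distr lborel borel T"
  have N_int: "(\<integral>\<^sup>+x. q x \<partial>N) = (\<integral>\<^sup>+x. q (T x) \<partial>lborel)" if [measurable]: "q \<in> borel_measurable borel"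
    for q :: "'a \<Rightarrow> ennreal"
    by (simp add: N_def nn_integral_distr)
  have "sigma_finite_measure N"
  proof (rule sigma_finite_measure.intro, intro exI conjI)
    let ?A = "range (\<lambda>n::nat. ball 0 (real n) :: 'a set)"
    show "countable ?A" "?A \<subseteq> sets N" by (auto simp: N_def)
    have "\<exists>n::nat. norm x < real n" for x :: 'a by (rule reals_Archimedean2)
    then show "\<Union> ?A = space N" by (auto simp: N_def)
    have "T -` ball 0 r = ball 0 r" for r by (auto simp: norm_T)
    then show "\<forall>a\<in>?A. emeasure N a \<noteq> \<infinity>"
      using emeasure_bounded_finite[OF bounded_ball[of "0::'a"]] by (auto simp: N_def emeasure_distr less_top)
  qed
  moreover have "(\<integral>\<^sup>+x. q (a + x) \<partial>N) = (\<integral>\<^sup>+x. q x \<partial>N)"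
    if [measurable]: "q \<in> borel_measurable borel" for a and q :: "'a \<Rightarrow> ennreal"
  proof -
    obtain b where b: "T b = a"
      using orthogonal_transformation_surj[OF T] by (metis surjD)
    have "(\<integral>\<^sup>+x. q (T x) \<partial>lborel) = (\<integral>\<^sup>+x. q (T (b + x)) \<partial>lborel)"
      by (subst lborel_distr_plus[symmetric, of b]) (simp add: nn_integral_distr)
    then show ?thesis by (simp add: N_int linear_add[OF lin] b)
  qed
  ultimately have swap: "(\<integral>\<^sup>+x. f x \<partial>lborel) * (\<integral>\<^sup>+x. g x \<partial>N) = (\<integral>\<^sup>+x. g (- x) \<partial>lborel) * (\<integral>\<^sup>+x. f x \<partial>N)"
    if "f \<in> borel_measurable borel" "g \<in> borel_measurable borel" for f g :: "'a \<Rightarrow> ennreal"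
    by (rule haar_swap[OF _ _ _ that, rotated 1]) (auto simp: N_def)
  define f :: "'a \<Rightarrow> ennreal" where "f = indicator (ball 0 1)"
  have [measurable]: "f \<in> borel_measurable borel" unfolding f_def by (intro borel_measurable_indicator) simp
  have f_T: "f (T x) = f x" for x by (simp add: f_def norm_T indicator_def)
  have c: "(\<integral>\<^sup>+x. f x \<partial>lborel) = emeasure lborel (ball (0::'a) 1)"
    by (simp add: f_def)
  have c0: "(\<integral>\<^sup>+x. f x \<partial>lborel) \<noteq> 0" "(\<integral>\<^sup>+x. f x \<partial>lborel) \<noteq> \<infinity>"
    unfolding c using emeasure_bounded_finite[OF bounded_ball[of "0::'a" 1]]
      open_not_negligible[of "ball (0::'a) 1"]
    by (auto simp: negligible_iff_null_sets null_sets_completion_iff null_sets_def)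
  have "(\<integral>\<^sup>+x. f x \<partial>lborel) * (\<integral>\<^sup>+x. p x \<partial>N) = (\<integral>\<^sup>+x. f x \<partial>lborel) * (\<integral>\<^sup>+x. p (- x) \<partial>lborel)"
    using swap[of f p] by (simp add: N_int f_T mult.commute)
  \<comment> \<open>Lebesgue measure satisfies the same identity in place of \<open>N\<close>; the
    reflected integral of \<open>p\<close> occurs in both and drops out.\<close>
  moreover have "(\<integral>\<^sup>+x. f x \<partial>lborel) * (\<integral>\<^sup>+x. p x \<partial>lborel) = (\<integral>\<^sup>+x. f x \<partial>lborel) * (\<integral>\<^sup>+x. p (- x) \<partial>lborel)"
  proof -
    have "(\<integral>\<^sup>+x. q (a + x) \<partial>lborel) = (\<integral>\<^sup>+x. q x \<partial>lborel)"
      if [measurable]: "q \<in> borel_measurable borel" for a :: 'a and q :: "'a \<Rightarrow> ennreal"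
      by (subst (2) lborel_distr_plus[symmetric, of a]) (simp add: nn_integral_distr)
    from haar_swap[OF _ lborel.sigma_finite_measure_axioms this, of f p] show ?thesis
      by (simp add: mult.commute)
  qed
  ultimately show ?thesis
    using c0 by (simp add: N_int ennreal_mult_cancel_left)
qed

section \<open>Circularly symmetric Gaussian vectors\<close>

lemma DIM_complex_vec: "DIM(complex^'m) = 2 * CARD('m)"
  by simp

lemma nn_integral_cscg:
  fixes f :: "complex^'m \<Rightarrow> ennreal"
  assumes [measurable]: "f \<in> borel_measurable borel"
  shows "(\<integral>\<^sup>+z. f z \<partial>cscg v) = (\<integral>\<^sup>+z. ennreal (exp (- (norm z)\<^sup>2 / v) / (pi * v) ^ CARD('m)) * f z \<partial>lborel)"
  unfolding cscg_def by (subst nn_integral_density) auto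

lemma sets_cscg [measurable_cong, simp]: "sets (cscg v) = sets borel"
  by (simp add: cscg_def)

lemma space_cscg [simp]: "space (cscg v) = UNIV"
  by (simp add: cscg_def)

text \<open>The path gain is 0 where an access point sits at the origin, since
  \<open>0 powr b = 0\<close>. Division by zero then makes \<open>cscg 0\<close> the null measure
  rather than a point mass, so upper bounds hold trivially at such sample points.\<close>

lemma cscg_0: "emeasure (cscg 0 :: (complex^'m) measure) B = 0"
proof -
  have "(cscg 0 :: (complex^'m) measure) = density lborel (\<lambda>_. 0)"
    by (simp add: cscg_def power_0_left)
  then show ?thesis
    by (cases "B \<in> sets lborel") (auto simp: emeasure_density emeasure_notin_sets)
qed

lemma nn_integral_cscg_orthogonal:
  fixes f :: "complex^'m \<Rightarrow> ennreal" and T :: "complex^'m \<Rightarrow> complex^'m"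
  assumes T: "orthogonal_transformation T" and [measurable]: "f \<in> borel_measurable borel"
  shows "(\<integral>\<^sup>+z. f (T z) \<partial>cscg v) = (\<integral>\<^sup>+z. f z \<partial>cscg v)"
proof -
  have lin: "linear T" and norm_T: "\<And>x. norm (T x) = norm x"
    using T by (auto simp: orthogonal_transformation)
  have [measurable]: "T \<in> borel_measurable borel"
    by (intro borel_measurable_continuous_onI linear_continuous_on)
      (simp add: lin linear_conv_bounded_linear[symmetric])
  show ?thesis
    using nn_integral_lborel_orthogonal[OF T, of "\<lambda>z. ennreal (exp (- (norm z)\<^sup>2 / v) / (pi * v) ^ CARD('m)) * f z"]
    by (simp add: nn_integral_cscg norm_T)
qed

lemma power2_norm_eq_sum_Basis: "(norm z)\<^sup>2 = (\<Sum>b\<in>Basis. (z \<bullet> b)\<^sup>2)"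
  unfolding power2_norm_eq_inner by (subst euclidean_inner) (simp add: power2_eq_square)

lemma cscg_density_prod:
  fixes z :: "complex^'m"
  assumes "v > 0"
  shows "exp (- (norm z)\<^sup>2 / v) / (pi * v) ^ CARD('m) = (\<Prod>b\<in>Basis. gauss v (z \<bullet> b))"
proof -
  have "exp (- (norm z)\<^sup>2 / v) = (\<Prod>b\<in>Basis. exp (- (z \<bullet> b)\<^sup>2 / v))"
    by (simp add: power2_norm_eq_sum_Basis sum_divide_distrib sum_negf flip: exp_sum)
  moreover have "(pi * v) ^ CARD('m) = (\<Prod>b\<in>(Basis::(complex^'m) set). sqrt (pi * v))"
    using assms by (simp add: DIM_complex_vec power_mult del: DIM_cart) 
  ultimately show ?thesis by (simp add: gauss_def prod_dividef)
qed

lemma nn_integral_cscg_prod: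
  fixes p :: "complex^'m \<Rightarrow> real \<Rightarrow> real"
  assumes v: "v > 0" and [measurable]: "\<And>b. b \<in> Basis \<Longrightarrow> p b \<in> borel_measurable borel"
    and pos: "\<And>b x. p b x \<ge> 0"
  shows "(\<integral>\<^sup>+z. ennreal (\<Prod>b\<in>Basis. p b (z \<bullet> b)) \<partial>cscg v) = (\<Prod>b\<in>Basis. \<integral>\<^sup>+x. gauss v x * p b x \<partial>lborel)"
proof -
  have "(\<integral>\<^sup>+z. ennreal (\<Prod>b\<in>Basis. p b (z \<bullet> b)) \<partial>cscg v) =
      (\<integral>\<^sup>+z. ennreal (\<Prod>b\<in>Basis. gauss v (z \<bullet> b) * p b (z \<bullet> b)) \<partial>lborel)"
    using v pos by (subst nn_integral_cscg)
      (auto simp only: cscg_density_prod prod.distrib ennreal_mult prod_nonneg gauss_nonneg intro!: nn_integral_cong, measurable)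
  also have "\<dots> = (\<integral>\<^sup>+z. (\<Prod>b\<in>Basis. ennreal (gauss v (z \<bullet> b) * p b (z \<bullet> b))) \<partial>lborel)"
    using v pos by (simp add: prod_ennreal)
  also have "\<dots> = (\<Prod>b\<in>Basis. \<integral>\<^sup>+x. gauss v x * p b x \<partial>lborel)"
    by (rule nn_integral_lborel_prod) auto
  finally show ?thesis .
qed

lemma emeasure_cscg_UNIV:
  assumes "v > 0" shows "emeasure (cscg v :: (complex^'m) measure) UNIV = 1"
  using nn_integral_cscg_prod[OF assms, of "\<lambda>(_::complex^'m) _. 1"] assms
  by simp

lemma prob_space_cscg: "v > 0 \<Longrightarrow> prob_space (cscg v)"
  by (rule prob_spaceI) (simp add: emeasure_cscg_UNIV)

lemma nn_integral_cscg_basis_square: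
  fixes b :: "complex^'m"
  assumes v: "v > 0" and b: "b \<in> Basis"
  shows "(\<integral>\<^sup>+z. ennreal ((z \<bullet> b)\<^sup>2) \<partial>cscg v) = v / 2"
proof -
  have "(z \<bullet> b)\<^sup>2 = (\<Prod>c\<in>Basis. if c = b then (z \<bullet> c)\<^sup>2 else 1)" for z
    using b by (simp add: prod.delta)
  then have "(\<integral>\<^sup>+z. ennreal ((z \<bullet> b)\<^sup>2) \<partial>cscg v) =
      (\<integral>\<^sup>+z. ennreal (\<Prod>c\<in>Basis. (if c = b then (z \<bullet> c)\<^sup>2 else 1)) \<partial>cscg v)"
    by simp
  also have "\<dots> = (\<Prod>c\<in>Basis. \<integral>\<^sup>+x. gauss v x * (if c = b then x\<^sup>2 else 1) \<partial>lborel)"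
    by (rule nn_integral_cscg_prod[OF v, of "\<lambda>c x. if c = b then x\<^sup>2 else 1"]) auto
  also have "\<dots> = (\<Prod>c\<in>Basis. if c = b then ennreal (v / 2) else 1)"
    using v by (intro prod.cong) (auto simp: nn_integral_gauss_square)
  also have "\<dots> = v / 2" using b by (simp add: prod.delta)
  finally show ?thesis .
qed

text \<open>Each coordinate in \<open>D\<close> contributes a factor
  \<open>1 / sqrt (1 + t * v)\<close>. The product is the Laplace transform of the Gamma law with
  shape \<open>n\<close> and scale \<open>v\<close>.\<close>

lemma nn_integral_cscg_exp:
  assumes v: "v > 0" and D: "D \<subseteq> (Basis :: (complex^'m) set)" "card D = 2 * n" and t: "t \<ge> 0"
  shows "(\<integral>\<^sup>+z. ennreal (exp (- t * (\<Sum>b\<in>D. (z \<bullet> b)\<^sup>2))) \<partial>cscg v) = 1 / (1 + t * v) ^ n"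
proof -
  have pos: "1 + t * v > 0" using v t by (simp add: add_pos_nonneg)
  have "exp (- t * (\<Sum>b\<in>D. (z \<bullet> b)\<^sup>2)) = (\<Prod>b\<in>Basis. if b \<in> D then exp (- t * (z \<bullet> b)\<^sup>2) else 1)" for z
    using D by (simp add: sum_distrib_left sum_negf exp_sum finite_subset[OF D(1)] prod.If_cases Int_absorb1
      flip: exp_minus sum_negf)
  then have "(\<integral>\<^sup>+z. ennreal (exp (- t * (\<Sum>b\<in>D. (z \<bullet> b)\<^sup>2))) \<partial>cscg v) =
      (\<integral>\<^sup>+z. ennreal (\<Prod>b\<in>Basis. (if b \<in> D then exp (- t * (z \<bullet> b)\<^sup>2) else 1)) \<partial>cscg v)"
    by simp
  also have "\<dots> = (\<Prod>b\<in>Basis. \<integral>\<^sup>+x. gauss v x * (if b \<in> D then exp (- t * x\<^sup>2) else 1) \<partial>lborel)"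
    by (rule nn_integral_cscg_prod[OF v, of "\<lambda>b x. if b \<in> D then exp (- t * x\<^sup>2) else 1"]) auto
  also have "\<dots> = (\<Prod>b\<in>Basis. if b \<in> D then ennreal (1 / sqrt (1 + t * v)) else 1)"
    using nn_integral_gauss_exp[OF v t] v by (intro prod.cong) auto
  also have "\<dots> = ennreal (1 / sqrt (1 + t * v)) ^ (2 * n)"
    using D by (simp add: prod.If_cases Int_absorb1)
  also have "\<dots> = 1 / (1 + t * v) ^ n"
    using pos by (simp add: ennreal_power power_mult power_divide)
  finally show ?thesis .
qed

text \<open>The extended inverse makes the case \<open>q = 0\<close> true as well, both sides being
  infinite. A vanishing signal thus counts as an infinite inverse instead of disappearing through
  \<open>x / 0 = 0\<close>.\<close>

lemma nn_integral_exp_inverse: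
  assumes "q \<ge> 0"
  shows "(\<integral>\<^sup>+t. ennreal (exp (- t * q)) * indicator {0..} t \<partial>lborel) = inverse (ennreal q)"
proof (cases "q = 0")
  case True
  have "emeasure lborel {0::real..} = \<top>"
  proof (rule ccontr)
    assume "emeasure lborel {0::real..} \<noteq> \<top>"
    then obtain n where "emeasure lborel {0::real..} < of_nat n"
      using ennreal_Ex_less_of_nat by (auto simp: less_top)
    moreover have "emeasure lborel {0..real n} \<le> emeasure lborel {0::real..}"
      by (intro emeasure_mono) auto
    ultimately show False by (simp add: ennreal_of_nat_eq_real_of_nat)
  qed
  with True show ?thesis by simp
next
  case False
  with assms have q: "q > 0" by simp
  have "((\<lambda>t. - exp (- t * q) / q) \<longlongrightarrow> - 0 / q) at_top"
    using q by real_asymp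
  then have "(\<integral>\<^sup>+t. ennreal (exp (- t * q)) * indicator {0..} t \<partial>lborel) = ennreal (0 - (- exp (- 0 * q) / q))"
    using q by (intro nn_integral_FTC_atLeast) (auto intro!: derivative_eq_intros)
  then show ?thesis using q by (simp add: inverse_ennreal divide_inverse)
qed

lemma nn_integral_inverse_power:
  assumes "v > 0" "n \<ge> 2"
  shows "(\<integral>\<^sup>+t. ennreal (1 / (1 + t * v) ^ n) * indicator {0..} t \<partial>lborel) = 1 / (v * (real n - 1))"
proof -
  \<comment> \<open>Two successors leave the exponent \<open>Suc k\<close> in the antiderivative, so
    that it vanishes at infinity; for exponent 1 it would be a logarithm.\<close>
  obtain k where n: "n = Suc (Suc k)" using assms(2) by (metis One_nat_def Suc_le_D numeral_2_eq_2 Suc_le_mono)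
  have pos: "1 + t * v > 0" if "t \<ge> 0" for t using that assms by (simp add: add_pos_nonneg)
  let ?F = "\<lambda>t. - (inverse (1 + t * v) ^ Suc k) / (v * (real k + 1))"
  have "((\<lambda>t. inverse (1 + t * v)) \<longlongrightarrow> 0) at_top"
    using assms by real_asymp
  then have "((\<lambda>t. inverse (1 + t * v) ^ Suc k) \<longlongrightarrow> 0 ^ Suc k) at_top"
    by (intro tendsto_intros)
  then have "(?F \<longlongrightarrow> - (0 ^ Suc k) / (v * (real k + 1))) at_top"
    by (intro tendsto_divide tendsto_minus tendsto_const) (use assms in auto)
  moreover have "(?F has_real_derivative 1 / (1 + t * v) ^ n) (at t)" if "0 \<le> t" for t
  proof -
    have "((\<lambda>t. inverse (1 + t * v)) has_real_derivative - (v * (inverse (1 + t * v))\<^sup>2)) (at t)"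
      using pos[OF that] by (auto intro!: derivative_eq_intros simp: power2_eq_square)
    from DERIV_cdivide[OF DERIV_minus[OF DERIV_power[OF this, of "Suc k"]], of "v * (real k + 1)"]
    show ?thesis
    proof (rule DERIV_cong)
      define w where "w = inverse (1 + t * v)"
      have w_n: "1 / (1 + t * v) ^ n = w ^ n" by (simp add: w_def power_inverse divide_inverse)
      show "- (real (Suc k) * (- (v * (inverse (1 + t * v))\<^sup>2) * inverse (1 + t * v) ^ (Suc k - Suc 0)))
          / (v * (real k + 1)) = 1 / (1 + t * v) ^ n"
        unfolding w_def[symmetric] w_n using assms
        by (simp add: n power2_eq_square divide_simps add_nonneg_eq_0_iff)
    qed
  qed
  ultimately have "(\<integral>\<^sup>+t. ennreal (1 / (1 + t * v) ^ n) * indicator {0..} t \<partial>lborel) = ennreal (0 - ?F 0)"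
    using pos assms by (intro nn_integral_FTC_atLeast) (auto simp: less_imp_le)
  then show ?thesis by (simp add: n add.commute)
qed

text \<open>Uses \<open>1 / q = \<integral> exp (- t q) dt\<close> over \<open>t \<ge> 0\<close>, which turns the inverse of a sum of squares into
  a product of one-dimensional integrals.\<close>

lemma nn_integral_cscg_inverse_basis:
  assumes v: "v > 0" and D: "D \<subseteq> (Basis :: (complex^'m) set)" "card D = 2 * n" and n: "n \<ge> 2"
  shows "(\<integral>\<^sup>+z. inverse (ennreal (\<Sum>b\<in>D. (z \<bullet> b)\<^sup>2)) \<partial>cscg v) = 1 / (v * (real n - 1))"
proof -
  interpret prob_space "cscg v :: (complex^'m) measure" by (rule prob_space_cscg) fact
  interpret P: pair_sigma_finite "cscg v :: (complex^'m) measure" "lborel :: real measure" ..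
  have "(\<integral>\<^sup>+z. inverse (ennreal (\<Sum>b\<in>D. (z \<bullet> b)\<^sup>2)) \<partial>cscg v) =
      (\<integral>\<^sup>+z. (\<integral>\<^sup>+t. ennreal (exp (- t * (\<Sum>b\<in>D. (z \<bullet> b)\<^sup>2))) * indicator {0..} t \<partial>lborel) \<partial>cscg v)"
    by (simp only: nn_integral_exp_inverse sum_nonneg zero_le_power2)
  also have "\<dots> = (\<integral>\<^sup>+t. (\<integral>\<^sup>+z. ennreal (exp (- t * (\<Sum>b\<in>D. (z \<bullet> b)\<^sup>2))) * indicator {0..} t \<partial>cscg v) \<partial>lborel)"
    by (rule P.Fubini'[symmetric]) measurable
  also have "\<dots> = (\<integral>\<^sup>+t. ennreal (1 / (1 + t * v) ^ n) * indicator {0..} t \<partial>lborel)"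
    by (intro nn_integral_cong)
      (auto simp: nn_integral_multc nn_integral_cscg_exp[OF v D, simplified] split: split_indicator)
  finally show ?thesis using nn_integral_inverse_power[OF v n] by simp
qed

section \<open>Rotating orthonormal systems onto coordinate axes\<close>

text \<open>Matching an orthonormal basis that extends \<open>B\<close> with \<open>Basis\<close>
  gives the rotation. It reduces questions about subspaces to subsets of \<open>Basis\<close>, along
  which the Gaussian density factors.\<close>

lemma orthonormal_to_Basis:
  fixes B :: "'a::euclidean_space set"
  assumes orth: "pairwise orthogonal B" and norm1: "\<And>x. x \<in> B \<Longrightarrow> norm x = 1"
  obtains T :: "'a \<Rightarrow> 'a" and \<sigma> where "orthogonal_transformation T" "inj_on \<sigma> B" "\<sigma> ` B \<subseteq> Basis"
    "\<And>z e. e \<in> B \<Longrightarrow> T z \<bullet> \<sigma> e = z \<bullet> e"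
proof -
  \<comment> \<open>The added vectors avoid 0, so \<open>sgn\<close> really normalises them; on
    \<open>B\<close> it is the identity.\<close>
  obtain U where U: "U \<inter> insert 0 B = {}" "pairwise orthogonal (B \<union> U)" "span (B \<union> U) = span (B \<union> UNIV)"
    using orthogonal_extension_strong[OF orth] by metis
  define C where "C = sgn ` (B \<union> U)"
  have BC: "B \<subseteq> C"
  proof
    fix e assume "e \<in> B"
    then have "e = sgn e" using norm1[of e] by (simp add: sgn_div_norm)
    with \<open>e \<in> B\<close> show "e \<in> C" by (auto simp: C_def)
  qed
  have "0 \<notin> B" using norm1 by force
  then have C1: "norm c = 1" if "c \<in> C" for c
    using that U(1) by (auto simp: C_def norm_sgn)
  have orthC: "pairwise orthogonal C"
    unfolding C_def
  proof (rule pairwise_imageI)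
    fix x y assume "x \<in> B \<union> U" "y \<in> B \<union> U" "x \<noteq> y"
    then have "orthogonal x y" using U(2) by (simp add: pairwise_def)
    then show "orthogonal (sgn x) (sgn y)" by (simp add: orthogonal_def sgn_div_norm)
  qed
  have "x \<in> span C" if "x \<in> B \<union> U" for x
  proof -
    have "norm x *\<^sub>R sgn x \<in> span C"
      by (intro span_scale span_base) (use that in \<open>auto simp: C_def\<close>)
    then show ?thesis by (cases "x = 0") (auto simp: sgn_div_norm)
  qed
  then have "span (B \<union> U) \<subseteq> span C" by (intro span_minimal) auto
  then have span: "span C = UNIV" using U(3) by auto
  have ind: "independent C"
    using pairwise_orthogonal_independent[OF orthC] C1 by force
  have fin: "finite C" using ind by (rule independent_imp_finite)
  have "card C = DIM('a)"
    using basis_card_eq_dim[of C UNIV] ind span by simp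
  then obtain \<sigma> where \<sigma>: "bij_betw \<sigma> C (Basis :: 'a set)"
    using finite_same_card_bij[OF fin finite_Basis[where 'a='a]] by auto
  define T where "T z = (\<Sum>c\<in>C. (z \<bullet> c) *\<^sub>R \<sigma> c)" for z
  have T_inner: "T z \<bullet> \<sigma> e = z \<bullet> e" if "e \<in> C" for z e
  proof -
    have "T z \<bullet> \<sigma> e = (\<Sum>c\<in>C. (z \<bullet> c) * (\<sigma> c \<bullet> \<sigma> e))" by (simp add: T_def inner_sum_left)
    also have "\<dots> = (\<Sum>c\<in>C. if c = e then z \<bullet> c else 0)"
    proof (intro sum.cong refl)
      fix c assume "c \<in> C"
      then have eq: "\<sigma> c = \<sigma> e \<longleftrightarrow> c = e"
        using that by (rule inj_on_eq_iff[OF bij_betw_imp_inj_on[OF \<sigma>]])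
      from \<open>c \<in> C\<close> that have "\<sigma> c \<in> Basis" "\<sigma> e \<in> Basis"
        by (simp_all add: bij_betw_apply[OF \<sigma>])
      then have "\<sigma> c \<bullet> \<sigma> e = (if c = e then 1 else 0)"
        by (simp only: inner_Basis eq)
      then show "(z \<bullet> c) * (\<sigma> c \<bullet> \<sigma> e) = (if c = e then z \<bullet> c else 0)"
        by simp
    qed
    finally show ?thesis using fin that by simp
  qed
  have "linear T"
    unfolding T_def by (rule linearI) (auto simp: inner_add_left scaleR_left_distrib sum.distrib scaleR_sum_right)
  moreover have "T v \<bullet> T w = v \<bullet> w" for v w
  proof -
    have w: "w = (\<Sum>c\<in>C. (w \<bullet> c) *\<^sub>R c)"
      by (rule orthonormal_basis_expand[OF orthC C1 _ fin, symmetric]) (simp_all add: span)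
    have "T v \<bullet> T w = (\<Sum>c\<in>C. (w \<bullet> c) * (T v \<bullet> \<sigma> c))" by (simp add: T_def[of w] inner_sum_right)
    also have "\<dots> = (\<Sum>c\<in>C. (w \<bullet> c) * (v \<bullet> c))" by (simp add: T_inner)
    also have "\<dots> = v \<bullet> (\<Sum>c\<in>C. (w \<bullet> c) *\<^sub>R c)" by (simp add: inner_sum_right)
    finally show ?thesis unfolding w[symmetric] .
  qed
  ultimately have "orthogonal_transformation T" by (simp add: orthogonal_transformation_def)
  moreover have "inj_on \<sigma> B"
    by (rule inj_on_subset[OF bij_betw_imp_inj_on[OF \<sigma>] BC])
  moreover have "\<sigma> ` B \<subseteq> Basis"
    unfolding bij_betw_imp_surj_on[OF \<sigma>, symmetric] by (rule image_mono[OF BC])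
  ultimately show ?thesis
    by (rule that) (simp add: T_inner subsetD[OF BC])
qed

lemma nn_integral_cscg_inner_square:
  fixes w :: "complex^'m"
  assumes v: "v > 0"
  shows "(\<integral>\<^sup>+z. ennreal ((z \<bullet> w)\<^sup>2) \<partial>cscg v) = v / 2 * (norm w)\<^sup>2"
proof (cases "w = 0")
  case False
  define e where "e = sgn w"
  have "pairwise orthogonal {e}" "\<And>x. x \<in> {e} \<Longrightarrow> norm x = 1"
    using False by (auto simp: e_def norm_sgn)
  then obtain T :: "complex^'m \<Rightarrow> complex^'m" and \<sigma> where T: "orthogonal_transformation T" and \<sigma>: "\<sigma> e \<in> Basis"
    and inner: "\<And>z. T z \<bullet> \<sigma> e = z \<bullet> e"
    by (rule orthonormal_to_Basis) auto
  have w: "w = norm w *\<^sub>R e" using False by (simp add: e_def sgn_div_norm)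
  have "(z \<bullet> w)\<^sup>2 = (norm w)\<^sup>2 * (T z \<bullet> \<sigma> e)\<^sup>2" for z
    by (subst w) (simp add: inner power_mult_distrib)
  then have "(\<integral>\<^sup>+z. ennreal ((z \<bullet> w)\<^sup>2) \<partial>cscg v) = (\<integral>\<^sup>+z. ennreal ((norm w)\<^sup>2) * ennreal ((T z \<bullet> \<sigma> e)\<^sup>2) \<partial>cscg v)"
    by (simp add: ennreal_mult)
  also have "\<dots> = (\<integral>\<^sup>+z. ennreal ((norm w)\<^sup>2) * ennreal ((z \<bullet> \<sigma> e)\<^sup>2) \<partial>cscg v)"
    by (rule nn_integral_cscg_orthogonal[OF T, where f="\<lambda>z. ennreal ((norm w)\<^sup>2) * ennreal ((z \<bullet> \<sigma> e)\<^sup>2)"]) measurable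
  also have "\<dots> = ennreal ((norm w)\<^sup>2) * ennreal (v / 2)"
    using v \<sigma> by (simp add: nn_integral_cmult nn_integral_cscg_basis_square)
  finally show ?thesis using v by (simp add: ennreal_mult[symmetric] mult.commute)
qed simp

lemma nn_integral_cscg_inverse_orthonormal:
  assumes v: "v > 0" and B: "pairwise orthogonal B" "\<And>x. x \<in> B \<Longrightarrow> norm x = 1"
    and card: "card (B :: (complex^'m) set) = 2 * n" and n: "n \<ge> 2"
  shows "(\<integral>\<^sup>+z. inverse (ennreal (\<Sum>b\<in>B. (z \<bullet> b)\<^sup>2)) \<partial>cscg v) = 1 / (v * (real n - 1))"
proof -
  obtain T :: "complex^'m \<Rightarrow> complex^'m" and \<sigma> where T: "orthogonal_transformation T"
    and \<sigma>: "inj_on \<sigma> B" "\<sigma> ` B \<subseteq> Basis" and inner: "\<And>z e. e \<in> B \<Longrightarrow> T z \<bullet> \<sigma> e = z \<bullet> e"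
    using orthonormal_to_Basis[OF B] by metis
  have "(\<Sum>b\<in>B. (z \<bullet> b)\<^sup>2) = (\<Sum>b\<in>\<sigma> ` B. (T z \<bullet> b)\<^sup>2)" for z
    using \<sigma>(1) by (simp add: sum.reindex inner)
  then have "(\<integral>\<^sup>+z. inverse (ennreal (\<Sum>b\<in>B. (z \<bullet> b)\<^sup>2)) \<partial>cscg v) =
      (\<integral>\<^sup>+z. inverse (ennreal (\<Sum>b\<in>\<sigma> ` B. (T z \<bullet> b)\<^sup>2)) \<partial>cscg v)"
    by simp
  also have "\<dots> = (\<integral>\<^sup>+z. inverse (ennreal (\<Sum>b\<in>\<sigma> ` B. (z \<bullet> b)\<^sup>2)) \<partial>cscg v)"
    by (rule nn_integral_cscg_orthogonal[OF T, where f="\<lambda>z. inverse (ennreal (\<Sum>b\<in>\<sigma> ` B. (z \<bullet> b)\<^sup>2))"]) measurable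
  also have "\<dots> = 1 / (v * (real n - 1))"
    using nn_integral_cscg_inverse_basis[OF v \<sigma>(2) _ n] card \<sigma>(1) by (simp add: card_image)
  finally show ?thesis .
qed

lemma borel_measurable_inner_square: "(\<lambda>z. ennreal ((z \<bullet> b)\<^sup>2)) \<in> borel_measurable (cscg v)"
  by measurable

lemma nn_integral_cscg_norm_square:
  assumes v: "v > 0"
  shows "(\<integral>\<^sup>+z. ennreal ((norm (z :: complex^'m))\<^sup>2) \<partial>cscg v) = v * real CARD('m)"
proof -
  have "(\<integral>\<^sup>+z. ennreal ((norm (z :: complex^'m))\<^sup>2) \<partial>cscg v) =
      (\<integral>\<^sup>+z. (\<Sum>b\<in>Basis. ennreal (((z :: complex^'m) \<bullet> b)\<^sup>2)) \<partial>cscg v)"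
    by (simp add: power2_norm_eq_sum_Basis)
  also have "\<dots> = (\<Sum>b\<in>(Basis :: (complex^'m) set). ennreal (v / 2))"
    using v by (simp only: nn_integral_sum borel_measurable_inner_square nn_integral_cscg_basis_square cong: sum.cong)
  also have "\<dots> = v * real CARD('m)"
    using v by (simp add: ennreal_of_nat_eq_real_of_nat ennreal_mult[symmetric] mult.commute flip: ennreal_numeral)
  finally show ?thesis .
qed

section \<open>Zero-forcing beamformers\<close>

text \<open>Gram-Schmidt. A vector of the list that depends on the later ones has residual \<open>0\<close> and
  contributes nothing, because \<open>x / 0 = 0\<close>. Unlike the \<open>THE\<close> in the definition of the orthogonal projection, the
  recursion is visibly measurable in all its arguments.\<close>

primrec gs_residual :: "'a::real_inner list \<Rightarrow> 'a \<Rightarrow> 'a" where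
  "gs_residual [] h = h"
| "gs_residual (g # gs) h =
     gs_residual gs h - ((gs_residual gs h \<bullet> gs_residual gs g) / (gs_residual gs g \<bullet> gs_residual gs g)) *\<^sub>R gs_residual gs g"

lemma gs_residual_span: "h - gs_residual gs h \<in> span (set gs)"
proof (induction gs arbitrary: h)
  case (Cons g gs)
  let ?q = "gs_residual gs g" and ?r = "gs_residual gs h"
  have mono: "span (set gs) \<subseteq> span (set (g # gs))" by (intro span_mono) auto
  have "g - (g - ?q) \<in> span (set (g # gs))"
    by (rule span_diff[OF span_base subsetD[OF mono Cons.IH]]) simp
  then have q: "?q \<in> span (set (g # gs))" by simp
  have "(h - ?r) + ((?r \<bullet> ?q) / (?q \<bullet> ?q)) *\<^sub>R ?q \<in> span (set (g # gs))"
    using Cons.IH[of h] mono q by (intro span_add span_scale) auto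
  then show ?case by (simp add: algebra_simps)
qed (simp add: span_zero)

lemma gs_residual_orthogonal: "x \<in> span (set gs) \<Longrightarrow> gs_residual gs h \<bullet> x = 0"
proof (induction gs arbitrary: h x)
  case (Cons g gs)
  let ?q = "gs_residual gs g" and ?r' = "gs_residual (g # gs) h"
  have 0: "?r' \<bullet> x = 0" if "x \<in> span (set gs)" for x
    using Cons.IH[OF that] by (simp add: inner_diff_left)
  have "?r' \<bullet> ?q = 0" by (cases "?q = 0") (simp_all add: inner_diff_left)
  \<comment> \<open>\<open>g\<close> differs from its residual by an element of the span of
    \<open>gs\<close>, to which \<open>?r'\<close> is already known to be orthogonal.\<close>
  with 0[OF gs_residual_span[of g gs]] have "?r' \<bullet> g = 0" by (simp add: inner_diff_right)
  then have "\<forall>y\<in>set (g # gs). ?r' \<bullet> y = 0" using 0 by (auto intro: span_base)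
  then show ?case
    using Cons.prems by (intro span_induct[of x "set (g # gs)" "\<lambda>y. ?r' \<bullet> y = 0"] subspace_hyperplane) auto
qed simp

lemma gs_residual_measurable:
  fixes h :: "'b \<Rightarrow> 'a::euclidean_space"
  assumes "\<And>i. i \<in> set js \<Longrightarrow> G i \<in> borel_measurable N" "h \<in> borel_measurable N"
  shows "(\<lambda>p. gs_residual (map (\<lambda>i. G i p) js) (h p)) \<in> borel_measurable N"
  using assms
proof (induction js arbitrary: h)
  case (Cons j js)
  have [measurable]: "(\<lambda>p. gs_residual (map (\<lambda>i. G i p) js) (h p)) \<in> borel_measurable N"
    "(\<lambda>p. gs_residual (map (\<lambda>i. G i p) js) (G j p)) \<in> borel_measurable N"
    using Cons by auto
  show ?case by simp
qed simp

text \<open>Bessel's inequality: after a rotation, nonnegative coordinate squares are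
  dropped.\<close>

lemma sum_orthonormal_le_norm:
  fixes p :: "'a::euclidean_space"
  assumes B: "pairwise orthogonal B" "\<And>x. x \<in> B \<Longrightarrow> norm x = 1"
  shows "(\<Sum>b\<in>B. (p \<bullet> b)\<^sup>2) \<le> (norm p)\<^sup>2"
proof -
  obtain T :: "'a \<Rightarrow> 'a" and \<sigma> where T: "orthogonal_transformation T"
    and \<sigma>: "inj_on \<sigma> B" "\<sigma> ` B \<subseteq> Basis" and inner: "\<And>z e. e \<in> B \<Longrightarrow> T z \<bullet> \<sigma> e = z \<bullet> e"
    using orthonormal_to_Basis[OF B] by metis
  have "(\<Sum>b\<in>B. (p \<bullet> b)\<^sup>2) = (\<Sum>b\<in>\<sigma> ` B. (T p \<bullet> b)\<^sup>2)"
    using \<sigma>(1) by (simp add: sum.reindex inner)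
  also have "\<dots> \<le> (\<Sum>b\<in>Basis. (T p \<bullet> b)\<^sup>2)"
    using \<sigma>(2) by (intro sum_mono2) auto
  also have "\<dots> = (norm (T p))\<^sup>2"
    by (rule power2_norm_eq_sum_Basis[symmetric])
  also have "\<dots> = (norm p)\<^sup>2" using T by (simp add: orthogonal_transformation)
  finally show ?thesis .
qed

text \<open>The orthogonal complement of the list has dimension at least
  \<open>DIM('a) - length gs\<close>, and along its vectors \<open>h\<close> and its residual have
  the same coordinates. Choosing only \<open>n\<close> of them gives a bound that holds whatever the
  rank of the list, so the channels need not be shown linearly independent.\<close>

lemma orthonormal_below_gs_residual:
  fixes gs :: "'a::euclidean_space list"
  assumes "length gs + n \<le> DIM('a)"
  obtains B where "pairwise orthogonal B" "\<And>x. x \<in> B \<Longrightarrow> norm x = 1" "card B = n"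
    "\<And>h. (\<Sum>b\<in>B. (h \<bullet> b)\<^sup>2) \<le> (norm (gs_residual gs h))\<^sup>2"
proof -
  define W where "W = {y. \<forall>x\<in>span (set gs). orthogonal x y}"
  have "dim W + dim (span (set gs)) = DIM('a)"
    using dim_subspace_orthogonal_to_vectors[OF subspace_span subspace_UNIV subset_UNIV, of "set gs"]
    by (simp add: W_def)
  moreover have "dim (span (set gs)) \<le> length gs"
    using dim_le_card[of "set gs" "set gs"] card_length[of gs] by (simp add: span_superset dim_span)
  ultimately have "n \<le> dim W" using assms by linarith
  moreover have "subspace W"
    unfolding W_def by (simp add: subspace_orthogonal_to_vectors)
  then obtain C where C: "C \<subseteq> W" "pairwise orthogonal C" "\<And>x. x \<in> C \<Longrightarrow> norm x = 1" "card C = dim W"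
    using orthonormal_basis_subspace by metis
  ultimately obtain B where B: "B \<subseteq> C" "card B = n" "finite B"
    using obtain_subset_with_card_n by metis
  have orthB: "pairwise orthogonal B" using C(2) B(1) by (rule pairwise_subset)
  have "(\<Sum>b\<in>B. (h \<bullet> b)\<^sup>2) \<le> (norm (gs_residual gs h))\<^sup>2" for h
  proof -
    have "h \<bullet> b = gs_residual gs h \<bullet> b" if "b \<in> B" for b
    proof -
      have "orthogonal (h - gs_residual gs h) b"
        using that B(1) C(1) gs_residual_span[of h gs] by (auto simp: W_def)
      then show ?thesis by (simp add: orthogonal_def inner_diff_left)
    qed
    then have "(\<Sum>b\<in>B. (h \<bullet> b)\<^sup>2) = (\<Sum>b\<in>B. (gs_residual gs h \<bullet> b)\<^sup>2)" by simp
    also have "\<dots> \<le> (norm (gs_residual gs h))\<^sup>2"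
      using orthB B(1) C(3) by (intro sum_orthonormal_le_norm) auto
    finally show ?thesis .
  qed
  then show ?thesis using that[OF orthB] B C(3) by auto
qed

section \<open>Complex orthogonality through the real inner product\<close>

lemma Re_hdot: "Re (hdot v w) = v \<bullet> w"
  by (simp add: hdot_def inner_vec_def inner_complex_def)

lemma Im_hdot: "Im (hdot v w) = (\<i> *s v) \<bullet> w"
  by (simp add: hdot_def inner_vec_def inner_complex_def)

lemma hdot_eq_0_iff: "hdot v w = 0 \<longleftrightarrow> v \<bullet> w = 0 \<and> (\<i> *s v) \<bullet> w = 0"
  by (simp add: complex_eq_iff Re_hdot Im_hdot)

lemma hdot_self: "hdot v v = of_real ((norm v)\<^sup>2)"
  by (simp add: complex_eq_iff Re_hdot power2_norm_eq_inner)
     (simp add: hdot_def)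

lemma cnj_hdot: "cnj (hdot v w) = hdot w v"
  by (simp add: hdot_def mult.commute)

lemma hdot_add_right: "hdot v (w + w') = hdot v w + hdot v w'"
  by (simp add: hdot_def algebra_simps sum.distrib)

lemma hdot_diff_right: "hdot v (w - w') = hdot v w - hdot v w'"
  by (simp add: hdot_def algebra_simps sum_subtractf)

lemma hdot_add_left: "hdot (v + v') w = hdot v w + hdot v' w"
  by (simp add: hdot_def algebra_simps sum.distrib)

lemma hdot_scaleR_right: "hdot v (r *\<^sub>R w) = of_real r * hdot v w"
  by (simp add: hdot_def scaleR_sum_right flip: scaleR_conv_of_real)

lemma hdot_smult_left: "hdot (c *s v) w = cnj c * hdot v w"
  by (simp add: hdot_def sum_distrib_left algebra_simps)

lemma hdot_smult_right: "hdot v (c *s w) = c * hdot v w"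
  by (simp add: hdot_def sum_distrib_left algebra_simps)

lemma orth_complement_span_iff: "w \<in> orth_complement (vec.span A) \<longleftrightarrow> (\<forall>v\<in>A. hdot v w = 0)"
proof
  assume "\<forall>v\<in>A. hdot v w = 0"
  moreover have "vec.subspace {v. hdot v w = 0}"
    by (rule vec.subspaceI) (auto simp: hdot_add_left hdot_smult_left, simp add: hdot_def)
  ultimately have "vec.span A \<subseteq> {v. hdot v w = 0}"
    by (intro vec.span_minimal) auto
  then show "w \<in> orth_complement (vec.span A)" by (auto simp: orth_complement_def)
qed (auto simp: orth_complement_def intro: vec.span_base)

text \<open>With \<open>v\<close> and \<open>\<i> v\<close> both in the list, real orthogonality to the list is complex orthogonality.\<close>

lemma orth_projection_eq_gs_residual:
  assumes gs: "set gs = A \<union> (\<lambda>v. \<i> *s v) ` A"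
  shows "orth_projection (orth_complement (vec.span A)) h = gs_residual gs h"
    and "hdot h (gs_residual gs h) = of_real ((norm (gs_residual gs h))\<^sup>2)"
proof -
  let ?V = "orth_complement (vec.span A)" and ?p = "gs_residual gs h"
  have V: "?p \<in> ?V"
    unfolding orth_complement_span_iff hdot_eq_0_iff
  proof (intro ballI conjI)
    fix v assume "v \<in> A"
    then have "v \<in> span (set gs)" "\<i> *s v \<in> span (set gs)"
      unfolding gs by (blast intro: span_base)+
    from this[THEN gs_residual_orthogonal] show "v \<bullet> ?p = 0" "(\<i> *s v) \<bullet> ?p = 0"
      by (simp_all only: inner_commute)
  qed
  have "set gs \<subseteq> {x. \<forall>v\<in>?V. hdot v x = 0}"
  proof safe
    fix x v assume "x \<in> set gs" "v \<in> ?V"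
    then have "hdot x v = 0"
      unfolding gs orth_complement_span_iff by (auto simp: hdot_smult_left)
    then show "hdot v x = 0" using cnj_hdot[of x v] by simp
  qed
  moreover have "subspace {x. \<forall>v\<in>?V. hdot v x = 0}"
    by (rule subspaceI) (auto simp: hdot_add_right hdot_scaleR_right, simp add: hdot_def)
  ultimately have "span (set gs) \<subseteq> orth_complement ?V"
    unfolding orth_complement_def[of ?V] by (rule span_minimal)
  then have W: "h - ?p \<in> orth_complement ?V" using gs_residual_span by (rule subsetD)
  \<comment> \<open>The definite description needs uniqueness: two candidates differ by a vector
    that lies in \<open>?V\<close> and is orthogonal to \<open>?V\<close>, hence to itself.\<close>
  have unique: "p' = ?p" if "p' \<in> ?V \<and> h - p' \<in> orth_complement ?V" for p'
  proof -
    have "?p - p' \<in> ?V"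
      using V conjunct1[OF that] by (simp add: orth_complement_def hdot_diff_right)
    moreover have *: "hdot v (?p - p') = 0" if "v \<in> ?V" for v
    proof -
      have "hdot v (h - p') = 0" "hdot v (h - ?p) = 0"
        using W \<open>p' \<in> ?V \<and> h - p' \<in> orth_complement ?V\<close> that by (auto simp: orth_complement_def[of ?V])
      then show ?thesis by (simp add: hdot_diff_right)
    qed
    ultimately have "hdot (?p - p') (?p - p') = 0" using * by simp
    then show ?thesis by (simp add: hdot_self)
  qed
  show "orth_projection ?V h = ?p"
    unfolding orth_projection_def by (rule the_equality, rule conjI[OF V W], rule unique)
  have "hdot ?p (h - ?p) = 0" using V W unfolding orth_complement_def[of ?V] by blast
  then have "hdot ?p h = of_real ((norm ?p)\<^sup>2)" by (simp add: hdot_diff_right hdot_self)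
  then show "hdot h ?p = of_real ((norm ?p)\<^sup>2)" using cnj_hdot[of ?p h] by simp
qed

section \<open>Zero-forcing columns as Gram-Schmidt residuals\<close>

text \<open>Any enumeration serves, because the residual depends only on the span of the listed
  vectors.\<close>

definition other_indices :: "'k::finite \<Rightarrow> 'k list" where
  "other_indices j = (SOME js. distinct js \<and> set js = - {j})"

lemma
  fixes j :: "'k::finite"
  shows set_other_indices: "set (other_indices j) = - {j}"
    and length_other_indices: "length (other_indices j) = CARD('k) - 1"
proof -
  have "\<exists>js. distinct js \<and> set js = - {j}"
    using finite_distinct_list[of "- {j}"] by auto
  then have js: "distinct (other_indices j) \<and> set (other_indices j) = - {j}"
    unfolding other_indices_def by (rule someI_ex)
  then show "set (other_indices j) = - {j}" by simp
  from js show "length (other_indices j) = CARD('k) - 1"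
    using distinct_card[of "other_indices j"] by (simp add: Compl_eq_Diff_UNIV)
qed

text \<open>The projected vector is an argument of its own, and only the rows of \<open>G\<close>
  other than \<open>j\<close> are read. The channel of user \<open>j\<close> can thus be integrated
  while the other rows stay fixed.\<close>

definition zf_residual :: "complex^'m^'k \<Rightarrow> 'k \<Rightarrow> complex^'m \<Rightarrow> complex^'m" where
  "zf_residual G j h =
     gs_residual (map (\<lambda>(c, l). c *s (G $ l)) (List.product [1, \<i>] (other_indices j))) h"

text \<open>The rest \<open>h - p\<close> is orthogonal to the projection \<open>p\<close>, so
  \<open>hdot h p\<close> is the squared norm of \<open>p\<close> and normalising \<open>p\<close>
  leaves its norm. With \<open>sgn 0 = 0\<close> this includes \<open>p = 0\<close>.\<close>

lemma zf_column_eq: "zf_column G j = sgn (zf_residual G j (G $ j))"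
  and cmod_hdot_zf_residual: "cmod (hdot h (sgn (zf_residual G j h))) = norm (zf_residual G j h)"
proof -
  have set: "set (map (\<lambda>(c, l). c *s (G $ l)) (List.product [1, \<i>] (other_indices j))) =
      {G $ l | l. l \<noteq> j} \<union> (\<lambda>v. \<i> *s v) ` {G $ l | l. l \<noteq> j}"
    by (auto simp: image_iff set_other_indices)
  show "zf_column G j = sgn (zf_residual G j (G $ j))"
    unfolding zf_column_def zf_residual_def orth_projection_eq_gs_residual(1)[OF set] ..
  let ?p = "zf_residual G j h"
  have "hdot h ?p = of_real ((norm ?p)\<^sup>2)"
    unfolding zf_residual_def by (rule orth_projection_eq_gs_residual(2)[OF set])
  then have "hdot h (sgn ?p) = of_real (norm ?p)"
    by (cases "?p = 0") (simp_all add: sgn_div_norm hdot_scaleR_right power2_eq_square field_simps)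
  then show "cmod (hdot h (sgn ?p)) = norm ?p" by simp
qed

lemma norm_zf_residual_le: "norm (zf_residual G j h) \<le> norm h"
proof -
  let ?p = "zf_residual G j h"
  have "?p \<bullet> (h - ?p) = 0"
    unfolding zf_residual_def using gs_residual_orthogonal gs_residual_span by blast
  then have "(norm ?p)\<^sup>2 = ?p \<bullet> h" by (simp add: inner_diff_right power2_norm_eq_inner)
  also have "\<dots> \<le> norm ?p * norm h" by (rule norm_cauchy_schwarz)
  finally show ?thesis by (cases "?p = 0") (simp_all add: power2_eq_square)
qed

lemma vec_nth_measurable [measurable]:
  "(\<lambda>x. x $ i) \<in> borel_measurable (borel :: ('a::euclidean_space ^ 'n) measure)"
  by (intro borel_measurable_continuous_onI continuous_intros)

lemma smult_measurable [measurable]: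
  "(\<lambda>x. c *s x) \<in> borel_measurable (borel :: (complex ^ 'n) measure)"
proof -
  have "linear (\<lambda>x. c *s x :: complex ^ 'n)"
    by (rule linearI) (auto simp: vec_eq_iff algebra_simps)
  then show ?thesis
    by (intro borel_measurable_continuous_onI linear_continuous_on)
      (simp add: linear_conv_bounded_linear[symmetric])
qed

lemma hdot_measurable [measurable]:
  assumes [measurable]: "f \<in> borel_measurable N" "g \<in> borel_measurable N"
  shows "(\<lambda>p. hdot (f p) (g p)) \<in> borel_measurable N"
proof -
  have "hdot (f p) (g p) = of_real (f p \<bullet> g p) + \<i> * of_real ((\<i> *s f p) \<bullet> g p)" for p
    by (simp add: complex_eq_iff Re_hdot Im_hdot)
  then show ?thesis by simp
qed

text \<open>Measurability is required only of the rows other than \<open>j\<close>, so the lemma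
  applies to a sigma-algebra that knows the channels of the other home users but not that of the
  typical user.\<close>

lemma zf_residual_measurable:
  fixes G :: "'b \<Rightarrow> complex^'m^'k::finite"
  assumes G: "\<And>l. l \<noteq> j \<Longrightarrow> (\<lambda>p. G p $ l) \<in> borel_measurable N" and h: "h \<in> borel_measurable N"
  shows "(\<lambda>p. zf_residual (G p) j (h p)) \<in> borel_measurable N"
proof -
  have "(\<lambda>p. gs_residual (map (\<lambda>i. (\<lambda>(c, l). c *s (G p $ l)) i) (List.product [1, \<i>] (other_indices j))) (h p)) \<in> borel_measurable N"
  proof (rule gs_residual_measurable[OF _ h])
    fix i assume i: "i \<in> set (List.product [1, \<i>] (other_indices j))"
    obtain c l where [simp]: "i = (c, l)" by (cases i)
    have [measurable]: "(\<lambda>p. G p $ l) \<in> borel_measurable N" using i G by (auto simp: set_other_indices)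
    show "(\<lambda>p. (\<lambda>(c, l). c *s (G p $ l)) i) \<in> borel_measurable N" by simp
  qed
  then show ?thesis by (simp add: zf_residual_def)
qed

lemma zf_column_measurable [measurable]:
  assumes [measurable]: "G \<in> borel_measurable N"
  shows "(\<lambda>p. zf_column (G p) j) \<in> borel_measurable N"
proof -
  have [measurable]: "(\<lambda>p. zf_residual (G p) j (G p $ j)) \<in> borel_measurable N"
    by (rule zf_residual_measurable) measurable
  show ?thesis unfolding zf_column_eq sgn_div_norm by measurable
qed

lemma column_zf_matrix: "column j (zf_matrix G) = zf_column G j"
  by (simp add: column_def zf_matrix_def vec_eq_iff)

lemma norm_hrow_square: "(norm (hrow h W))\<^sup>2 = (\<Sum>j\<in>UNIV. (cmod (hdot h (column j W)))\<^sup>2)"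
  by (simp add: hrow_def norm_vec_def L2_set_def sum_nonneg)

text \<open>The squared modulus is the sum of the squared real inner products of \<open>z\<close>
  with \<open>w\<close> and with \<open>\<i> *s w\<close>. These vectors have equal length, and each
  accounts for half of the result.\<close>

lemma nn_integral_cscg_hdot_square:
  assumes v: "v > 0"
  shows "(\<integral>\<^sup>+z. ennreal ((cmod (hdot z w))\<^sup>2) \<partial>cscg v) = v * (norm w)\<^sup>2"
proof -
  have i: "(norm (\<i> *s w))\<^sup>2 = (norm w)\<^sup>2"
  proof -
    have "complex_of_real ((norm (\<i> *s w))\<^sup>2) = of_real ((norm w)\<^sup>2)"
      unfolding hdot_self[symmetric] by (simp add: hdot_smult_left hdot_smult_right)
    then show ?thesis by (simp only: of_real_eq_iff)
  qed
  have "(cmod (hdot z w))\<^sup>2 = (z \<bullet> w)\<^sup>2 + (z \<bullet> (\<i> *s w))\<^sup>2" for z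
  proof -
    have "cmod (hdot z w) = cmod (hdot w z)" using cnj_hdot[of z w] by (metis complex_mod_cnj)
    then show ?thesis by (simp add: cmod_power2 Re_hdot Im_hdot inner_commute)
  qed
  then have "(\<integral>\<^sup>+z. ennreal ((cmod (hdot z w))\<^sup>2) \<partial>cscg v) =
     (\<integral>\<^sup>+z. ennreal ((z \<bullet> w)\<^sup>2) + ennreal ((z \<bullet> (\<i> *s w))\<^sup>2) \<partial>cscg v)" by simp
  also have "\<dots> = ennreal (v / 2 * (norm w)\<^sup>2) + ennreal (v / 2 * (norm (\<i> *s w))\<^sup>2)"
    using v by (subst nn_integral_add) (auto simp: nn_integral_cscg_inner_square)
  also have "\<dots> = v * (norm w)\<^sup>2" using v by (simp add: i flip: ennreal_plus)
  finally show ?thesis .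
qed

lemma inverse_ennreal_mono:
  assumes "x \<le> y" shows "inverse (ennreal y) \<le> inverse (ennreal x)"
proof (cases "x > 0")
  case True
  then show ?thesis using assms by (simp add: inverse_ennreal ennreal_leI le_imp_inverse_le)
qed (simp add: ennreal_neg)

text \<open>Nulling \<open>CARD('k) - 1\<close> users costs twice as many real dimensions, which
  leaves \<open>2 * n\<close> with \<open>n - 1 = CARD('m) - CARD('k)\<close>. The assumption on the
  cardinalities is exactly \<open>n \<ge> 2\<close>, the condition for a finite inverse
  mean.\<close>

lemma nn_integral_cscg_inverse_zf_residual:
  fixes G :: "complex^'m^'k::finite"
  assumes v: "v > 0" and card: "CARD('m) \<ge> CARD('k) + 1"
  shows "(\<integral>\<^sup>+z. inverse (ennreal ((norm (zf_residual G j z))\<^sup>2)) \<partial>cscg v) \<le> 1 / (v * (real CARD('m) - real CARD('k)))"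
proof -
  define gs where "gs = map (\<lambda>(c, l). c *s (G $ l)) (List.product [1, \<i>] (other_indices j))"
  define n where "n = CARD('m) + 1 - CARD('k)"
  have "length gs + 2 * n \<le> DIM(complex^'m)"
  proof -
    have "length gs = 2 * (CARD('k) - 1)"
      by (simp add: gs_def length_product length_other_indices)
    moreover have "CARD('k) \<ge> 1" by (simp add: Suc_leI)
    ultimately show ?thesis using card by (simp only: n_def DIM_complex_vec)
  qed
  then obtain B where B: "pairwise orthogonal B" "\<And>x. x \<in> B \<Longrightarrow> norm x = 1" "card B = 2 * n"
    "\<And>h. (\<Sum>b\<in>B. (h \<bullet> b)\<^sup>2) \<le> (norm (gs_residual gs h))\<^sup>2"
    using orthonormal_below_gs_residual[of gs "2 * n"] by metis
  have "(\<integral>\<^sup>+z. inverse (ennreal ((norm (zf_residual G j z))\<^sup>2)) \<partial>cscg v) \<le>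
      (\<integral>\<^sup>+z. inverse (ennreal (\<Sum>b\<in>B. (z \<bullet> b)\<^sup>2)) \<partial>cscg v)"
    unfolding zf_residual_def gs_def[symmetric]
    by (intro nn_integral_mono inverse_ennreal_mono B(4))
  also have "\<dots> = 1 / (v * (real n - 1))"
    using card by (intro nn_integral_cscg_inverse_orthonormal[OF v B(1-3)]) (auto simp: n_def)
  also have "real n - 1 = real CARD('m) - real CARD('k)" using card by (simp add: n_def)
  finally show ?thesis .
qed

section \<open>Conditioning on the distances and the other channels\<close>

lemma nn_integral_cscg_measurable:
  fixes g :: "'a \<times> (complex^'m) \<Rightarrow> ennreal"
  assumes [measurable]: "v \<in> borel_measurable F" "g \<in> borel_measurable (F \<Otimes>\<^sub>M borel)"
  shows "(\<lambda>\<xi>. \<integral>\<^sup>+z. g (\<xi>, z) \<partial>cscg (v \<xi>)) \<in> borel_measurable F"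
proof -
  have "(\<lambda>\<xi>. \<integral>\<^sup>+z. ennreal (exp (- (norm z)\<^sup>2 / v \<xi>) / (pi * v \<xi>) ^ CARD('m)) * g (\<xi>, z) \<partial>lborel) \<in> borel_measurable F"
    by measurable
  moreover have "(\<integral>\<^sup>+z. g (\<xi>, z) \<partial>cscg (v \<xi>)) =
      (\<integral>\<^sup>+z. ennreal (exp (- (norm z)\<^sup>2 / v \<xi>) / (pi * v \<xi>) ^ CARD('m)) * g (\<xi>, z) \<partial>lborel)"
    if "\<xi> \<in> space F" for \<xi>
    using that by (intro nn_integral_cscg) simp
  ultimately show ?thesis by (simp cong: measurable_cong)
qed

lemma emeasure_cscg_measurable:
  fixes B :: "(complex^'m) set"
  assumes [measurable]: "v \<in> borel_measurable F" "B \<in> sets borel"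
  shows "(\<lambda>\<xi>. emeasure (cscg (v \<xi>)) B) \<in> borel_measurable F"
proof -
  have "(\<lambda>\<xi>. \<integral>\<^sup>+z. (\<lambda>p. indicator B (snd p)) (\<xi>, z) \<partial>cscg (v \<xi>)) \<in> borel_measurable F"
    by (rule nn_integral_cscg_measurable) measurable
  then show ?thesis by simp
qed

lemma emeasure_cscg_le_1:
  assumes "v \<ge> 0" shows "emeasure (cscg v) B \<le> 1"
proof (cases "v = 0")
  case False
  with assms interpret prob_space "cscg v" by (intro prob_space_cscg) simp
  show ?thesis by (rule emeasure_le_1)
qed (simp add: cscg_0)

lemma emeasure_cscg_eq_measure: "v \<ge> 0 \<Longrightarrow> emeasure (cscg v) B = ennreal (measure (cscg v) B)"
  using emeasure_cscg_le_1[of v B] by (intro emeasure_eq_ennreal_measure) (auto simp: top_unique)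

section \<open>From conditional laws to integrating out one channel\<close>

text \<open>If the \<open>A j\<close> are sigma-algebras on the same space, this is an
  intersection-stable generator of the sigma-algebra joining \<open>F\<close> and the blocks in
  \<open>J\<close>, and its members have the shape that conditional independence speaks
  about.\<close>

definition cylinder_sets :: "'w measure \<Rightarrow> ('i \<Rightarrow> 'w set set) \<Rightarrow> 'i set \<Rightarrow> 'w set set" where
  "cylinder_sets F A J = {C \<inter> (\<Inter>j\<in>J. D j) | C D. C \<in> sets F \<and> D \<in> Pi J A}"

lemma cylinder_sets_Pow: "cylinder_sets F A J \<subseteq> Pow (space F)"
  using sets.sets_into_space by (auto simp: cylinder_sets_def)

lemma cylinder_setsI:
  "C \<in> sets F \<Longrightarrow> (\<And>j. j \<in> J \<Longrightarrow> D j \<in> A j) \<Longrightarrow> C \<inter> (\<Inter>j\<in>J. D j) \<in> cylinder_sets F A J"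
  by (auto simp: cylinder_sets_def)

lemma Int_stable_cylinder_sets:
  assumes "\<And>j. j \<in> J \<Longrightarrow> A j = sets (N j)"
  shows "Int_stable (cylinder_sets F A J)"
proof (rule Int_stableI)
  fix a b assume "a \<in> cylinder_sets F A J" "b \<in> cylinder_sets F A J"
  then obtain C D C' D' where a: "a = C \<inter> (\<Inter>j\<in>J. D j)" "C \<in> sets F" "D \<in> Pi J A"
    and b: "b = C' \<inter> (\<Inter>j\<in>J. D' j)" "C' \<in> sets F" "D' \<in> Pi J A"
    by (auto simp: cylinder_sets_def)
  have "(C \<inter> C') \<inter> (\<Inter>j\<in>J. D j \<inter> D' j) \<in> cylinder_sets F A J"
  proof (rule cylinder_setsI)
    fix j assume "j \<in> J"
    then have "D j \<in> sets (N j)" "D' j \<in> sets (N j)" using a(3) b(3) assms[of j] by auto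
    then show "D j \<inter> D' j \<in> A j" using assms[OF \<open>j \<in> J\<close>] by simp
  qed (use a b in auto)
  moreover have "a \<inter> b = (C \<inter> C') \<inter> (\<Inter>j\<in>J. D j \<inter> D' j)" unfolding a(1) b(1) by auto
  ultimately show "a \<inter> b \<in> cylinder_sets F A J" by simp
qed

text \<open>Conditional independence splits the conditional probability of the event of
  \<open>Z\<close> and the blocks into the kernel and the conditional probability of the blocks.
  Integrating over \<open>C\<close> in \<open>F\<close> then removes the conditioning.\<close>

lemma (in prob_space) emeasure_cylinder_cond_distr:
  fixes Z :: "'a \<Rightarrow> complex^'m"
  assumes sub: "subalgebra M F"
    and Z: "has_cond_distr M F borel Z (\<lambda>\<xi>. cscg (v \<xi>))"
    and v[measurable]: "v \<in> borel_measurable F" and v0: "\<And>\<xi>. v \<xi> \<ge> 0"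
    and indep: "cond_indep_sets M F A I"
    and J: "insert z J \<subseteq> I" "z \<notin> J" "J \<noteq> {}" "finite J"
    and Az: "A z = sets (vimage_algebra (space M) Z borel)"
    and X: "X \<in> cylinder_sets F A J" and B[measurable]: "B \<in> sets borel"
  shows "emeasure M (X \<inter> (Z -` B \<inter> space M)) = (\<integral>\<^sup>+\<xi>. emeasure (cscg (v \<xi>)) B * indicator X \<xi> \<partial>M)"
proof -
  interpret F: finite_measure_subalgebra M F by standard (rule sub)
  interpret F: sigma_finite_subalgebra M F by (rule F.sigma_finite_subalgebra_axioms)
  obtain C D where X: "X = C \<inter> (\<Inter>j\<in>J. D j)" and C[measurable]: "C \<in> sets F" and D: "D \<in> Pi J A"
    using X by (auto simp: cylinder_sets_def)
  have A: "A i \<subseteq> sets M" if "i \<in> I" for i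
    using indep that by (auto simp: cond_indep_sets_def)
  have CM[measurable]: "C \<in> sets M" using sub C by (auto simp: subalgebra_def)
  have Zm[measurable]: "Z \<in> borel_measurable M" using Z by (simp add: has_cond_distr_def)
  have vM[measurable]: "v \<in> borel_measurable M" by (rule measurable_from_subalg[OF sub v])
  let ?Q = "\<Inter>j\<in>J. D j" and ?Z = "Z -` B \<inter> space M"
  have QM[measurable]: "?Q \<in> sets M" using J D A by (intro sets.finite_INT) auto
  let ?\<kappa> = "\<lambda>\<xi>. measure (cscg (v \<xi>)) B"
  let ?r = "real_cond_exp M F (indicator ?Q)"
  have \<kappa>F[measurable]: "?\<kappa> \<in> borel_measurable F"
    unfolding measure_def by (intro measurable_compose[OF emeasure_cscg_measurable[OF v B]]) simp
  have \<kappa>M[measurable]: "?\<kappa> \<in> borel_measurable M" by (rule measurable_from_subalg[OF sub \<kappa>F])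
  have \<kappa>1: "?\<kappa> \<xi> \<le> 1" for \<xi>
    using emeasure_cscg_le_1[OF v0, of \<xi> B] unfolding emeasure_cscg_eq_measure[OF v0] by simp
  have distr: "AE \<xi> in M. real_cond_exp M F (indicator ?Z) \<xi> = ?\<kappa> \<xi>"
    using Z B by (simp add: has_cond_distr_def)
  \<comment> \<open>The product formula is used for \<open>insert z J\<close> and again for
    \<open>J\<close>; the second use collects the factors other than \<open>z\<close> into
    \<open>?r\<close>.\<close>
  define D' where "D' = D(z := ?Z)"
  have "?Z \<in> A z" unfolding Az by (rule in_vimage_algebra) simp
  then have D': "D' \<in> Pi (insert z J) A" using D J(2) by (auto simp: D'_def Pi_iff)
  have INT: "(\<Inter>j\<in>insert z J. D' j) = ?Z \<inter> ?Q"
    using J(2) by (auto simp: D'_def)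
  have "AE \<xi> in M. real_cond_exp M F (indicator (\<Inter>j\<in>insert z J. D' j)) \<xi> =
      (\<Prod>j\<in>insert z J. real_cond_exp M F (indicator (D' j)) \<xi>)"
    using indep J D' unfolding cond_indep_sets_def by blast
  moreover have "AE \<xi> in M. ?r \<xi> = (\<Prod>j\<in>J. real_cond_exp M F (indicator (D j)) \<xi>)"
    using indep J D unfolding cond_indep_sets_def by blast
  ultimately have joint: "AE \<xi> in M. real_cond_exp M F (indicator (?Z \<inter> ?Q)) \<xi> = ?\<kappa> \<xi> * ?r \<xi>"
    using distr
  proof eventually_elim
    fix \<xi>
    assume 1: "real_cond_exp M F (indicator (\<Inter>j\<in>insert z J. D' j)) \<xi> =
      (\<Prod>j\<in>insert z J. real_cond_exp M F (indicator (D' j)) \<xi>)"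
      and 2: "?r \<xi> = (\<Prod>j\<in>J. real_cond_exp M F (indicator (D j)) \<xi>)"
      and 3: "real_cond_exp M F (indicator ?Z) \<xi> = ?\<kappa> \<xi>"
    have "(\<Prod>j\<in>J. real_cond_exp M F (indicator (D' j)) \<xi>) = (\<Prod>j\<in>J. real_cond_exp M F (indicator (D j)) \<xi>)"
      using J(2) by (intro prod.cong) (auto simp: D'_def)
    moreover have "D' z = ?Z" by (simp add: D'_def)
    ultimately show "real_cond_exp M F (indicator (?Z \<inter> ?Q)) \<xi> = ?\<kappa> \<xi> * ?r \<xi>"
      using 1 2 3 J(2,4) unfolding INT by simp
  qed
  have bnd: "integrable M f" if "f \<in> borel_measurable M" "\<And>\<xi>. \<bar>f \<xi>\<bar> \<le> 1" for f :: "'a \<Rightarrow> real"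
    by (rule integrable_const_bound[of _ 1]) (use that in auto)
  have "(\<integral>\<xi>. indicator C \<xi> * indicator (?Z \<inter> ?Q) \<xi> \<partial>M) = (\<integral>\<xi>. indicator C \<xi> * real_cond_exp M F (indicator (?Z \<inter> ?Q)) \<xi> \<partial>M)"
    by (rule F.real_cond_exp_intg(2)[symmetric]) (auto intro!: bnd split: split_indicator)
  also have "\<dots> = (\<integral>\<xi>. (indicator C \<xi> * ?\<kappa> \<xi>) * ?r \<xi> \<partial>M)"
    using joint by (intro integral_cong_AE) (auto simp: mult.assoc elim!: eventually_mono)
  \<comment> \<open>The factor in front of \<open>?r\<close> is \<open>F\<close>-measurable, so the
    averaging property puts the indicator back in place of its conditional expectation.\<close>
  also have "\<dots> = (\<integral>\<xi>. (indicator C \<xi> * ?\<kappa> \<xi>) * indicator ?Q \<xi> \<partial>M)"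
    using \<kappa>1 by (intro F.real_cond_exp_intg(2)) (auto intro!: bnd split: split_indicator)
  finally have eq: "(\<integral>\<xi>. indicator C \<xi> * indicator (?Z \<inter> ?Q) \<xi> \<partial>M) = (\<integral>\<xi>. (indicator C \<xi> * ?\<kappa> \<xi>) * indicator ?Q \<xi> \<partial>M)" .
  have XM[measurable]: "X \<in> sets M" unfolding X by simp
  have "emeasure M (X \<inter> ?Z) = ennreal (\<integral>\<xi>. indicator (X \<inter> ?Z) \<xi> \<partial>M)"
    by (simp add: emeasure_eq_measure)
  also have "(\<integral>\<xi>. (indicator (X \<inter> ?Z) \<xi> :: real) \<partial>M) = (\<integral>\<xi>. indicator C \<xi> * indicator (?Z \<inter> ?Q) \<xi> \<partial>M)"
    unfolding X by (intro Bochner_Integration.integral_cong) (auto simp: indicator_def)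
  also have "\<dots> = (\<integral>\<xi>. ?\<kappa> \<xi> * indicator X \<xi> \<partial>M)"
    unfolding eq X by (intro Bochner_Integration.integral_cong) (auto simp: indicator_def)
  also have "ennreal \<dots> = (\<integral>\<^sup>+\<xi>. ?\<kappa> \<xi> * indicator X \<xi> \<partial>M)"
    using \<kappa>1 by (intro nn_integral_eq_integral[symmetric] bnd) (auto simp: indicator_def)
  also have "\<dots> = (\<integral>\<^sup>+\<xi>. emeasure (cscg (v \<xi>)) B * indicator X \<xi> \<partial>M)"
    by (intro nn_integral_cong) (simp add: emeasure_cscg_eq_measure[OF v0] ennreal_mult ennreal_indicator)
  finally show ?thesis .
qed

text \<open>As functions of \<open>X\<close> both sides are finite measures, and they agree on an
  intersection-stable generator that contains the whole space.\<close>

lemma (in prob_space) emeasure_sigma_cylinder_cond_distr: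
  fixes Z :: "'a \<Rightarrow> complex^'m"
  assumes sub: "subalgebra M F"
    and Z: "has_cond_distr M F borel Z (\<lambda>\<xi>. cscg (v \<xi>))"
    and v[measurable]: "v \<in> borel_measurable F" and v0: "\<And>\<xi>. v \<xi> \<ge> 0"
    and indep: "cond_indep_sets M F A I"
    and J: "insert z J \<subseteq> I" "z \<notin> J" "J \<noteq> {}" "finite J"
    and Az: "A z = sets (vimage_algebra (space M) Z borel)"
    and AN: "\<And>j. j \<in> J \<Longrightarrow> A j = sets (N j)" "\<And>j. j \<in> J \<Longrightarrow> space (N j) = space M"
    and X: "X \<in> sets (sigma (space M) (cylinder_sets F A J))" and B[measurable]: "B \<in> sets borel"
  shows "emeasure M (X \<inter> (Z -` B \<inter> space M)) = (\<integral>\<^sup>+\<xi>. emeasure (cscg (v \<xi>)) B * indicator X \<xi> \<partial>M)"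
    and "sets (sigma (space M) (cylinder_sets F A J)) \<subseteq> sets M"
proof -
  let ?E = "cylinder_sets F A J" and ?Z = "Z -` B \<inter> space M"
  let ?G = "sigma (space M) ?E"
  have spF: "space F = space M" using sub by (simp add: subalgebra_def)
  have E: "?E \<subseteq> Pow (space M)" using cylinder_sets_Pow[of F A J] spF by simp
  have A: "A i \<subseteq> sets M" if "i \<in> I" for i
    using indep that by (auto simp: cond_indep_sets_def)
  have EM: "?E \<subseteq> sets M"
  proof
    fix X assume "X \<in> ?E"
    then obtain C D where "X = C \<inter> (\<Inter>j\<in>J. D j)" "C \<in> sets F" "D \<in> Pi J A" by (auto simp: cylinder_sets_def)
    moreover from this have "D j \<in> sets M" if "j \<in> J" for j
      using that J(1) A by blast
    ultimately show "X \<in> sets M"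
      using sub J(3,4) by (auto simp: subalgebra_def intro!: sets.Int sets.finite_INT)
  qed
  then show GM: "sets ?G \<subseteq> sets M" using E by (simp add: sets.sigma_sets_subset)
  have Zm[measurable]: "Z \<in> borel_measurable M" using Z by (simp add: has_cond_distr_def)
  have vM[measurable]: "v \<in> borel_measurable M" by (rule measurable_from_subalg[OF sub v])
  have \<kappa>M[measurable]: "(\<lambda>\<xi>. emeasure (cscg (v \<xi>)) B) \<in> borel_measurable M"
    by (rule emeasure_cscg_measurable) measurable
  \<comment> \<open>The restriction to \<open>?G\<close> is needed because the uniqueness theorem
    compares measures whose measurable sets are exactly those generated by
    \<open>?E\<close>.\<close>
  define m1 where "m1 = restr_to_subalg (density M (indicator ?Z)) ?G"
  define m2 where "m2 = restr_to_subalg (density M (\<lambda>\<xi>. emeasure (cscg (v \<xi>)) B)) ?G"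
  have sub1: "subalgebra (density M f) ?G" for f
    using GM by (simp add: subalgebra_def space_measure_of_conv)
  have m1: "emeasure m1 X = emeasure M (X \<inter> ?Z)" if "X \<in> sets ?G" for X
  proof -
    have "X \<in> sets M" using that GM by auto
    then have "emeasure m1 X = (\<integral>\<^sup>+\<xi>. indicator (X \<inter> ?Z) \<xi> \<partial>M)"
      using that unfolding m1_def emeasure_restr_to_subalg[OF sub1 that]
      by (subst emeasure_density) (auto simp del: nn_integral_indicator nn_integral_indicator' intro!: nn_integral_cong split: split_indicator)
    then show ?thesis using \<open>X \<in> sets M\<close> by simp
  qed
  have m2: "emeasure m2 X = (\<integral>\<^sup>+\<xi>. emeasure (cscg (v \<xi>)) B * indicator X \<xi> \<partial>M)" if "X \<in> sets ?G" for X
  proof -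
    have "X \<in> sets M" using that GM by auto
    then show ?thesis
      unfolding m2_def emeasure_restr_to_subalg[OF sub1 that] by (subst emeasure_density) auto
  qed
  have EG: "?E \<subseteq> sets ?G" using E by auto
  have "m1 = m2"
  proof (rule measure_eqI_generator_eq[where \<Omega>="space M" and E="?E" and A="\<lambda>_. space M"])
    show "Int_stable ?E" by (rule Int_stable_cylinder_sets[OF AN(1)])
    show "?E \<subseteq> Pow (space M)" by fact
    show "emeasure m1 X = emeasure m2 X" if "X \<in> ?E" for X
    proof -
      have "X \<in> sets ?G" using that EG by auto
      then show ?thesis
        by (simp only: m1 m2 emeasure_cylinder_cond_distr[OF sub Z v v0 indep J Az that B])
    qed
    show "sets m1 = sigma_sets (space M) ?E" "sets m2 = sigma_sets (space M) ?E"
      unfolding m1_def m2_def using E by (simp_all add: sets_restr_to_subalg[OF sub1])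
    have "space M \<inter> (\<Inter>j\<in>J. space M) \<in> ?E"
    proof (rule cylinder_setsI)
      show "space M \<in> A j" if "j \<in> J" for j using AN[OF that] sets.top[of "N j"] by simp
    qed (use sets.top[of F] spF in simp)
    then show spE: "range (\<lambda>_. space M) \<subseteq> ?E" using J(3) by simp
    have "space M \<in> sets ?G" using spE EG by auto
    then show "emeasure m1 (space M) \<noteq> \<infinity>" by (simp add: m1)
  qed simp
  then show "emeasure M (X \<inter> ?Z) = (\<integral>\<^sup>+\<xi>. emeasure (cscg (v \<xi>)) B * indicator X \<xi> \<partial>M)"
    using m1[OF X] m2[OF X] by simp
qed

text \<open>The law of the pair of sample point and \<open>Z\<close> is compared with the measure of
  density \<open>d\<close> over the product of the restricted probability and Lebesgue measure;
  \<open>rect\<close> is their agreement on rectangles. Keeping the sample point itself as first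
  component lets \<open>g\<close> depend on any \<open>G\<close>-measurable data.\<close>

lemma (in prob_space) nn_integral_freeze:
  fixes Z :: "'a \<Rightarrow> complex^'m" and g :: "'a \<times> (complex^'m) \<Rightarrow> ennreal"
  assumes sub: "subalgebra M G"
    and Z[measurable]: "Z \<in> borel_measurable M" and v[measurable]: "v \<in> borel_measurable G"
    and v0: "\<And>\<xi>. v \<xi> \<ge> 0"
    and rect: "\<And>X B. X \<in> sets G \<Longrightarrow> B \<in> sets borel \<Longrightarrow>
      emeasure M (X \<inter> (Z -` B \<inter> space M)) = (\<integral>\<^sup>+\<xi>. emeasure (cscg (v \<xi>)) B * indicator X \<xi> \<partial>M)"
    and g[measurable]: "g \<in> borel_measurable (G \<Otimes>\<^sub>M borel)"
  shows "(\<integral>\<^sup>+\<xi>. g (\<xi>, Z \<xi>) \<partial>M) = (\<integral>\<^sup>+\<xi>. (\<integral>\<^sup>+z. g (\<xi>, z) \<partial>cscg (v \<xi>)) \<partial>M)"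
proof -
  define d where "d p = ennreal (exp (- (norm (snd p))\<^sup>2 / v (fst p)) / (pi * v (fst p)) ^ CARD('m))"
    for p :: "'a \<times> (complex^'m)"
  have d[measurable]: "d \<in> borel_measurable (G \<Otimes>\<^sub>M borel)"
    unfolding d_def by measurable
  have spG: "space G = space M" using sub by (simp add: subalgebra_def)
  have id[measurable]: "(\<lambda>\<xi>. \<xi>) \<in> M \<rightarrow>\<^sub>M G"
    using sub by (auto simp: subalgebra_def intro!: measurableI)
  let ?R = "restr_to_subalg M G"
  have R[measurable_cong]: "sets ?R = sets G" by (rule sets_restr_to_subalg[OF sub])
  have sets_RL[measurable_cong]: "sets (?R \<Otimes>\<^sub>M (lborel :: (complex^'m) measure)) = sets (G \<Otimes>\<^sub>M borel)"
    by (intro sets_pair_measure_cong R) simp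
  define P where "P = distr M (G \<Otimes>\<^sub>M borel) (\<lambda>\<xi>. (\<xi>, Z \<xi>))"
  define Q where "Q = density (?R \<Otimes>\<^sub>M (lborel :: (complex^'m) measure)) d"
  have Q_int: "(\<integral>\<^sup>+p. f p \<partial>Q) = (\<integral>\<^sup>+\<xi>. (\<integral>\<^sup>+z. f (\<xi>, z) \<partial>cscg (v \<xi>)) \<partial>M)"
    if f[measurable]: "f \<in> borel_measurable (G \<Otimes>\<^sub>M borel)" for f :: "'a \<times> (complex^'m) \<Rightarrow> ennreal"
  proof -
    have "(\<integral>\<^sup>+p. f p \<partial>Q) = (\<integral>\<^sup>+p. d p * f p \<partial>(?R \<Otimes>\<^sub>M lborel))"
      unfolding Q_def by (subst nn_integral_density) auto
    also have "\<dots> = (\<integral>\<^sup>+\<xi>. (\<integral>\<^sup>+z. d (\<xi>, z) * f (\<xi>, z) \<partial>lborel) \<partial>?R)"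
      by (rule lborel.nn_integral_fst[symmetric]) measurable
    also have "\<dots> = (\<integral>\<^sup>+\<xi>. (\<integral>\<^sup>+z. d (\<xi>, z) * f (\<xi>, z) \<partial>lborel) \<partial>M)"
      by (rule nn_integral_subalgebra2[OF sub]) measurable
    also have "\<dots> = (\<integral>\<^sup>+\<xi>. (\<integral>\<^sup>+z. f (\<xi>, z) \<partial>cscg (v \<xi>)) \<partial>M)"
    proof (rule nn_integral_cong)
      fix \<xi> assume "\<xi> \<in> space M"
      then have "(\<lambda>z. f (\<xi>, z)) \<in> borel_measurable borel"
        using measurable_Pair2[OF f] spG by auto
      then show "(\<integral>\<^sup>+z. d (\<xi>, z) * f (\<xi>, z) \<partial>lborel) = (\<integral>\<^sup>+z. f (\<xi>, z) \<partial>cscg (v \<xi>))"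
        by (simp add: nn_integral_cscg d_def)
    qed
    finally show ?thesis .
  qed
  have "P = Q"
  proof (rule measure_eqI_generator_eq[where \<Omega>="space (G \<Otimes>\<^sub>M (borel :: (complex^'m) measure))"
        and E="{a \<times> b |a b. a \<in> sets G \<and> b \<in> sets (borel :: (complex^'m) measure)}"
        and A="\<lambda>_. space (G \<Otimes>\<^sub>M (borel :: (complex^'m) measure))"])
    let ?E = "{a \<times> b |a b. a \<in> sets G \<and> b \<in> sets (borel :: (complex^'m) measure)}"
    show "Int_stable ?E" by (rule Int_stable_pair_measure_generator)
    show "?E \<subseteq> Pow (space (G \<Otimes>\<^sub>M (borel :: (complex^'m) measure)))"
      using sets.space_closed[of G] by (auto simp: space_pair_measure)
    show "sets P = sigma_sets (space (G \<Otimes>\<^sub>M (borel :: (complex^'m) measure))) ?E"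
      by (simp add: P_def sets_pair_measure space_pair_measure)
    show "sets Q = sigma_sets (space (G \<Otimes>\<^sub>M (borel :: (complex^'m) measure))) ?E"
      by (simp only: Q_def sets_density sets_RL) (simp add: sets_pair_measure space_pair_measure)
    show "range (\<lambda>_. space (G \<Otimes>\<^sub>M (borel :: (complex^'m) measure))) \<subseteq> ?E"
      unfolding space_pair_measure by (intro image_subsetI CollectI exI conjI refl) auto
    show "emeasure P (space (G \<Otimes>\<^sub>M (borel :: (complex^'m) measure))) \<noteq> \<infinity>"
      by (simp add: P_def emeasure_distr)
    fix X assume "X \<in> ?E"
    then obtain a b where X: "X = a \<times> b" and a[measurable]: "a \<in> sets G" and b[measurable]: "b \<in> sets (borel :: (complex^'m) measure)"
      by auto
    have "emeasure P X = emeasure M (a \<inter> (Z -` b \<inter> space M))"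
      unfolding P_def X by (subst emeasure_distr) (auto intro!: arg_cong[where f="emeasure M"])
    also have "\<dots> = (\<integral>\<^sup>+\<xi>. (\<integral>\<^sup>+z. indicator (a \<times> b) (\<xi>, z) \<partial>cscg (v \<xi>)) \<partial>M)"
      unfolding rect[OF a b]
      by (intro nn_integral_cong) (auto simp: indicator_times nn_integral_cmult mult.commute)
    also have "\<dots> = emeasure Q X"
      unfolding X by (subst Q_int[symmetric]) (auto simp: Q_def sets_RL)
    finally show "emeasure P X = emeasure Q X" .
  qed simp
  moreover have "(\<integral>\<^sup>+\<xi>. g (\<xi>, Z \<xi>) \<partial>M) = (\<integral>\<^sup>+p. g p \<partial>P)"
    unfolding P_def by (subst nn_integral_distr) auto
  ultimately show ?thesis by (simp add: Q_int)
qed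

section \<open>The nearest point of a planar Poisson process\<close>

lemma poisson_sums: "(\<lambda>n. m ^ n / fact n * exp (- m)) sums (1 :: real)"
  using sums_mult2[OF exp_converges[of m], of "exp (- m)"]
  by (simp add: divide_inverse mult_ac exp_minus_inverse)

lemma poisson_mean_sums: "(\<lambda>n. real n * (m ^ n / fact n * exp (- m))) sums (m :: real)"
proof -
  have "(\<lambda>n. m * (m ^ n / fact n * exp (- m))) sums (m * 1)"
    by (rule sums_mult[OF poisson_sums])
  moreover have "m * (m ^ n / fact n * exp (- m)) = real (Suc n) * (m ^ Suc n / fact (Suc n) * exp (- m))" for n
    by (simp add: field_simps del: of_nat_Suc)
  ultimately have "(\<lambda>n. real (Suc n) * (m ^ Suc n / fact (Suc n) * exp (- m))) sums m"
    by (simp only: mult_1_right)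
  then show ?thesis by (subst (asm) sums_Suc_iff) simp
qed

lemma poisson_first_sums: "(\<lambda>n. (if n = 0 then 1 else 0) * (m ^ n / fact n * exp (- m))) sums (exp (- m) :: real)"
proof -
  have "(\<lambda>n. (if n = 0 then 1 else 0) * (m ^ n / fact n * exp (- m))) =
      (\<lambda>n. if n = 0 then m ^ n / fact n * exp (- m) else 0)"
    by auto
  then show ?thesis using sums_single[of 0 "\<lambda>n. m ^ n / fact n * exp (- m)"] by simp
qed

lemma measure_ball_plane: "r \<ge> 0 \<Longrightarrow> measure lborel (ball 0 r :: (real^2) set) = pi * r\<^sup>2"
  by (simp add: content_ball unit_ball_vol_2)

lemma measure_annulus:
  assumes "0 \<le> r" "r \<le> r'"
  shows "measure lborel (ball 0 r' - ball 0 r :: (real^2) set) = pi * (r'\<^sup>2 - r\<^sup>2)"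
proof -
  have "measure lborel (ball 0 r' - ball 0 r :: (real^2) set) =
      measure lborel (ball 0 r' :: (real^2) set) - measure lborel (ball 0 r :: (real^2) set)"
    using assms emeasure_bounded_finite[OF bounded_ball[of "0::real^2" r']]
    by (intro measure_Diff) (auto simp: less_top)
  then show ?thesis using assms by (simp add: measure_ball_plane algebra_simps)
qed

lemma suminf_indicator_card:
  assumes "finite S" shows "(\<Sum>i. indicator S i :: ennreal) = of_nat (card S)"
proof -
  have "(\<Sum>i. indicator S i :: ennreal) = (\<Sum>i\<in>S. indicator S i)"
    by (rule suminf_finite) (use assms in auto)
  then show ?thesis by simp
qed

locale planar_ppp = prob_space M
  for M :: "'w measure" and lam :: real and \<Psi> :: "'w \<Rightarrow> (real^2) set" and X :: "nat \<Rightarrow> 'w \<Rightarrow> real^2" +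
  assumes lam_pos: "lam > 0"
    and ppp: "homogeneous_ppp M lam \<Psi>"
    and X_measurable [measurable]: "\<And>i. X i \<in> borel_measurable M"
    and X_enumerates: "AE \<xi> in M. bij_betw (\<lambda>i. X i \<xi>) UNIV (\<Psi> \<xi>)"
    and X0_closest: "AE \<xi> in M. \<forall>y\<in>\<Psi> \<xi>. norm (X 0 \<xi>) \<le> norm y"
begin

lemma finite_points: "\<xi> \<in> space M \<Longrightarrow> bounded B \<Longrightarrow> finite (\<Psi> \<xi> \<inter> B)"
  using ppp by (simp add: homogeneous_ppp_def)

lemma count_measurable:
  "B \<in> sets borel \<Longrightarrow> bounded B \<Longrightarrow> (\<lambda>\<xi>. card (\<Psi> \<xi> \<inter> B)) \<in> M \<rightarrow>\<^sub>M count_space UNIV"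
  using ppp by (simp add: homogeneous_ppp_def)

lemma prob_count:
  assumes "B \<in> sets borel" "bounded B" "lam * measure lborel B = m"
  shows "prob {\<xi>\<in>space M. card (\<Psi> \<xi> \<inter> B) = n} = m ^ n / fact n * exp (- m)"
  using ppp assms by (auto simp: homogeneous_ppp_def)

lemma nn_integral_count:
  assumes B: "B \<in> sets borel" "bounded B" "lam * measure lborel B = m"
    and f: "\<And>n. f n \<ge> 0" and sums: "(\<lambda>n. f n * (m ^ n / fact n * exp (- m))) sums s"
  shows "(\<integral>\<^sup>+\<xi>. ennreal (f (card (\<Psi> \<xi> \<inter> B))) \<partial>M) = ennreal s"
proof -
  have m: "m \<ge> 0" using B(3) lam_pos by (metis less_imp_le measure_nonneg mult_nonneg_nonneg)
  have [measurable]: "(\<lambda>\<xi>. card (\<Psi> \<xi> \<inter> B)) \<in> M \<rightarrow>\<^sub>M count_space UNIV"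
    by (rule count_measurable) (use B in auto)
  let ?A = "\<lambda>n. {\<xi>\<in>space M. card (\<Psi> \<xi> \<inter> B) = n}"
  have "ennreal (f (card (\<Psi> \<xi> \<inter> B))) = (\<Sum>n. ennreal (f n) * indicator (?A n) \<xi>)" if "\<xi> \<in> space M" for \<xi>
  proof -
    have "(\<Sum>n. ennreal (f n) * indicator (?A n) \<xi>) =
        (\<Sum>n\<in>{card (\<Psi> \<xi> \<inter> B)}. ennreal (f n) * indicator (?A n) \<xi>)"
      by (rule suminf_finite) (auto simp: indicator_def)
    then show ?thesis using that by simp
  qed
  then have "(\<integral>\<^sup>+\<xi>. ennreal (f (card (\<Psi> \<xi> \<inter> B))) \<partial>M) = (\<integral>\<^sup>+\<xi>. (\<Sum>n. ennreal (f n) * indicator (?A n) \<xi>) \<partial>M)"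
    by (intro nn_integral_cong) simp
  also have "\<dots> = (\<Sum>n. \<integral>\<^sup>+\<xi>. ennreal (f n) * indicator (?A n) \<xi> \<partial>M)"
    by (rule nn_integral_suminf) measurable
  also have "\<dots> = (\<Sum>n. ennreal (f n * (m ^ n / fact n * exp (- m))))"
    using m f by (intro suminf_cong)
      (simp add: nn_integral_cmult_indicator emeasure_eq_measure prob_count[OF B] ennreal_mult[symmetric])
  also have "\<dots> = ennreal s" using f m sums by (intro suminf_ennreal_eq) auto
  finally show ?thesis .
qed

lemma nn_integral_count_eq_0:
  assumes "B \<in> sets borel" "bounded B" "lam * measure lborel B = m"
  shows "(\<integral>\<^sup>+\<xi>. ennreal (if card (\<Psi> \<xi> \<inter> B) = 0 then 1 else 0) \<partial>M) = exp (- m)"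
  by (rule nn_integral_count[OF assms, where f="\<lambda>n. if n = 0 then 1 else 0"]) (use poisson_first_sums in auto)

lemma nn_integral_count_neq_0:
  assumes "B \<in> sets borel" "bounded B" "lam * measure lborel B = m"
  shows "(\<integral>\<^sup>+\<xi>. ennreal (if card (\<Psi> \<xi> \<inter> B) = 0 then 0 else 1) \<partial>M) = 1 - exp (- m)"
proof (rule nn_integral_count[OF assms, where f="\<lambda>n. if n = 0 then 0 else 1"])
  show "(\<lambda>n. (if n = 0 then 0 else 1) * (m ^ n / fact n * exp (- m))) sums (1 - exp (- m))"
    using sums_diff[OF poisson_sums[of m] poisson_first_sums[of m]]
    by (rule sums_cong[THEN iffD1, rotated]) auto
qed auto

lemma nn_integral_count_mean:
  assumes "B \<in> sets borel" "bounded B" "lam * measure lborel B = m"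
  shows "(\<integral>\<^sup>+\<xi>. ennreal (real (card (\<Psi> \<xi> \<inter> B))) \<partial>M) = m"
  by (rule nn_integral_count[OF assms, where f=real]) (use poisson_mean_sums in auto)

text \<open>Truncated subtraction gives 0 instead of -1 for an empty region, whence the correction
  \<open>exp (- m)\<close>. The excess counts the points that accompany the nearest one in its
  annulus.\<close>

lemma nn_integral_count_excess:
  assumes "B \<in> sets borel" "bounded B" "lam * measure lborel B = m"
  shows "(\<integral>\<^sup>+\<xi>. ennreal (real (card (\<Psi> \<xi> \<inter> B) - 1)) \<partial>M) = m - 1 + exp (- m)"
proof (rule nn_integral_count[OF assms, where f="\<lambda>n. real (n - 1)"])
  show "(\<lambda>n. real (n - 1) * (m ^ n / fact n * exp (- m))) sums (m - 1 + exp (- m))"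
    using sums_add[OF sums_diff[OF poisson_mean_sums[of m] poisson_sums[of m]] poisson_first_sums[of m]]
  proof (rule sums_cong[THEN iffD1, rotated])
    show "real n * (m ^ n / fact n * exp (- m)) - m ^ n / fact n * exp (- m) +
       (if n = 0 then 1 else 0) * (m ^ n / fact n * exp (- m)) = real (n - 1) * (m ^ n / fact n * exp (- m))" for n
      by (cases n) (auto simp: algebra_simps add_divide_distrib)
  qed
qed auto

text \<open>The three regions will be a disc, the annulus around it that holds the nearest point,
  and a further annulus up to the dilated radius.\<close>

lemma nn_integral_three_counts:
  fixes f g h :: "nat \<Rightarrow> ennreal"
  assumes B: "B0 \<in> sets borel" "bounded B0" "B1 \<in> sets borel" "bounded B1" "B2 \<in> sets borel" "bounded B2"
    and disj: "B0 \<inter> B1 = {}" "B0 \<inter> B2 = {}" "B1 \<inter> B2 = {}"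
  shows "(\<integral>\<^sup>+\<xi>. f (card (\<Psi> \<xi> \<inter> B0)) * g (card (\<Psi> \<xi> \<inter> B1)) * h (card (\<Psi> \<xi> \<inter> B2)) \<partial>M) =
    (\<integral>\<^sup>+\<xi>. f (card (\<Psi> \<xi> \<inter> B0)) \<partial>M) * (\<integral>\<^sup>+\<xi>. g (card (\<Psi> \<xi> \<inter> B1)) \<partial>M) *
    (\<integral>\<^sup>+\<xi>. h (card (\<Psi> \<xi> \<inter> B2)) \<partial>M)"
proof -
  define B where "B = (\<lambda>i::nat. if i = 0 then B0 else if i = 1 then B1 else B2)"
  define F where "F = (\<lambda>i::nat. if i = 0 then f else if i = 1 then g else h)"
  have "disjoint_family_on B {0, 1, 2}"
    using disj by (auto simp: disjoint_family_on_def B_def)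
  then have "indep_vars (\<lambda>_. count_space UNIV) (\<lambda>i \<xi>. card (\<Psi> \<xi> \<inter> B i)) {0, 1, 2}"
    using ppp assms unfolding homogeneous_ppp_def by (auto simp: B_def)
  then have "indep_vars (\<lambda>_. borel) (\<lambda>i \<xi>. F i (card (\<Psi> \<xi> \<inter> B i))) {0, 1, 2}"
    by (rule indep_vars_compose2) simp
  from indep_vars_nn_integral[OF _ this] show ?thesis
    by (simp add: F_def B_def mult.assoc)
qed

lemma X_in_points: "AE \<xi> in M. \<xi> \<in> space M \<and> (\<forall>i. X i \<xi> \<in> \<Psi> \<xi> \<and> norm (X 0 \<xi>) \<le> norm (X i \<xi>)) \<and> inj (\<lambda>i. X i \<xi>)"
  using X_enumerates X0_closest AE_space
  by eventually_elim (auto simp: bij_betw_def)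

section \<open>Distance of the nearest point\<close>

text \<open>The nearest point lies in a closed disc exactly when the disc is not empty, so the
  distribution function is one minus a void probability. Squaring the distance makes the area, and
  hence the exponent, linear.\<close>

lemma nearest_distributed:
  "distributed M lborel (\<lambda>\<xi>. (norm (X 0 \<xi>))\<^sup>2) (exponential_density (pi * lam))"
proof (rule exponential_distributedI)
  fix a :: real assume a: "0 \<le> a"
  let ?B = "cball 0 (sqrt a) :: (real^2) set"
  have m: "lam * measure lborel ?B = pi * lam * a"
    using a by (simp add: content_cball unit_ball_vol_2)
  have [measurable]: "(\<lambda>\<xi>. card (\<Psi> \<xi> \<inter> ?B)) \<in> M \<rightarrow>\<^sub>M count_space UNIV"
    by (rule count_measurable) auto
  have "AE \<xi> in M. (norm (X 0 \<xi>))\<^sup>2 \<le> a \<longleftrightarrow> card (\<Psi> \<xi> \<inter> ?B) \<noteq> 0"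
    using X_in_points X0_closest
  proof eventually_elim
    case (elim \<xi>)
    have "finite (\<Psi> \<xi> \<inter> ?B)" using elim by (intro finite_points) auto
    moreover have "(norm (X 0 \<xi>))\<^sup>2 \<le> a \<longleftrightarrow> norm (X 0 \<xi>) \<le> sqrt a"
      using a by (metis norm_ge_zero real_sqrt_le_iff real_sqrt_unique)
    moreover have "norm (X 0 \<xi>) \<le> sqrt a \<longleftrightarrow> \<Psi> \<xi> \<inter> ?B \<noteq> {}"
      using elim by (auto simp: disjoint_iff intro: order_trans)
    ultimately show ?case by simp
  qed
  then have "emeasure M {\<xi>\<in>space M. (norm (X 0 \<xi>))\<^sup>2 \<le> a} = emeasure M {\<xi>\<in>space M. card (\<Psi> \<xi> \<inter> ?B) \<noteq> 0}"
    by (intro emeasure_eq_AE) auto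
  also have "\<dots> = (\<integral>\<^sup>+\<xi>. ennreal (if card (\<Psi> \<xi> \<inter> ?B) = 0 then 0 else 1) \<partial>M)"
  proof -
    have "emeasure M {\<xi>\<in>space M. card (\<Psi> \<xi> \<inter> ?B) \<noteq> 0} =
        (\<integral>\<^sup>+\<xi>. indicator {\<xi>\<in>space M. card (\<Psi> \<xi> \<inter> ?B) \<noteq> 0} \<xi> \<partial>M)"
      by (rule nn_integral_indicator[symmetric]) measurable
    also have "\<dots> = (\<integral>\<^sup>+\<xi>. ennreal (if card (\<Psi> \<xi> \<inter> ?B) = 0 then 0 else 1) \<partial>M)"
      by (rule nn_integral_cong) (simp add: indicator_def)
    finally show ?thesis .
  qed
  also have "\<dots> = 1 - exp (- a * (pi * lam))"
    by (subst nn_integral_count_neq_0[OF _ _ m]) (auto simp: mult_ac)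
  finally show "emeasure M {\<xi>\<in>space M. (norm (X 0 \<xi>))\<^sup>2 \<le> a} = 1 - ennreal (exp (- a * (pi * lam)))"
    by (simp add: ennreal_minus ennreal_1[symmetric] del: ennreal_1)
qed (use lam_pos in auto)

lemma nearest_pos: "AE \<xi> in M. norm (X 0 \<xi>) > 0"
proof -
  have "prob {\<xi> \<in> space M. (norm (X 0 \<xi>))\<^sup>2 \<le> 0} = 1 - exp (- 0 * (pi * lam))"
    by (rule exponential_distributedD_le[OF nearest_distributed]) (use lam_pos in auto)
  then have "prob {\<xi> \<in> space M. X 0 \<xi> = 0} = 0" by simp
  then have "AE \<xi> in M. \<xi> \<notin> {\<xi> \<in> space M. X 0 \<xi> = 0}"
    using prob_eq_0[of "{\<xi> \<in> space M. X 0 \<xi> = 0}"] by simp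
  then show ?thesis using AE_space by eventually_elim simp
qed

lemma nn_integral_nearest_powr:
  assumes b: "b > -2"
  shows "(\<integral>\<^sup>+\<xi>. ennreal (norm (X 0 \<xi>) powr b) \<partial>M) = Gamma (b / 2 + 1) / (pi * lam) powr (b / 2)"
proof -
  define l where "l = pi * lam"
  have l: "l > 0" using lam_pos by (simp add: l_def)
  have "(\<integral>\<^sup>+\<xi>. ennreal (norm (X 0 \<xi>) powr b) \<partial>M) = (\<integral>\<^sup>+\<xi>. ennreal (((norm (X 0 \<xi>))\<^sup>2) powr (b / 2)) \<partial>M)"
  proof (rule nn_integral_cong)
    fix \<xi>
    show "ennreal (norm (X 0 \<xi>) powr b) = ennreal (((norm (X 0 \<xi>))\<^sup>2) powr (b / 2))"
      by (cases "X 0 \<xi> = 0") (simp_all add: powr_powr flip: powr_numeral)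
  qed
  also have "\<dots> = (\<integral>\<^sup>+x. ennreal (exponential_density l x) * ennreal (x powr (b / 2)) \<partial>lborel)"
    unfolding l_def by (rule distributed_nn_integral[OF nearest_distributed, symmetric]) measurable
  also have "\<dots> = ennreal \<bar>1 / l\<bar> * (\<integral>\<^sup>+x. ennreal (exponential_density l (0 + 1 / l * x)) * ennreal ((0 + 1 / l * x) powr (b / 2)) \<partial>lborel)"
    using l by (intro nn_integral_real_affine) auto
  also have "\<dots> = ennreal (1 / l) * (\<integral>\<^sup>+x. ennreal (l powr (1 - b / 2)) * ennreal (indicator {0..} x * x powr (b / 2 + 1 - 1) / exp x) \<partial>lborel)"
  proof -
    have "ennreal (exponential_density l (0 + 1 / l * x)) * ennreal ((0 + 1 / l * x) powr (b / 2)) =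
      ennreal (l powr (1 - b / 2)) * ennreal (indicator {0..} x * x powr (b / 2 + 1 - 1) / exp x)" for x
    proof (cases "x \<ge> 0")
      case True
      then have "exponential_density l (0 + 1 / l * x) * ((0 + 1 / l * x) powr (b / 2)) =
        l powr (1 - b / 2) * (indicator {0..} x * x powr (b / 2 + 1 - 1) / exp x)"
      proof -
        have "l powr (1 - b / 2) = l / l powr (b / 2)" using l by (simp add: powr_diff)
        then show ?thesis
          using l True by (simp only: exponential_density_def) (simp add: powr_divide exp_minus field_simps)
      qed
      then show ?thesis using l True by (simp add: ennreal_mult[symmetric] exponential_density_def)
    next
      case False
      then have "1 / l * x < 0" using l by (simp add: field_simps)
      then show ?thesis using False by (simp add: exponential_density_def)
    qed
    then show ?thesis using l by simp
  qed
  also have "\<dots> = ennreal (1 / l) * (ennreal (l powr (1 - b / 2)) * ennreal (Gamma (b / 2 + 1)))"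
    using b by (subst nn_integral_cmult) (auto simp: Gamma_conv_nn_integral_real)
  also have "\<dots> = Gamma (b / 2 + 1) / l powr (b / 2)"
  proof -
    have "Gamma (b / 2 + 1) > 0" using b by (intro Gamma_real_pos) simp
    then have "ennreal (1 / l) * (ennreal (l powr (1 - b / 2)) * ennreal (Gamma (b / 2 + 1))) =
        ennreal (1 / l * (l powr (1 - b / 2) * Gamma (b / 2 + 1)))"
      using l by (simp add: ennreal_mult[symmetric])
    also have "1 / l * (l powr (1 - b / 2) * Gamma (b / 2 + 1)) = Gamma (b / 2 + 1) / l powr (b / 2)"
    proof -
      have "l powr (1 - b / 2) = l / l powr (b / 2)" using l by (simp add: powr_diff)
      then show ?thesis using l by (simp only:) simp
    qed
    finally show ?thesis .
  qed
  finally show ?thesis by (simp add: l_def)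
qed

section \<open>Points in a dilated ball and the sum of distance ratios\<close>

text \<open>The radii \<open>sqrt (k * \<delta> / (pi * lam))\<close> cut the plane into annuli of equal mean count \<open>\<delta>\<close>, so the
  index of the annulus holding the nearest point is geometrically distributed.\<close>

lemma count_in_dilated_ball_discrete:
  assumes s: "s \<ge> 1" and \<delta>: "\<delta> > 0"
  shows "(\<integral>\<^sup>+\<xi>. (\<Sum>i. indicator {i. norm (X (Suc i) \<xi>) < s * norm (X 0 \<xi>)} i) \<partial>M) \<le>
    ennreal ((\<delta> - 1 + exp (- \<delta>)) / (1 - exp (- \<delta>)) + (s\<^sup>2 - 1) * \<delta> / (1 - exp (- \<delta>)))"
proof -
  define l where "l = pi * lam"
  have l: "l > 0" using lam_pos by (simp add: l_def)
  define r where "r k = sqrt (real k * \<delta> / l)" for k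
  have r0: "r k \<ge> 0" and rmono: "r k \<le> r (Suc k)" and r_sq: "(r k)\<^sup>2 = real k * \<delta> / l" for k
    using l \<delta> by (auto simp: r_def divide_right_mono mult_right_mono)
  define B0 :: "nat \<Rightarrow> (real^2) set" where "B0 k = ball 0 (r k)" for k
  define B1 :: "nat \<Rightarrow> (real^2) set" where "B1 k = ball 0 (r (Suc k)) - ball 0 (r k)" for k
  define B2 :: "nat \<Rightarrow> (real^2) set" where "B2 k = ball 0 (s * r (Suc k)) - ball 0 (r (Suc k))" for k
  have meas: "B0 k \<in> sets borel" "B1 k \<in> sets borel" "B2 k \<in> sets borel" for k
    by (auto simp: B0_def B1_def B2_def)
  have bdd: "bounded (B0 k)" "bounded (B1 k)" "bounded (B2 k)" for k
    by (auto simp: B0_def B1_def B2_def bounded_diff)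
  have srmono: "r k \<le> s * r k" for k using s r0[of k] by (simp add: mult_le_cancel_right1)
  have disj: "B0 k \<inter> B1 k = {}" "B0 k \<inter> B2 k = {}" "B1 k \<inter> B2 k = {}" for k
    using rmono[of k] by (auto simp: B0_def B1_def B2_def)
  have m0: "lam * measure lborel (B0 k) = real k * \<delta>" for k
    using r0 l lam_pos by (simp add: B0_def measure_ball_plane r_sq l_def)
  have m1: "lam * measure lborel (B1 k) = \<delta>" for k
  proof -
    have "lam * measure lborel (B1 k) = l * ((r (Suc k))\<^sup>2 - (r k)\<^sup>2)"
      unfolding B1_def by (subst measure_annulus[OF r0 rmono]) (simp add: l_def)
    also have "\<dots> = \<delta>" unfolding r_sq using l by (simp add: field_simps)
    finally show ?thesis .
  qed
  have m2: "lam * measure lborel (B2 k) = (s\<^sup>2 - 1) * real (Suc k) * \<delta>" for k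
  proof -
    have "lam * measure lborel (B2 k) = l * ((s * r (Suc k))\<^sup>2 - (r (Suc k))\<^sup>2)"
      unfolding B2_def by (subst measure_annulus[OF r0 srmono]) (simp add: l_def)
    also have "\<dots> = (s\<^sup>2 - 1) * real (Suc k) * \<delta>"
      unfolding power_mult_distrib r_sq using l by (simp add: field_simps del: of_nat_Suc)
    finally show ?thesis .
  qed
  define n0 n1 n2 where "n0 k \<xi> = card (\<Psi> \<xi> \<inter> B0 k)" and "n1 k \<xi> = card (\<Psi> \<xi> \<inter> B1 k)"
    and "n2 k \<xi> = card (\<Psi> \<xi> \<inter> B2 k)" for k \<xi>
  have n_meas[measurable]: "n0 k \<in> M \<rightarrow>\<^sub>M count_space UNIV" "n1 k \<in> M \<rightarrow>\<^sub>M count_space UNIV"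
    "n2 k \<in> M \<rightarrow>\<^sub>M count_space UNIV" for k
    unfolding n0_def n1_def n2_def by (intro count_measurable meas bdd)+
  define e where "e n = ennreal (if n = 0 then 1 else 0)" for n :: nat
  define p where "p n = ennreal (if n = 0 then 0 else 1)" for n :: nat
  define x where "x n = ennreal (real (n - 1))" for n :: nat
  \<comment> \<open>If annulus \<open>k\<close> holds the nearest point, then \<open>B0 k\<close> is
    empty, \<open>B1 k\<close> is not, and every other point of the dilated ball is an excess point
    of \<open>B1 k\<close> or lies in \<open>B2 k\<close>. Summing over all \<open>k\<close> removes
    the random index. The factor \<open>1\<close> gives the first term the form of
    \<open>nn_integral_three_counts\<close>.\<close>
  have pos: "AE \<xi> in M. (\<Sum>i. indicator {i. norm (X (Suc i) \<xi>) < s * norm (X 0 \<xi>)} i) \<le>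
      (\<Sum>k. e (n0 k \<xi>) * x (n1 k \<xi>) * 1 + e (n0 k \<xi>) * p (n1 k \<xi>) * ennreal (real (n2 k \<xi>)))"
    using X_in_points X0_closest
  proof eventually_elim
    case (elim \<xi>)
    let ?d = "norm (X 0 \<xi>)"
    define k where "k = nat \<lfloor>l * ?d\<^sup>2 / \<delta>\<rfloor>"
    have y0: "l * ?d\<^sup>2 / \<delta> \<ge> 0" using l \<delta> by simp
    have "real k \<le> l * ?d\<^sup>2 / \<delta>" "l * ?d\<^sup>2 / \<delta> < real (Suc k)"
      using y0 by (simp_all add: k_def) linarith+
    then have "(r k)\<^sup>2 \<le> ?d\<^sup>2" "?d\<^sup>2 < (r (Suc k))\<^sup>2"
      unfolding r_sq using l \<delta> by (simp_all add: field_simps del: of_nat_Suc)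
    then have dk: "r k \<le> ?d" "?d < r (Suc k)"
      using r0 by (auto intro: power2_le_imp_le power2_less_imp_less)
    have fin: "finite (\<Psi> \<xi> \<inter> B1 k)" "finite (\<Psi> \<xi> \<inter> B2 k)"
      using elim bdd by (auto intro: finite_points)
    have "\<Psi> \<xi> \<inter> B0 k = {}" using elim dk(1) by (force simp: B0_def)
    then have e: "e (n0 k \<xi>) = 1" by (simp add: n0_def e_def)
    have X0: "X 0 \<xi> \<in> \<Psi> \<xi> \<inter> B1 k" using elim dk by (auto simp: B1_def)
    then have "n1 k \<xi> \<noteq> 0" using fin by (auto simp: n1_def)
    then have p: "p (n1 k \<xi>) = 1" by (simp add: p_def)
    let ?S = "{i. norm (X (Suc i) \<xi>) < s * ?d}"
    have sd: "s * ?d \<le> s * r (Suc k)" using dk s by simp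
    have sub: "(\<lambda>i. X (Suc i) \<xi>) ` ?S \<subseteq> (\<Psi> \<xi> \<inter> B1 k - {X 0 \<xi>}) \<union> (\<Psi> \<xi> \<inter> B2 k)"
    proof safe
      fix i assume i: "norm (X (Suc i) \<xi>) < s * ?d" and nB2: "X (Suc i) \<xi> \<notin> B2 k"
      have "r k \<le> norm (X (Suc i) \<xi>)" using elim dk(1) order_trans by blast
      moreover have "norm (X (Suc i) \<xi>) < s * r (Suc k)" using i sd by linarith
      ultimately show "X (Suc i) \<xi> \<in> B1 k" using nB2 by (auto simp: B1_def B2_def)
    next
      fix i assume "X (Suc i) \<xi> = X 0 \<xi>"
      moreover have "inj (\<lambda>i. X i \<xi>)" using elim by blast
      ultimately have "Suc i = 0" by (rule injD[rotated])
      then show "X (Suc i) \<xi> \<in> B2 k" by simp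
    qed (use elim in auto)
    have inj: "inj_on (\<lambda>i. X (Suc i) \<xi>) ?S"
      using elim by (auto simp: inj_on_def inj_def)
    have fS: "finite ?S"
      using finite_subset[OF sub] fin inj by (auto dest: finite_imageD)
    have "card ?S = card ((\<lambda>i. X (Suc i) \<xi>) ` ?S)" by (rule card_image[OF inj, symmetric])
    also have "\<dots> \<le> card ((\<Psi> \<xi> \<inter> B1 k - {X 0 \<xi>}) \<union> (\<Psi> \<xi> \<inter> B2 k))"
      by (rule card_mono[OF _ sub]) (use fin in auto)
    also have "\<dots> \<le> (n1 k \<xi> - 1) + n2 k \<xi>"
      using card_Un_le[of "\<Psi> \<xi> \<inter> B1 k - {X 0 \<xi>}" "\<Psi> \<xi> \<inter> B2 k"] X0 fin
      by (simp add: n1_def n2_def)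
    finally have card: "card ?S \<le> (n1 k \<xi> - 1) + n2 k \<xi>" .
    have "(\<Sum>i. indicator ?S i :: ennreal) = ennreal (real (card ?S))"
      using suminf_indicator_card[OF fS] by (simp add: ennreal_of_nat_eq_real_of_nat)
    also have "\<dots> \<le> ennreal (real (n1 k \<xi> - 1) + real (n2 k \<xi>))"
      using card by (intro ennreal_leI) linarith
    also have "\<dots> = e (n0 k \<xi>) * x (n1 k \<xi>) * 1 + e (n0 k \<xi>) * p (n1 k \<xi>) * ennreal (real (n2 k \<xi>))"
      by (simp add: e p x_def)
    also have "\<dots> \<le> (\<Sum>k. e (n0 k \<xi>) * x (n1 k \<xi>) * 1 + e (n0 k \<xi>) * p (n1 k \<xi>) * ennreal (real (n2 k \<xi>)))"
      using sum_le_suminf[of "\<lambda>k. e (n0 k \<xi>) * x (n1 k \<xi>) * 1 + e (n0 k \<xi>) * p (n1 k \<xi>) * ennreal (real (n2 k \<xi>))" "{k}"]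
      by (simp add: summableI)
    finally show ?case .
  qed
  define q where "q = exp (- \<delta>)"
  have q: "0 < q" "q < 1" using \<delta> by (auto simp: q_def)
  have a0: "\<delta> - 1 + q \<ge> 0" using exp_ge_add_one_self[of "- \<delta>"] by (simp add: q_def)
  have s0: "s\<^sup>2 - 1 \<ge> 0" using s by (simp add: one_le_power)
  \<comment> \<open>The counts of disjoint regions are independent, so the means multiply;
    \<open>B0 k\<close> is empty with probability \<open>q ^ k\<close>, and the mean count of
    \<open>B2 k\<close> is proportional to \<open>Suc k\<close>.\<close>
  have tm: "(\<integral>\<^sup>+\<xi>. e (n0 k \<xi>) * x (n1 k \<xi>) * 1 + e (n0 k \<xi>) * p (n1 k \<xi>) * ennreal (real (n2 k \<xi>)) \<partial>M) =
     ennreal ((\<delta> - 1 + q) * q ^ k + (1 - q) * (s\<^sup>2 - 1) * \<delta> * (real (Suc k) * q ^ k))" for k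
  proof -
    have qk: "exp (- (real k * \<delta>)) = q ^ k" by (simp add: q_def exp_of_nat_mult[symmetric])
    have "(\<integral>\<^sup>+\<xi>. e (n0 k \<xi>) * x (n1 k \<xi>) * 1 + e (n0 k \<xi>) * p (n1 k \<xi>) * ennreal (real (n2 k \<xi>)) \<partial>M) =
      (\<integral>\<^sup>+\<xi>. e (n0 k \<xi>) * x (n1 k \<xi>) * 1 \<partial>M) + (\<integral>\<^sup>+\<xi>. e (n0 k \<xi>) * p (n1 k \<xi>) * ennreal (real (n2 k \<xi>)) \<partial>M)"
      unfolding e_def p_def x_def by (rule nn_integral_add) measurable
    also have "(\<integral>\<^sup>+\<xi>. e (n0 k \<xi>) * x (n1 k \<xi>) * 1 \<partial>M) = ennreal (q ^ k) * ennreal (\<delta> - 1 + q) * 1"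
      unfolding n0_def n1_def
      by (subst nn_integral_three_counts[OF meas(1) bdd(1) meas(2) bdd(2) meas(3) bdd(3) disj, where f=e and g=x and h="\<lambda>_. 1"])
         (simp add: e_def x_def nn_integral_count_eq_0[OF meas(1) bdd(1) m0] nn_integral_count_excess[OF meas(2) bdd(2) m1]
           emeasure_space_1 qk q_def[symmetric] del: One_nat_def)
    also have "(\<integral>\<^sup>+\<xi>. e (n0 k \<xi>) * p (n1 k \<xi>) * ennreal (real (n2 k \<xi>)) \<partial>M) =
        ennreal (q ^ k) * ennreal (1 - q) * ennreal ((s\<^sup>2 - 1) * real (Suc k) * \<delta>)"
      unfolding n0_def n1_def n2_def
      by (subst nn_integral_three_counts[OF meas(1) bdd(1) meas(2) bdd(2) meas(3) bdd(3) disj, where f=e and g=p and h="\<lambda>n. ennreal (real n)"])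
         (simp add: e_def p_def nn_integral_count_eq_0[OF meas(1) bdd(1) m0] nn_integral_count_neq_0[OF meas(2) bdd(2) m1]
           nn_integral_count_mean[OF meas(3) bdd(3) m2] qk q_def[symmetric] del: of_nat_Suc)
    also have "ennreal (q ^ k) * ennreal (\<delta> - 1 + q) * 1 + ennreal (q ^ k) * ennreal (1 - q) * ennreal ((s\<^sup>2 - 1) * real (Suc k) * \<delta>) =
        ennreal (q ^ k * (\<delta> - 1 + q) + q ^ k * (1 - q) * ((s\<^sup>2 - 1) * real (Suc k) * \<delta>))"
      using q a0 s0 \<delta> by (simp add: ennreal_mult ennreal_plus del: of_nat_Suc)
    finally show ?thesis by (simp add: mult_ac del: of_nat_Suc)
  qed
  have "(\<integral>\<^sup>+\<xi>. (\<Sum>i. indicator {i. norm (X (Suc i) \<xi>) < s * norm (X 0 \<xi>)} i) \<partial>M) \<le>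
      (\<integral>\<^sup>+\<xi>. (\<Sum>k. e (n0 k \<xi>) * x (n1 k \<xi>) * 1 + e (n0 k \<xi>) * p (n1 k \<xi>) * ennreal (real (n2 k \<xi>))) \<partial>M)"
    by (rule nn_integral_mono_AE[OF pos])
  also have "\<dots> = (\<Sum>k. \<integral>\<^sup>+\<xi>. e (n0 k \<xi>) * x (n1 k \<xi>) * 1 + e (n0 k \<xi>) * p (n1 k \<xi>) * ennreal (real (n2 k \<xi>)) \<partial>M)"
    unfolding e_def p_def x_def by (rule nn_integral_suminf) measurable
  also have "\<dots> = (\<Sum>k. ennreal ((\<delta> - 1 + q) * q ^ k + (1 - q) * (s\<^sup>2 - 1) * \<delta> * (real (Suc k) * q ^ k)))"
    by (simp only: tm)
  \<comment> \<open>The geometric series and its derivative.\<close>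
  also have "\<dots> = ennreal ((\<delta> - 1 + q) * (1 / (1 - q)) + (1 - q) * (s\<^sup>2 - 1) * \<delta> * (1 / (1 - q)\<^sup>2))"
  proof (rule suminf_ennreal_eq)
    show "(\<lambda>k. (\<delta> - 1 + q) * q ^ k + (1 - q) * (s\<^sup>2 - 1) * \<delta> * (real (Suc k) * q ^ k)) sums
      ((\<delta> - 1 + q) * (1 / (1 - q)) + (1 - q) * (s\<^sup>2 - 1) * \<delta> * (1 / (1 - q)\<^sup>2))"
      using q by (intro sums_add sums_mult geometric_sums geometric_deriv_sums) auto
  qed (use q a0 s0 \<delta> in auto)
  also have "(\<delta> - 1 + q) * (1 / (1 - q)) + (1 - q) * (s\<^sup>2 - 1) * \<delta> * (1 / (1 - q)\<^sup>2) =
      (\<delta> - 1 + q) / (1 - q) + (s\<^sup>2 - 1) * \<delta> / (1 - q)"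
  proof -
    have "u * A * \<delta> * (1 / u\<^sup>2) = A * \<delta> / u" if "u \<noteq> 0" for u A :: real
      using that by (simp add: power2_eq_square)
    from this[of "1 - q" "s\<^sup>2 - 1"] show ?thesis using q by simp
  qed
  finally show ?thesis by (simp add: q_def)
qed

text \<open>As the mesh \<delta> tends to 0, the mean number of companions in the annulus of the
  nearest point vanishes and the rounding factor \<open>\<delta> / (1 - exp (- \<delta>))\<close>
  tends to 1. Heuristically, the region between the two radii has mean count
  \<open>(s\<^sup>2 - 1)\<close> times \<open>pi * lam\<close> times the squared nearest distance,
  and the latter product has mean 1.\<close>

lemma count_in_dilated_ball:
  assumes s: "s \<ge> 1"
  shows "(\<integral>\<^sup>+\<xi>. (\<Sum>i. indicator {i. norm (X (Suc i) \<xi>) < s * norm (X 0 \<xi>)} i) \<partial>M) \<le> ennreal (s\<^sup>2 - 1)"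
proof -
  let ?g = "\<lambda>\<delta>::real. (\<delta> - 1 + exp (- \<delta>)) / (1 - exp (- \<delta>)) + (s\<^sup>2 - 1) * (\<delta> / (1 - exp (- \<delta>)))"
  have "((\<lambda>\<delta>::real. (\<delta> - 1 + exp (- \<delta>)) / (1 - exp (- \<delta>))) \<longlongrightarrow> 0) (at_right 0)"
    by real_asymp
  moreover have "((\<lambda>\<delta>::real. \<delta> / (1 - exp (- \<delta>))) \<longlongrightarrow> 1) (at_right 0)"
    by real_asymp
  ultimately have "(?g \<longlongrightarrow> 0 + (s\<^sup>2 - 1) * 1) (at_right 0)"
    by (intro tendsto_intros)
  then have "((\<lambda>\<delta>. ennreal (?g \<delta>)) \<longlongrightarrow> ennreal (s\<^sup>2 - 1)) (at_right 0)"
    by (intro tendsto_ennrealI) simp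
  moreover have "\<forall>\<^sub>F \<delta> in at_right 0. (\<integral>\<^sup>+\<xi>. (\<Sum>i. indicator {i. norm (X (Suc i) \<xi>) < s * norm (X 0 \<xi>)} i) \<partial>M) \<le> ennreal (?g \<delta>)"
    using count_in_dilated_ball_discrete[OF s] by (auto simp: eventually_at_right_field intro: exI[of _ 1])
  ultimately show ?thesis by (rule tendsto_lowerbound) simp
qed

text \<open>Layer cake: a ratio with power \<alpha> is the length of the set of \<open>u\<close>
  below it, and \<open>u\<close> lies below it exactly when the point is in the ball dilated by
  \<open>u powr (- 1 / \<alpha>)\<close>. The ratios are at most 1, so only \<open>u\<close> in the
  unit interval matters, and the mean count is at most \<open>u powr (- 2 / \<alpha>) - 1\<close>,
  integrable since \<open>\<alpha> > 2\<close>.\<close>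

lemma nn_integral_distance_ratios:
  assumes \<alpha>: "\<alpha> > 2"
  shows "(\<integral>\<^sup>+\<xi>. (\<Sum>i. ennreal ((norm (X 0 \<xi>) / norm (X (Suc i) \<xi>)) powr \<alpha>)) \<partial>M) \<le> ennreal (2 / (\<alpha> - 2))"
proof -
  let ?c = "\<lambda>u \<xi>. (\<Sum>i. indicator {i. norm (X (Suc i) \<xi>) < u powr (- 1 / \<alpha>) * norm (X 0 \<xi>)} i) :: ennreal"
  interpret P: pair_sigma_finite lborel M ..
  have cm[measurable]: "(\<lambda>p. ?c (fst p) (snd p)) \<in> borel_measurable (borel \<Otimes>\<^sub>M M)"
    unfolding indicator_def mem_Collect_eq by measurable
  have pt: "AE \<xi> in M. (\<Sum>i. ennreal ((norm (X 0 \<xi>) / norm (X (Suc i) \<xi>)) powr \<alpha>)) \<le>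
      (\<integral>\<^sup>+u. indicator {0<..<1} u * ?c u \<xi> \<partial>lborel)"
    using X_in_points
  proof eventually_elim
    case (elim \<xi>)
    have "ennreal ((norm (X 0 \<xi>) / norm (X (Suc i) \<xi>)) powr \<alpha>) \<le>
        (\<integral>\<^sup>+u. indicator {0<..<1} u * indicator {i. norm (X (Suc i) \<xi>) < u powr (- 1 / \<alpha>) * norm (X 0 \<xi>)} i \<partial>lborel)" for i
    proof -
      define t where "t = norm (X 0 \<xi>) / norm (X (Suc i) \<xi>)"
      have t: "0 \<le> t" "t \<le> 1" using elim by (auto simp: t_def divide_le_eq_1)
      then have t1: "t powr \<alpha> \<le> 1" using \<alpha> by (intro powr_le1) auto
      have "ennreal (t powr \<alpha>) = emeasure lborel {0<..<t powr \<alpha>}" by simp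
      also have "\<dots> = (\<integral>\<^sup>+u. indicator {0<..<t powr \<alpha>} u \<partial>lborel)" by simp
      also have "\<dots> \<le> (\<integral>\<^sup>+u. indicator {0<..<1} u * indicator {i. norm (X (Suc i) \<xi>) < u powr (- 1 / \<alpha>) * norm (X 0 \<xi>)} i \<partial>lborel)"
      proof (rule nn_integral_mono)
        fix u :: real
        have "norm (X (Suc i) \<xi>) < u powr (- 1 / \<alpha>) * norm (X 0 \<xi>)" if u: "0 < u" "u < t powr \<alpha>"
        proof -
          have "t \<noteq> 0" using u by auto
          then have Xi: "norm (X (Suc i) \<xi>) > 0" by (auto simp: t_def)
          have "u powr (1 / \<alpha>) < (t powr \<alpha>) powr (1 / \<alpha>)" using u \<alpha> by (intro powr_less_mono2) auto
          then have "u powr (1 / \<alpha>) < t" using \<alpha> t by (simp add: powr_powr)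
          then have "u powr (1 / \<alpha>) * norm (X (Suc i) \<xi>) < norm (X 0 \<xi>)"
            using Xi by (simp add: t_def field_simps)
          moreover have inv: "u powr (- 1 / \<alpha>) = 1 / u powr (1 / \<alpha>)" using powr_minus_divide[of u "1 / \<alpha>"] by simp
          moreover have "u powr (1 / \<alpha>) > 0" using u by simp
          ultimately show ?thesis unfolding inv by (simp add: pos_less_divide_eq mult.commute)
        qed
        then show "indicator {0<..<t powr \<alpha>} u \<le> (indicator {0<..<1} u * indicator {i. norm (X (Suc i) \<xi>) < u powr (- 1 / \<alpha>) * norm (X 0 \<xi>)} i :: ennreal)"
          using t1 by (auto simp: indicator_def)
      qed
      finally show ?thesis by (simp add: t_def)
    qed
    then have "(\<Sum>i. ennreal ((norm (X 0 \<xi>) / norm (X (Suc i) \<xi>)) powr \<alpha>)) \<le>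
       (\<Sum>i. \<integral>\<^sup>+u. indicator {0<..<1} u * indicator {i. norm (X (Suc i) \<xi>) < u powr (- 1 / \<alpha>) * norm (X 0 \<xi>)} i \<partial>lborel)"
      by (intro suminf_le summableI)
    also have "\<dots> = (\<integral>\<^sup>+u. (\<Sum>i. indicator {0<..<1} u * indicator {i. norm (X (Suc i) \<xi>) < u powr (- 1 / \<alpha>) * norm (X 0 \<xi>)} i) \<partial>lborel)"
      unfolding indicator_def mem_Collect_eq by (rule nn_integral_suminf[symmetric]) measurable
    finally show ?case by simp
  qed
  have "(\<integral>\<^sup>+\<xi>. (\<Sum>i. ennreal ((norm (X 0 \<xi>) / norm (X (Suc i) \<xi>)) powr \<alpha>)) \<partial>M) \<le>
      (\<integral>\<^sup>+\<xi>. (\<integral>\<^sup>+u. indicator {0<..<1} u * ?c u \<xi> \<partial>lborel) \<partial>M)"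
    by (rule nn_integral_mono_AE[OF pt])
  also have "\<dots> = (\<integral>\<^sup>+u. (\<integral>\<^sup>+\<xi>. indicator {0<..<1} u * ?c u \<xi> \<partial>M) \<partial>lborel)"
    by (rule P.Fubini') measurable
  \<comment> \<open>The case \<open>u = 0\<close> is set apart because \<open>0 powr b = 0\<close>
    would make the integrand -1 there.\<close>
  also have "\<dots> \<le> (\<integral>\<^sup>+u. ennreal (if u = 0 then 0 else u powr (- 2 / \<alpha>) - 1) * indicator {0..1} u \<partial>lborel)"
  proof (rule nn_integral_mono)
    fix u :: real
    show "(\<integral>\<^sup>+\<xi>. indicator {0<..<1} u * ?c u \<xi> \<partial>M) \<le> ennreal (if u = 0 then 0 else u powr (- 2 / \<alpha>) - 1) * indicator {0..1} u"
    proof (cases "0 < u \<and> u < 1")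
      case True
      have "u powr 0 \<le> u powr (- 1 / \<alpha>)" using True \<alpha> by (intro powr_mono') auto
      then have "1 \<le> u powr (- 1 / \<alpha>)" using True by simp
      from count_in_dilated_ball[OF this] show ?thesis
        using True by (simp add: powr_power)
    qed (auto simp: indicator_def)
  qed
  also have "\<dots> = ennreal (1 powr (- 2 / \<alpha> + 1) / (- 2 / \<alpha> + 1) - 1 *\<^sub>R (1 - 0))"
  proof (rule nn_integral_has_integral_lebesgue')
    show "0 \<le> (if u = 0 then 0 else u powr (- 2 / \<alpha>) - 1)" if "u \<in> {0..1}" for u
    proof (cases "u = 0")
      case False
      then have "u powr 0 \<le> u powr (- 2 / \<alpha>)" using that \<alpha> by (intro powr_mono') auto
      then show ?thesis using False by simp
    qed simp
    have "((\<lambda>u. u powr (- 2 / \<alpha>) - 1) has_integral 1 powr (- 2 / \<alpha> + 1) / (- 2 / \<alpha> + 1) - 1 *\<^sub>R (1 - 0)) {0..1}"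
      using \<alpha> has_integral_const_real[of "1::real" 0 1]
      by (intro has_integral_diff has_integral_powr_from_0) (auto simp: field_simps)
    then show "((\<lambda>u. if u = 0 then 0 else u powr (- 2 / \<alpha>) - 1) has_integral
        1 powr (- 2 / \<alpha> + 1) / (- 2 / \<alpha> + 1) - 1 *\<^sub>R (1 - 0)) {0..1}"
      by (rule has_integral_spike_finite[of "{0}", rotated 2]) auto
  qed
  also have "1 powr (- 2 / \<alpha> + 1) / (- 2 / \<alpha> + 1) - 1 *\<^sub>R (1 - 0) = 2 / (\<alpha> - 2)"
    using \<alpha> by (simp add: field_simps)
  finally show ?thesis .
qed

end

section \<open>The zero-forcing network\<close>

text \<open>For \<open>a = \<epsilon>\<^sup>2\<close> this is the efficiency when interference plus
  noise, divided by the signal, equals \<open>y\<close>. The second derivative is a difference of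
  inverse squares, nonnegative because \<open>a < 1\<close>. The domain is open because
  \<open>a = 0\<close> makes the function singular at 0.\<close>

lemma convex_on_log_ratio:
  assumes a: "0 \<le> a" "a < 1"
  shows "convex_on {0<..} (\<lambda>y. (ln (y + 1) - ln (y + a)) / ln (2::real))"
proof (rule f''_ge0_imp_convex)
  show "((\<lambda>y. (ln (y + 1) - ln (y + a)) / ln 2) has_real_derivative (1 / (y + 1) - 1 / (y + a)) / ln 2) (at y)"
    if "y \<in> {0<..}" for y
    using that a by (auto intro!: derivative_eq_intros)
  show "((\<lambda>y. (1 / (y + 1) - 1 / (y + a)) / ln 2) has_real_derivative (1 / (y + a)\<^sup>2 - 1 / (y + 1)\<^sup>2) / ln 2) (at y)"
    if "y \<in> {0<..}" for y
    using that a by (auto intro!: derivative_eq_intros simp: power2_eq_square)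
  show "0 \<le> (1 / (y + a)\<^sup>2 - 1 / (y + 1)\<^sup>2) / ln 2" if "y \<in> {0<..}" for y
  proof -
    have "1 / (y + 1)\<^sup>2 \<le> 1 / (y + a)\<^sup>2"
      using that a by (intro divide_left_mono power_mono) auto
    then show ?thesis by simp
  qed
qed auto

lemma antimono_log_ratio:
  assumes "0 \<le> a" "a < 1" "0 < x" "x \<le> (y::real)"
  shows "(ln (y + 1) - ln (y + a)) / ln 2 \<le> (ln (x + 1) - ln (x + a)) / ln 2"
proof (rule divide_right_mono)
  have "(y + 1) * (x + a) \<le> (x + 1) * (y + a)"
    using assms mult_left_mono[of x y "1 - a"] by (simp add: algebra_simps)
  then have "ln ((y + 1) * (x + a)) \<le> ln ((x + 1) * (y + a))" using assms by simp
  then show "ln (y + 1) - ln (y + a) \<le> ln (x + 1) - ln (x + a)"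
    using assms by (simp add: ln_mult)
qed simp

text \<open>Serves both sides of the bound: the random efficiency at a sample point, and the closed
  formula with \<open>s\<close> equal to antennas minus users.\<close>

lemma log_ratio_eq:
  assumes "0 \<le> a" "a < 1" "0 < s" "0 < (n::real)"
  shows "log 2 (1 + (1 - a) * s / (n + a * s)) = (ln (n / s + 1) - ln (n / s + a)) / ln 2"
proof -
  have pos: "n + a * s > 0" "n + s > 0" using assms by (simp_all add: add_pos_nonneg)
  have "n / s + 1 = (n + s) / s" "n / s + a = (n + a * s) / s" using assms by (simp_all add: field_simps)
  moreover have "1 + (1 - a) * s / (n + a * s) = (n + s) / (n + a * s)"
    using pos by (simp add: field_simps)
  ultimately show ?thesis
    using pos assms by (simp add: log_def ln_div)
qed

text \<open>The default values agree: a divergent \<open>infsum\<close> is 0, and so is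
  \<open>enn2real \<top>\<close>.\<close>

lemma infsum_eq_enn2real:
  fixes f :: "nat \<Rightarrow> real"
  assumes f: "\<And>i. f i \<ge> 0"
  shows "(\<Sum>\<^sub>\<infinity>i\<in>UNIV - {0}. f i) = enn2real (\<Sum>i. ennreal (f (Suc i)))"
proof -
  have "UNIV - {0} = range Suc" using not0_implies_Suc by auto
  then have "(\<Sum>\<^sub>\<infinity>i\<in>UNIV - {0}. f i) = (\<Sum>\<^sub>\<infinity>i\<in>range Suc. f i)" by (simp only:)
  also have "\<dots> = (\<Sum>\<^sub>\<infinity>i. f (Suc i))"
    by (subst infsum_reindex) (simp_all add: o_def)
  also have "\<dots> = enn2real (\<Sum>i. ennreal (f (Suc i)))"
  proof (cases "summable (\<lambda>i. f (Suc i))")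
    case True
    then have "((\<lambda>i. f (Suc i)) has_sum (\<Sum>i. f (Suc i))) UNIV"
      using f by (intro sums_nonneg_imp_has_sum summable_sums)
    then have "(\<Sum>\<^sub>\<infinity>i. f (Suc i)) = (\<Sum>i. f (Suc i))" by (rule infsumI)
    moreover have "(\<Sum>i. f (Suc i)) \<ge> 0" using True f by (rule suminf_nonneg)
    ultimately show ?thesis by (simp only: suminf_ennreal2[OF f True] enn2real_ennreal)
  next
    case False
    then have "\<not> (\<lambda>i. f (Suc i)) summable_on UNIV"
      by (simp add: summable_on_UNIV_nonneg_real_iff f)
    moreover have "(\<Sum>i. ennreal (f (Suc i))) = \<top>"
      using summable_suminf_not_top[of "\<lambda>i. f (Suc i)"] f False by metis
    ultimately show ?thesis by (simp add: infsum_not_exists)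
  qed
  finally show ?thesis .
qed

text \<open>Bounding \<open>d powr (- \<alpha>)\<close> by the power \<alpha> of
  \<open>1 + 1 / d\<close> lets the logarithm turn the exponent into a factor. Only the inverse
  first power of the distance remains, which is integrable for the nearest point.\<close>

lemma ln_one_plus_inverse_powr:
  assumes "C > 0" "\<alpha> > 0" "d > (0::real)"
  shows "ln (1 + C * d powr (- \<alpha>)) \<le> ln (1 + C) + \<alpha> * d powr (- 1)"
proof -
  have 1: "(1 + 1 / d) powr \<alpha> \<ge> 1" using assms by (intro ge_one_powr_ge_zero) auto
  have "(1 / d) powr \<alpha> \<le> (1 + 1 / d) powr \<alpha>" using assms by (intro powr_mono2) auto
  then have "d powr (- \<alpha>) \<le> (1 + 1 / d) powr \<alpha>"
    using assms by (simp add: powr_divide powr_minus_divide)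
  then have "C * d powr (- \<alpha>) \<le> C * (1 + 1 / d) powr \<alpha>" using assms by simp
  with 1 have "1 + C * d powr (- \<alpha>) \<le> (1 + C) * (1 + 1 / d) powr \<alpha>"
    by (simp add: algebra_simps)
  moreover have "0 < 1 + C * d powr (- \<alpha>)" using assms by (simp add: add_pos_nonneg)
  ultimately have "ln (1 + C * d powr (- \<alpha>)) \<le> ln ((1 + C) * (1 + 1 / d) powr \<alpha>)" by simp
  also have "\<dots> = ln (1 + C) + \<alpha> * ln (1 + 1 / d)"
    using assms 1 by (subst ln_mult) (auto simp: ln_powr add_pos_pos)
  also have "\<dots> \<le> ln (1 + C) + \<alpha> * (1 / d)"
    using assms by (intro add_left_mono mult_left_mono ln_add_one_self_le_self) auto
  also have "1 / d = d powr (- 1)" using assms by (simp add: powr_minus_divide)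
  finally show ?thesis .
qed

text \<open>A set of \<open>F\<close> or of a single block is a cylinder whose other components are
  the whole space.\<close>

lemma measurable_sigma_cylinder:
  assumes "space F = space M" "J \<noteq> {}"
    and "\<And>j. j \<in> J \<Longrightarrow> A j = sets (N j)" "\<And>j. j \<in> J \<Longrightarrow> space (N j) = space M"
  shows "f \<in> F \<rightarrow>\<^sub>M L \<Longrightarrow> f \<in> sigma (space M) (cylinder_sets F A J) \<rightarrow>\<^sub>M L"
    and "j \<in> J \<Longrightarrow> A j = sets (vimage_algebra (space M) Y L) \<Longrightarrow> Y \<in> space M \<rightarrow> space L \<Longrightarrow>
      Y \<in> sigma (space M) (cylinder_sets F A J) \<rightarrow>\<^sub>M L"
proof -
  let ?G = "sigma (space M) (cylinder_sets F A J)"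
  have Pow: "cylinder_sets F A J \<subseteq> Pow (space M)" using cylinder_sets_Pow[of F A J] assms(1) by simp
  have sp: "space ?G = space M" by (simp add: space_measure_of_conv)
  have top: "space M \<in> A j" if "j \<in> J" for j using assms(3,4)[OF that] sets.top[of "N j"] by simp
  have CG: "C \<in> sets ?G" if "C \<in> sets F" for C
  proof -
    have "C \<inter> (\<Inter>j\<in>J. space M) \<in> cylinder_sets F A J" by (rule cylinder_setsI[OF that top])
    moreover have "C \<inter> (\<Inter>j\<in>J. space M) = C" using sets.sets_into_space[OF that] assms(1,2) by auto
    ultimately show ?thesis using Pow by auto
  qed
  show "f \<in> ?G \<rightarrow>\<^sub>M L" if f: "f \<in> F \<rightarrow>\<^sub>M L"
  proof (rule measurableI)
    show "f x \<in> space L" if "x \<in> space ?G" for x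
      using measurable_space[OF f] that sp assms(1) by simp
    show "f -` B \<inter> space ?G \<in> sets ?G" if "B \<in> sets L" for B
      using CG[OF measurable_sets[OF f that]] sp assms(1) by simp
  qed
  show "Y \<in> ?G \<rightarrow>\<^sub>M L" if j: "j \<in> J" and Aj: "A j = sets (vimage_algebra (space M) Y L)" and Y: "Y \<in> space M \<rightarrow> space L"
  proof (rule measurableI)
    show "Y x \<in> space L" if "x \<in> space ?G" for x using Y that sp by auto
    fix B assume B: "B \<in> sets L"
    define D where "D i = (if i = j then Y -` B \<inter> space M else space M)" for i
    have "space M \<inter> (\<Inter>i\<in>J. D i) \<in> cylinder_sets F A J"
    proof (rule cylinder_setsI)
      show "space M \<in> sets F" using assms(1) sets.top[of F] by simp
      show "D i \<in> A i" if "i \<in> J" for i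
        using top[OF that] Aj in_vimage_algebra[OF B, of Y "space M"] by (auto simp: D_def)
    qed
    moreover have "space M \<inter> (\<Inter>i\<in>J. D i) = Y -` B \<inter> space M"
      using j by (auto simp: D_def split: if_splits)
    ultimately show "Y -` B \<inter> space ?G \<in> sets ?G" using Pow sp by auto
  qed
qed

lemma nn_integral_cscg_0 [simp]: "(\<integral>\<^sup>+z. f z \<partial>(cscg 0 :: (complex^'m) measure)) = 0"
proof -
  have "AE z in (cscg 0 :: (complex^'m) measure). f z = 0"
    by (rule AE_I[of _ _ "UNIV"]) (auto simp: cscg_0)
  then have "(\<integral>\<^sup>+z. f z \<partial>(cscg 0 :: (complex^'m) measure)) = (\<integral>\<^sup>+z. 0 \<partial>(cscg 0 :: (complex^'m) measure))"
    by (rule nn_integral_cong_AE)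
  then show ?thesis by simp
qed

section \<open>Integrating out channels in the network\<close>

context poisson_zf_network
begin

text \<open>Exhibits every family \<open>block_events\<close> as the sets of a measure space, which
  is how the cylinder lemmas ask for closure under intersection.\<close>

definition block_algebra :: "'k channel_block \<Rightarrow> 'w measure" where
  "block_algebra b = (case b of
     To_typical i \<Rightarrow> vimage_algebra (space M) (h i) borel
   | Home_user j \<Rightarrow> vimage_algebra (space M) (\<lambda>\<xi>. H 0 \<xi> $ j) borel
   | Other_cell i \<Rightarrow> vimage_algebra (space M) (H i) borel)"

lemma block_algebra: "block_events M h H b = sets (block_algebra b)" "space (block_algebra b) = space M"
  by (cases b; simp add: block_algebra_def)+

abbreviation "F \<equiv> distance_algebra M X U"

lemma space_F [simp]: "space F = space M"
  by (simp add: distance_algebra_def space_measure_of_conv)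

lemma sets_F: "sets F = sigma_sets (space M)
     ({(\<lambda>\<xi>. norm (X i \<xi>)) -` B \<inter> space M | i B. B \<in> sets borel} \<union>
      {(\<lambda>\<xi>. dist (X i \<xi>) (U i j \<xi>)) -` B \<inter> space M | i j B. B \<in> sets borel})"
  unfolding distance_algebra_def by (rule sets_measure_of) auto

lemma subalgebra_F: "subalgebra M F"
proof -
  have "sets F \<subseteq> sets M"
    unfolding sets_F using X_measurable U_measurable
    by (intro sets.sigma_sets_subset) (auto intro!: measurable_sets)
  then show ?thesis by (simp add: subalgebra_def)
qed

lemma norm_X_measurable_F [measurable]: "(\<lambda>\<xi>. norm (X i \<xi>)) \<in> borel_measurable F"
proof (rule measurableI)
  fix B :: "real set" assume "B \<in> sets borel"
  then show "(\<lambda>\<xi>. norm (X i \<xi>)) -` B \<inter> space F \<in> sets F"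
    unfolding sets_F space_F by (intro sigma_sets.Basic UnI1) blast
qed simp

definition v :: "nat \<Rightarrow> 'w \<Rightarrow> real" where
  "v i \<xi> = inverse \<omega> * norm (X i \<xi>) powr (- \<alpha>)"

lemma v_measurable_F [measurable]: "v i \<in> borel_measurable F"
  unfolding v_def by measurable

lemma v_measurable [measurable]: "v i \<in> borel_measurable M"
  by (rule measurable_from_subalg[OF subalgebra_F v_measurable_F])

lemma h_measurable [measurable]: "h i \<in> borel_measurable M"
  using h_distr[of i] by (simp add: has_cond_distr_def)

declare H_measurable [measurable] X_measurable [measurable]

abbreviation "home \<equiv> (Home_user :: 'k \<Rightarrow> 'k channel_block) ` (- {k})"

abbreviation "known J \<equiv> sigma (space M) (cylinder_sets F (block_events M h H) J)"

text \<open>Conditional independence is available with one foreign cell at a time, hence the single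
  block \<open>Other_cell l\<close>. The interference terms are accordingly averaged one by
  one.\<close>

lemma network_freeze:
  fixes g :: "'w \<times> (complex^'m) \<Rightarrow> ennreal"
  assumes \<omega>: "\<omega> > 0" and l: "l \<noteq> 0"
    and J: "J \<subseteq> range To_typical \<union> home \<union> {Other_cell l}" "To_typical i \<notin> J" "J \<noteq> {}" "finite J"
    and g: "g \<in> borel_measurable (known J \<Otimes>\<^sub>M borel)"
  shows "(\<integral>\<^sup>+\<xi>. g (\<xi>, h i \<xi>) \<partial>M) = (\<integral>\<^sup>+\<xi>. (\<integral>\<^sup>+z. g (\<xi>, z) \<partial>cscg (v i \<xi>)) \<partial>M)"
proof -
  have v0: "v i \<xi> \<ge> 0" for \<xi> using \<omega> by (simp add: v_def)
  have Z: "has_cond_distr M F borel (h i) (\<lambda>\<xi>. cscg (v i \<xi>))"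
    using h_distr[of i] by (simp add: v_def)
  have J': "insert (To_typical i) J \<subseteq> range To_typical \<union> home \<union> {Other_cell l}"
    using J(1) by auto
  note rect = emeasure_sigma_cylinder_cond_distr[OF subalgebra_F Z v_measurable_F v0 channels_indep[OF l] J' J(2-4)
      block_events.simps(1) block_algebra]
  have sub: "subalgebra M (known J)"
    using rect(2) by (auto simp: subalgebra_def space_measure_of_conv)
  show ?thesis
  proof (rule nn_integral_freeze[OF sub h_measurable _ v0 _ g])
    show "v i \<in> borel_measurable (known J)"
      by (rule measurable_sigma_cylinder(1)[OF space_F J(3) block_algebra v_measurable_F])
  qed (rule rect(1))
qed

lemma
  assumes J: "J \<noteq> {}"
  shows measurable_known_F: "f \<in> borel_measurable F \<Longrightarrow> f \<in> borel_measurable (known J)"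
    and measurable_known_typical: "To_typical i \<in> J \<Longrightarrow> h i \<in> borel_measurable (known J)"
    and measurable_known_home: "Home_user j \<in> J \<Longrightarrow> (\<lambda>\<xi>. H 0 \<xi> $ j) \<in> borel_measurable (known J)"
    and measurable_known_cell: "Other_cell i \<in> J \<Longrightarrow> H i \<in> borel_measurable (known J)"
  by ((rule measurable_sigma_cylinder(1)[OF space_F J block_algebra], assumption)
    | (rule measurable_sigma_cylinder(2)[OF space_F J block_algebra], assumption, rule block_events.simps, simp))+

text \<open>\<open>S\<close> is the signal power and \<open>I i\<close> the power received from access point \<open>i\<close>. \<open>S\<close> does not mention
  \<open>H 0 \<xi> $ k\<close>, which agrees with \<open>h 0 \<xi>\<close> only almost surely.\<close>

definition S :: "'w \<Rightarrow> real" where "S \<xi> = (norm (zf_residual (H 0 \<xi>) k (h 0 \<xi>)))\<^sup>2"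

definition I :: "nat \<Rightarrow> 'w \<Rightarrow> real" where "I i \<xi> = (norm (hrow (h i \<xi>) (zf_matrix (H i \<xi>))))\<^sup>2"

lemma S_measurable [measurable]: "S \<in> borel_measurable M"
proof -
  have [measurable]: "(\<lambda>\<xi>. zf_residual (H 0 \<xi>) k (h 0 \<xi>)) \<in> borel_measurable M"
    by (rule zf_residual_measurable) measurable
  show ?thesis unfolding S_def by measurable
qed

lemma S_nonneg [simp]: "S \<xi> \<ge> 0" by (simp add: S_def)

lemma I_nonneg [simp]: "I i \<xi> \<ge> 0" by (simp add: I_def)

lemma I_measurable [measurable]: "I i \<in> borel_measurable M"
  unfolding I_def norm_hrow_square column_zf_matrix by measurable

text \<open>Given the distances and the other home channels, \<open>h 0\<close> is still Gaussian
  while the subspace it is projected onto is fixed. The weight \<open>f\<close> will be a multiple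
  of the path gain of an interferer, or the noise.\<close>

lemma nn_integral_inverse_S:
  assumes \<omega>: "\<omega> > 0" and card: "CARD('m) \<ge> CARD('k) + 1"
    and f: "f \<in> borel_measurable F" "\<And>\<xi>. f \<xi> \<ge> 0"
  shows "(\<integral>\<^sup>+\<xi>. ennreal (f \<xi>) * inverse (ennreal (S \<xi>)) \<partial>M) \<le>
    (\<integral>\<^sup>+\<xi>. ennreal (f \<xi> / (v 0 \<xi> * (real CARD('m) - real CARD('k)))) \<partial>M)"
proof -
  \<comment> \<open>With a single user per cell \<open>home\<close> is empty;
    \<open>Other_cell 1\<close> keeps the index set nonempty.\<close>
  let ?J = "insert (Other_cell 1) home" and ?n = "real CARD('m) - real CARD('k)"
  define g :: "'w \<times> (complex^'m) \<Rightarrow> ennreal" where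
    "g p = ennreal (f (fst p)) * inverse (ennreal ((norm (zf_residual (H 0 (fst p)) k (snd p)))\<^sup>2))" for p
  have J: "?J \<noteq> {}" by simp
  note fG[measurable] = measurable_known_F[OF J f(1)]
  have res[measurable]: "(\<lambda>p. zf_residual (H 0 (fst p)) k (snd p)) \<in> borel_measurable (known ?J \<Otimes>\<^sub>M borel)"
  proof (rule zf_residual_measurable)
    fix l assume "l \<noteq> k"
    then have "(\<lambda>\<xi>. H 0 \<xi> $ l) \<in> borel_measurable (known ?J)"
      by (intro measurable_known_home) auto
    then show "(\<lambda>p. H 0 (fst p) $ l) \<in> borel_measurable (known ?J \<Otimes>\<^sub>M borel)"
      by (rule measurable_compose[OF measurable_fst])
  qed simp
  have g: "g \<in> borel_measurable (known ?J \<Otimes>\<^sub>M borel)"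
    unfolding g_def by measurable
  have "(\<integral>\<^sup>+\<xi>. ennreal (f \<xi>) * inverse (ennreal (S \<xi>)) \<partial>M) = (\<integral>\<^sup>+\<xi>. g (\<xi>, h 0 \<xi>) \<partial>M)"
    by (simp add: g_def S_def)
  also have "\<dots> = (\<integral>\<^sup>+\<xi>. (\<integral>\<^sup>+z. g (\<xi>, z) \<partial>cscg (v 0 \<xi>)) \<partial>M)"
    by (rule network_freeze[OF \<omega> one_neq_zero _ _ J _ g]) auto
  also have "\<dots> \<le> (\<integral>\<^sup>+\<xi>. ennreal (f \<xi> / (v 0 \<xi> * ?n)) \<partial>M)"
  proof (rule nn_integral_mono)
    fix \<xi>
    show "(\<integral>\<^sup>+z. g (\<xi>, z) \<partial>cscg (v 0 \<xi>)) \<le> ennreal (f \<xi> / (v 0 \<xi> * ?n))"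
    proof (cases "v 0 \<xi> > 0")
      case True
      have [measurable]: "(\<lambda>z. zf_residual (H 0 \<xi>) k z) \<in> borel_measurable borel"
        by (rule zf_residual_measurable) auto
      have "(\<integral>\<^sup>+z. g (\<xi>, z) \<partial>cscg (v 0 \<xi>)) =
          ennreal (f \<xi>) * (\<integral>\<^sup>+z. inverse (ennreal ((norm (zf_residual (H 0 \<xi>) k z))\<^sup>2)) \<partial>cscg (v 0 \<xi>))"
        unfolding g_def fst_conv snd_conv by (rule nn_integral_cmult) measurable
      also have "\<dots> \<le> ennreal (f \<xi>) * ennreal (1 / (v 0 \<xi> * ?n))"
        by (intro mult_left_mono nn_integral_cscg_inverse_zf_residual[OF True card]) simp
      also have "\<dots> = ennreal (f \<xi> / (v 0 \<xi> * ?n))"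
        using f(2)[of \<xi>] True card by (simp add: ennreal_mult[symmetric])
      finally show ?thesis .
    next
      case False
      moreover have "v 0 \<xi> \<ge> 0" using \<omega> by (simp add: v_def)
      ultimately have "v 0 \<xi> = 0" by simp
      then show ?thesis by simp
    qed
  qed
  finally show ?thesis .
qed

text \<open>Given \<open>H i\<close>, \<open>h 0\<close> and the home channels, both the beamformers
  of cell \<open>i\<close> and \<open>S\<close> are fixed. Each unit column then receives mean power
  \<open>v i\<close>, a function of the distances, so the remaining inverse of \<open>S\<close>
  falls under \<open>nn_integral_inverse_S\<close>.\<close>

lemma nn_integral_interference:
  assumes \<omega>: "\<omega> > 0" and card: "CARD('m) \<ge> CARD('k) + 1" and i: "i \<noteq> 0"
  shows "(\<integral>\<^sup>+\<xi>. ennreal (I i \<xi>) * inverse (ennreal (S \<xi>)) \<partial>M) \<le>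
    (\<integral>\<^sup>+\<xi>. ennreal (real CARD('k) * v i \<xi> / (v 0 \<xi> * (real CARD('m) - real CARD('k)))) \<partial>M)"
proof -
  let ?J = "insert (Other_cell i) (insert (To_typical 0) home)"
  define g :: "'w \<times> (complex^'m) \<Rightarrow> ennreal" where
    "g p = (\<Sum>j\<in>UNIV. ennreal ((cmod (hdot (snd p) (zf_column (H i (fst p)) j)))\<^sup>2)) * inverse (ennreal (S (fst p)))" for p
  have J: "?J \<noteq> {}" by simp
  have Hi[measurable]: "H i \<in> borel_measurable (known ?J)"
    by (rule measurable_known_cell) auto
  have SG[measurable]: "S \<in> borel_measurable (known ?J)"
  proof -
    have "(\<lambda>\<xi>. zf_residual (H 0 \<xi>) k (h 0 \<xi>)) \<in> borel_measurable (known ?J)"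
      by (rule zf_residual_measurable) (auto intro!: measurable_known_home measurable_known_typical)
    then show ?thesis unfolding S_def by measurable
  qed
  have g: "g \<in> borel_measurable (known ?J \<Otimes>\<^sub>M borel)"
    unfolding g_def by measurable
  have v0: "v i \<xi> \<ge> 0" for \<xi> using \<omega> by (simp add: v_def)
  have "(\<integral>\<^sup>+\<xi>. ennreal (I i \<xi>) * inverse (ennreal (S \<xi>)) \<partial>M) = (\<integral>\<^sup>+\<xi>. g (\<xi>, h i \<xi>) \<partial>M)"
    by (simp add: g_def I_def norm_hrow_square column_zf_matrix)
  also have "\<dots> = (\<integral>\<^sup>+\<xi>. (\<integral>\<^sup>+z. g (\<xi>, z) \<partial>cscg (v i \<xi>)) \<partial>M)"
    by (rule network_freeze[OF \<omega> i _ _ J _ g]) (use i in auto)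
  also have "\<dots> \<le> (\<integral>\<^sup>+\<xi>. ennreal (real CARD('k) * v i \<xi>) * inverse (ennreal (S \<xi>)) \<partial>M)"
  proof (rule nn_integral_mono_AE)
    have "AE \<xi> in M. \<forall>j. norm (zf_column (H i \<xi>) j) = 1"
      using unit_columns[of _ i] by (simp add: column_zf_matrix AE_all_countable[symmetric] eventually_all_finite)
    then show "AE \<xi> in M. (\<integral>\<^sup>+z. g (\<xi>, z) \<partial>cscg (v i \<xi>)) \<le> ennreal (real CARD('k) * v i \<xi>) * inverse (ennreal (S \<xi>))"
    proof eventually_elim
      case (elim \<xi>)
      show ?case
      proof (cases "v i \<xi> > 0")
        case True
        have "(\<integral>\<^sup>+z. g (\<xi>, z) \<partial>cscg (v i \<xi>)) =
            (\<integral>\<^sup>+z. (\<Sum>j\<in>UNIV. ennreal ((cmod (hdot z (zf_column (H i \<xi>) j)))\<^sup>2)) \<partial>cscg (v i \<xi>)) * inverse (ennreal (S \<xi>))"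
          unfolding g_def fst_conv snd_conv by (rule nn_integral_multc) measurable
        also have "(\<integral>\<^sup>+z. (\<Sum>j\<in>UNIV. ennreal ((cmod (hdot z (zf_column (H i \<xi>) j)))\<^sup>2)) \<partial>cscg (v i \<xi>)) =
            (\<Sum>j\<in>(UNIV :: 'k set). ennreal (v i \<xi>))"
          by (subst nn_integral_sum, measurable) (simp add: nn_integral_cscg_hdot_square[OF True] elim)
        also have "\<dots> = ennreal (real CARD('k) * v i \<xi>)"
          by (simp add: ennreal_mult ennreal_of_nat_eq_real_of_nat v0)
        finally show ?thesis by simp
      next
        case False
        then have "v i \<xi> = 0" using v0[of \<xi>] by simp
        then show ?thesis by simp
      qed
    qed
  qed
  also have "\<dots> \<le> (\<integral>\<^sup>+\<xi>. ennreal (real CARD('k) * v i \<xi> / (v 0 \<xi> * (real CARD('m) - real CARD('k)))) \<partial>M)"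
    by (rule nn_integral_inverse_S[OF \<omega> card]) (use v0 in auto)
  finally show ?thesis .
qed

text \<open>A crude bound, by the whole of \<open>h 0\<close> instead of its projection; it is used
  only for integrability.\<close>

lemma nn_integral_signal:
  assumes \<omega>: "\<omega> > 0"
  shows "(\<integral>\<^sup>+\<xi>. ennreal (S \<xi> / v 0 \<xi>) \<partial>M) \<le> real CARD('m)"
proof -
  let ?J = "{Other_cell 1} :: 'k channel_block set"
  define g :: "'w \<times> (complex^'m) \<Rightarrow> ennreal" where
    "g p = ennreal ((norm (snd p))\<^sup>2) * ennreal (1 / v 0 (fst p))" for p
  have J: "?J \<noteq> {}" by simp
  note vG[measurable] = measurable_known_F[OF J v_measurable_F[of 0]]
  have g: "g \<in> borel_measurable (known ?J \<Otimes>\<^sub>M borel)"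
    unfolding g_def by measurable
  have v0: "v 0 \<xi> \<ge> 0" for \<xi> using \<omega> by (simp add: v_def)
  have "ennreal (S \<xi> / v 0 \<xi>) \<le> g (\<xi>, h 0 \<xi>)" for \<xi>
  proof -
    have "S \<xi> \<le> (norm (h 0 \<xi>))\<^sup>2" unfolding S_def by (intro power_mono norm_zf_residual_le) simp
    then have "S \<xi> / v 0 \<xi> \<le> (norm (h 0 \<xi>))\<^sup>2 * (1 / v 0 \<xi>)"
      using v0[of \<xi>] by (simp add: divide_right_mono)
    then show ?thesis using v0[of \<xi>] by (simp add: g_def ennreal_mult[symmetric] ennreal_leI)
  qed
  then have "(\<integral>\<^sup>+\<xi>. ennreal (S \<xi> / v 0 \<xi>) \<partial>M) \<le> (\<integral>\<^sup>+\<xi>. g (\<xi>, h 0 \<xi>) \<partial>M)"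
    by (rule nn_integral_mono)
  also have "\<dots> = (\<integral>\<^sup>+\<xi>. (\<integral>\<^sup>+z. g (\<xi>, z) \<partial>cscg (v 0 \<xi>)) \<partial>M)"
    by (rule network_freeze[OF \<omega> one_neq_zero _ _ J _ g]) auto
  also have "\<dots> \<le> (\<integral>\<^sup>+\<xi>. ennreal (real CARD('m)) \<partial>M)"
  proof (rule nn_integral_mono)
    fix \<xi>
    show "(\<integral>\<^sup>+z. g (\<xi>, z) \<partial>cscg (v 0 \<xi>)) \<le> ennreal (real CARD('m))"
    proof (cases "v 0 \<xi> > 0")
      case True
      have "(\<integral>\<^sup>+z. g (\<xi>, z) \<partial>cscg (v 0 \<xi>)) = ennreal (v 0 \<xi> * real CARD('m)) * ennreal (1 / v 0 \<xi>)"
        unfolding g_def fst_conv snd_conv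
        by (subst nn_integral_multc) (simp_all add: nn_integral_cscg_norm_square[OF True])
      also have "\<dots> = ennreal (real CARD('m))"
        using True by (simp add: ennreal_mult[symmetric])
      finally show ?thesis by simp
    next
      case False
      then have "v 0 \<xi> = 0" using v0[of \<xi>] by simp
      then show ?thesis by simp
    qed
  qed
  finally show ?thesis by (simp add: emeasure_space_1)
qed

lemma planar_ppp: "lam > 0 \<Longrightarrow> planar_ppp M lam \<Psi> X"
  using ppp X_measurable X_enumerates X0_closest
  by (simp add: planar_ppp_def planar_ppp_axioms_def prob_space_axioms)

lemma nn_integral_noise_to_signal:
  assumes lam: "lam > 0" and \<alpha>: "\<alpha> > 2" and \<omega>: "\<omega> > 0" and card: "CARD('m) \<ge> CARD('k) + 1" and c: "c > 0"
  shows "(\<integral>\<^sup>+\<xi>. ((\<Sum>i. ennreal (I (Suc i) \<xi>)) + ennreal c) * inverse (ennreal (S \<xi>)) \<partial>M) \<le>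
    ennreal ((2 * real CARD('k) / (\<alpha> - 2) + Gamma (\<alpha> / 2 + 1) / (pi * lam) powr (\<alpha> / 2) * (\<omega> * c)) /
      (real CARD('m) - real CARD('k)))"
proof -
  interpret planar_ppp M lam \<Psi> X by (rule planar_ppp) fact
  let ?n = "real CARD('m) - real CARD('k)" and ?K = "real CARD('k)"
  let ?\<Gamma> = "Gamma (\<alpha> / 2 + 1) / (pi * lam) powr (\<alpha> / 2)"
  have n: "?n > 0" using card by simp
  have \<Gamma>: "?\<Gamma> \<ge> 0" using \<alpha> by (intro divide_nonneg_nonneg less_imp_le[OF Gamma_real_pos]) auto
  \<comment> \<open>In the quotient of path gains \<open>\<omega>\<close> cancels and the distance
    ratio remains. Access points at the origin are covered by \<open>x / 0 = 0\<close> and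
    \<open>0 powr b = 0\<close>.\<close>
  have ratio: "?K * v i \<xi> / (v 0 \<xi> * ?n) = ?K / ?n * (norm (X 0 \<xi>) / norm (X i \<xi>)) powr \<alpha>" for i \<xi>
    using \<omega> n by (cases "X 0 \<xi> = 0"; cases "X i \<xi> = 0") (auto simp: v_def powr_minus_divide powr_divide field_simps)
  have noise: "c / (v 0 \<xi> * ?n) = c * \<omega> / ?n * norm (X 0 \<xi>) powr \<alpha>" for \<xi>
    using \<omega> n by (cases "X 0 \<xi> = 0") (auto simp: v_def powr_minus_divide field_simps)
  have scale: "ennreal (r * t powr \<alpha>) = ennreal r * ennreal (t powr \<alpha>)" if "r \<ge> 0" for r t
    using that by (rule ennreal_mult) simp
  have "(\<integral>\<^sup>+\<xi>. (\<Sum>i. ennreal (I (Suc i) \<xi>) * inverse (ennreal (S \<xi>))) \<partial>M) =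
      (\<Sum>i. \<integral>\<^sup>+\<xi>. ennreal (I (Suc i) \<xi>) * inverse (ennreal (S \<xi>)) \<partial>M)"
    by (rule nn_integral_suminf) measurable
  also have "\<dots> \<le> (\<Sum>i. \<integral>\<^sup>+\<xi>. ennreal (?K * v (Suc i) \<xi> / (v 0 \<xi> * ?n)) \<partial>M)"
    by (intro suminf_le nn_integral_interference[OF \<omega> card] summableI) simp
  also have "\<dots> = (\<integral>\<^sup>+\<xi>. (\<Sum>i. ennreal (?K * v (Suc i) \<xi> / (v 0 \<xi> * ?n))) \<partial>M)"
    by (rule nn_integral_suminf[symmetric]) measurable
  also have "\<dots> = (\<integral>\<^sup>+\<xi>. ennreal (?K / ?n) * (\<Sum>i. ennreal ((norm (X 0 \<xi>) / norm (X (Suc i) \<xi>)) powr \<alpha>)) \<partial>M)"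
    using n by (simp only: ratio scale ennreal_suminf_cmult divide_nonneg_pos of_nat_0_le_iff)
  also have "\<dots> = ennreal (?K / ?n) * (\<integral>\<^sup>+\<xi>. (\<Sum>i. ennreal ((norm (X 0 \<xi>) / norm (X (Suc i) \<xi>)) powr \<alpha>)) \<partial>M)"
    by (rule nn_integral_cmult) measurable
  also have "\<dots> \<le> ennreal (?K / ?n) * ennreal (2 / (\<alpha> - 2))"
    by (intro mult_left_mono nn_integral_distance_ratios[OF \<alpha>]) simp
  also have "\<dots> = ennreal (?K / ?n * (2 / (\<alpha> - 2)))"
    using n \<alpha> by (intro ennreal_mult[symmetric]) auto
  finally have A: "(\<integral>\<^sup>+\<xi>. (\<Sum>i. ennreal (I (Suc i) \<xi>) * inverse (ennreal (S \<xi>))) \<partial>M) \<le> ennreal (?K / ?n * (2 / (\<alpha> - 2)))" .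
  have "(\<integral>\<^sup>+\<xi>. ennreal c * inverse (ennreal (S \<xi>)) \<partial>M) \<le> (\<integral>\<^sup>+\<xi>. ennreal (c / (v 0 \<xi> * ?n)) \<partial>M)"
    by (rule nn_integral_inverse_S[OF \<omega> card]) (use c in auto)
  also have "\<dots> = (\<integral>\<^sup>+\<xi>. ennreal (c * \<omega> / ?n) * ennreal (norm (X 0 \<xi>) powr \<alpha>) \<partial>M)"
    using n c \<omega> by (simp only: noise scale divide_nonneg_pos mult_nonneg_nonneg less_imp_le)
  also have "\<dots> = ennreal (c * \<omega> / ?n) * ennreal ?\<Gamma>"
    using \<alpha> by (subst nn_integral_cmult) (auto simp: nn_integral_nearest_powr)
  also have "\<dots> = ennreal (c * \<omega> / ?n * ?\<Gamma>)"
    using c \<omega> n \<Gamma> by (intro ennreal_mult[symmetric]) auto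
  finally have B: "(\<integral>\<^sup>+\<xi>. ennreal c * inverse (ennreal (S \<xi>)) \<partial>M) \<le> ennreal (c * \<omega> / ?n * ?\<Gamma>)" .
  have "(\<integral>\<^sup>+\<xi>. ((\<Sum>i. ennreal (I (Suc i) \<xi>)) + ennreal c) * inverse (ennreal (S \<xi>)) \<partial>M) =
      (\<integral>\<^sup>+\<xi>. (\<Sum>i. ennreal (I (Suc i) \<xi>) * inverse (ennreal (S \<xi>))) + ennreal c * inverse (ennreal (S \<xi>)) \<partial>M)"
    by (simp add: distrib_right)
  also have "\<dots> = (\<integral>\<^sup>+\<xi>. (\<Sum>i. ennreal (I (Suc i) \<xi>) * inverse (ennreal (S \<xi>))) \<partial>M) +
      (\<integral>\<^sup>+\<xi>. ennreal c * inverse (ennreal (S \<xi>)) \<partial>M)"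
    by (rule nn_integral_add) measurable
  also have "\<dots> \<le> ennreal (?K / ?n * (2 / (\<alpha> - 2))) + ennreal (c * \<omega> / ?n * ?\<Gamma>)"
    by (rule add_mono[OF A B])
  also have "\<dots> = ennreal (?K / ?n * (2 / (\<alpha> - 2)) + c * \<omega> / ?n * ?\<Gamma>)"
    using n \<alpha> c \<omega> \<Gamma> by (intro ennreal_plus[symmetric]) auto
  also have "?K / ?n * (2 / (\<alpha> - 2)) + c * \<omega> / ?n * ?\<Gamma> = (2 * ?K / (\<alpha> - 2) + ?\<Gamma> * (\<omega> * c)) / ?n"
    by (simp add: add_divide_distrib mult_ac)
  finally show ?thesis .
qed

section \<open>Jensen's inequality for the spectral efficiency\<close>

definition interference :: "'w \<Rightarrow> real" where
  "interference \<xi> = enn2real (\<Sum>i. ennreal (I (Suc i) \<xi>))"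

lemma interference_measurable [measurable]: "interference \<in> borel_measurable M"
  unfolding interference_def by measurable

lemma interference_nonneg: "interference \<xi> \<ge> 0"
  by (simp add: interference_def)

lemma S_eq: "AE \<xi> in M. (cmod (hdot (h 0 \<xi>) (column k (zf_matrix (H 0 \<xi>)))))\<^sup>2 = S \<xi>"
  using typical_user
proof eventually_elim
  case (elim \<xi>)
  then show ?case
    by (simp add: S_def column_zf_matrix zf_column_eq cmod_hdot_zf_residual)
qed

text \<open>\<open>S\<close> itself has infinite mean because \<open>d\<^sub>0\<close> to the power \<open>- \<alpha>\<close> is not integrable. Integrability of the
  logarithm comes from \<open>1 + S / c \<le> (1 + S / v 0) * (1 + v 0 / c)\<close>.\<close>

lemma integrable_log_signal:
  assumes lam: "lam > 0" and \<alpha>: "\<alpha> > 2" and \<omega>: "\<omega> > 0" and c: "c > 0"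
  shows "integrable M (\<lambda>\<xi>. ln (1 + S \<xi> / c))"
proof -
  interpret planar_ppp M lam \<Psi> X by (rule planar_ppp) fact
  define C where "C = inverse \<omega> / c"
  have C: "C > 0" using \<omega> c by (simp add: C_def)
  have v0: "v 0 \<xi> \<ge> 0" for \<xi> using \<omega> by (simp add: v_def)
  have "integrable M (\<lambda>\<xi>. S \<xi> / v 0 \<xi>)"
    using nn_integral_signal[OF \<omega>] v0
    by (intro integrableI_nonneg) (auto simp: le_less_trans[OF _ ennreal_less_top])
  moreover have "integrable M (\<lambda>\<xi>. norm (X 0 \<xi>) powr (- 1))"
  proof (rule integrableI_nonneg)
    show "(\<integral>\<^sup>+\<xi>. ennreal (norm (X 0 \<xi>) powr (- 1)) \<partial>M) < \<infinity>"
      by (subst nn_integral_nearest_powr) simp_all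
  qed simp_all
  ultimately have dom: "integrable M (\<lambda>\<xi>. S \<xi> / v 0 \<xi> + (ln (1 + C) + \<alpha> * norm (X 0 \<xi>) powr (- 1)))"
    by (intro Bochner_Integration.integrable_add integrable_mult_right integrable_const)
  have "AE \<xi> in M. norm (ln (1 + S \<xi> / c)) \<le> S \<xi> / v 0 \<xi> + (ln (1 + C) + \<alpha> * norm (X 0 \<xi>) powr (- 1))"
    using nearest_pos
  proof eventually_elim
    case (elim \<xi>)
    then have v: "v 0 \<xi> > 0" using \<omega> by (simp add: v_def)
    have vc: "v 0 \<xi> / c = C * norm (X 0 \<xi>) powr (- \<alpha>)" by (simp add: v_def C_def)
    have pos: "1 + S \<xi> / v 0 \<xi> > 0" "1 + v 0 \<xi> / c > 0" using v c by (simp_all add: add_pos_nonneg)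
    have "1 + S \<xi> / c \<le> (1 + S \<xi> / v 0 \<xi>) * (1 + v 0 \<xi> / c)"
      using v c by (simp add: field_simps)
    moreover have "1 \<le> 1 + S \<xi> / c" using c by simp
    ultimately have "ln (1 + S \<xi> / c) \<le> ln ((1 + S \<xi> / v 0 \<xi>) * (1 + v 0 \<xi> / c))" by simp
    also have "\<dots> = ln (1 + S \<xi> / v 0 \<xi>) + ln (1 + v 0 \<xi> / c)"
      using pos by (simp add: ln_mult)
    also have "\<dots> \<le> S \<xi> / v 0 \<xi> + (ln (1 + C) + \<alpha> * norm (X 0 \<xi>) powr (- 1))"
      unfolding vc using v C \<alpha> elim
      by (intro add_mono ln_add_one_self_le_self ln_one_plus_inverse_powr) auto
    finally show ?case using \<open>1 \<le> 1 + S \<xi> / c\<close> by simp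
  qed
  then show ?thesis
    by (intro Bochner_Integration.integrable_bound[OF dom]) (auto elim!: eventually_mono)
qed

lemma expectation_log_ratio:
  assumes lam: "lam > 0" and \<alpha>: "\<alpha> > 2" and \<omega>: "\<omega> > 0" and card: "CARD('m) \<ge> CARD('k) + 1"
    and c: "c > 0" and a: "0 \<le> a" "a < 1"
  defines "y \<equiv> (2 * real CARD('k) / (\<alpha> - 2) + Gamma (\<alpha> / 2 + 1) / (pi * lam) powr (\<alpha> / 2) * (\<omega> * c)) /
      (real CARD('m) - real CARD('k))"
  shows "expectation (\<lambda>\<xi>. log 2 (1 + (1 - a) * S \<xi> / (interference \<xi> + c + a * S \<xi>))) \<ge>
    (ln (y + 1) - ln (y + a)) / ln 2"
proof -
  define q where "q y = (ln (y + 1) - ln (y + a)) / ln 2" for y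
  define Y where "Y \<xi> = (interference \<xi> + c) / S \<xi>" for \<xi>
  have [measurable]: "Y \<in> borel_measurable M" unfolding Y_def by measurable
  have y0: "y \<ge> 0"
    using card \<alpha> \<omega> c unfolding y_def
    by (intro divide_nonneg_nonneg add_nonneg_nonneg mult_nonneg_nonneg less_imp_le[OF Gamma_real_pos]) auto
  let ?R = "\<lambda>\<xi>. ((\<Sum>i. ennreal (I (Suc i) \<xi>)) + ennreal c) * inverse (ennreal (S \<xi>))"
  have R: "(\<integral>\<^sup>+\<xi>. ?R \<xi> \<partial>M) \<le> ennreal y"
    unfolding y_def by (rule nn_integral_noise_to_signal[OF lam \<alpha> \<omega> card c])
  then have "(\<integral>\<^sup>+\<xi>. ?R \<xi> \<partial>M) \<noteq> \<infinity>" by (auto simp: top_unique)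
  \<comment> \<open>A finite mean excludes a vanishing signal, where \<open>c > 0\<close> would make
    \<open>?R\<close> infinite, and then also an infinite interference. Almost surely no default
    value enters \<open>Y\<close>.\<close>
  then have "AE \<xi> in M. ?R \<xi> \<noteq> \<infinity>"
    by (intro nn_integral_PInf_AE) measurable
  then have good: "AE \<xi> in M. S \<xi> > 0 \<and> ennreal (Y \<xi>) = ?R \<xi>"
  proof eventually_elim
    case (elim \<xi>)
    have S: "S \<xi> > 0"
    proof (rule ccontr)
      assume "\<not> S \<xi> > 0"
      then have "S \<xi> = 0" using S_nonneg[of \<xi>] by linarith
      then show False using elim c by (simp add: ennreal_mult_top)
    qed
    then have inv: "inverse (ennreal (S \<xi>)) = ennreal (inverse (S \<xi>))" by (rule inverse_ennreal)
    have "(\<Sum>i. ennreal (I (Suc i) \<xi>)) \<noteq> \<top>"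
      using elim S by (auto simp: inv ennreal_top_mult)
    then have "(\<Sum>i. ennreal (I (Suc i) \<xi>)) = ennreal (interference \<xi>)"
      by (simp add: interference_def less_top)
    then have "?R \<xi> = ennreal ((interference \<xi> + c) * inverse (S \<xi>))"
      using c S interference_nonneg[of \<xi>] by (simp add: inv ennreal_mult flip: ennreal_plus)
    then show ?case using S by (simp add: Y_def divide_inverse)
  qed
  then have "(\<integral>\<^sup>+\<xi>. ennreal (Y \<xi>) \<partial>M) = (\<integral>\<^sup>+\<xi>. ?R \<xi> \<partial>M)"
    by (intro nn_integral_cong_AE) auto
  with R have nnY: "(\<integral>\<^sup>+\<xi>. ennreal (Y \<xi>) \<partial>M) \<le> ennreal y" by simp
  have Y0: "Y \<xi> \<ge> 0" for \<xi> using c interference_nonneg[of \<xi>] by (simp add: Y_def)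
  have Ypos: "AE \<xi> in M. 0 < Y \<xi>"
    using good
  proof eventually_elim
    case (elim \<xi>)
    then show ?case using c interference_nonneg[of \<xi>] by (simp add: Y_def add_nonneg_pos)
  qed
  have intY: "integrable M Y"
    using nnY Y0 by (intro integrableI_nonneg) (auto intro: le_less_trans)
  have EY: "expectation Y \<le> y"
    using nnY y0 Y0 by (simp add: nn_integral_eq_integral[OF intY] integral_nonneg_AE)
  have EYpos: "0 < expectation Y" using intY Ypos by (rule expectation_greater)
  have eq: "AE \<xi> in M. log 2 (1 + (1 - a) * S \<xi> / (interference \<xi> + c + a * S \<xi>)) = q (Y \<xi>)"
    using good
  proof eventually_elim
    case (elim \<xi>)
    then show ?case
      unfolding q_def Y_def using c interference_nonneg[of \<xi>] by (intro log_ratio_eq[OF a]) auto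
  qed
  \<comment> \<open>The Bochner integral of a non-integrable function is 0, so integrability must be
    shown. Dropping interference and impairment bounds the ratio inside the logarithm by
    \<open>S / c\<close>.\<close>
  have "integrable M (\<lambda>\<xi>. log 2 (1 + (1 - a) * S \<xi> / (interference \<xi> + c + a * S \<xi>)))"
  proof (rule Bochner_Integration.integrable_bound)
    show "integrable M (\<lambda>\<xi>. ln (1 + S \<xi> / c) / ln 2)"
      using integrable_log_signal[OF lam \<alpha> \<omega> c] by simp
    show "AE \<xi> in M. norm (log 2 (1 + (1 - a) * S \<xi> / (interference \<xi> + c + a * S \<xi>))) \<le> norm (ln (1 + S \<xi> / c) / ln 2)"
    proof (rule AE_I2)
      fix \<xi>
      let ?x = "(1 - a) * S \<xi> / (interference \<xi> + c + a * S \<xi>)"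
      have "(1 - a) * S \<xi> \<le> S \<xi>" using a mult_right_mono[of "1 - a" 1 "S \<xi>"] by simp
      then have "?x \<le> S \<xi> / c"
        using a c interference_nonneg[of \<xi>] by (intro frac_le) auto
      moreover have "0 \<le> ?x" using a c interference_nonneg[of \<xi>] by simp
      ultimately show "norm (log 2 (1 + ?x)) \<le> norm (ln (1 + S \<xi> / c) / ln 2)"
        by (simp add: log_def divide_right_mono)
    qed
  qed measurable
  then have intq: "integrable M (\<lambda>\<xi>. q (Y \<xi>))"
    by (rule integrable_cong_AE_imp) (use eq in \<open>auto simp: q_def elim!: eventually_mono\<close>)
  have "q y \<le> q (expectation Y)"
    unfolding q_def by (rule antimono_log_ratio[OF a EYpos EY])
  also have "\<dots> \<le> expectation (\<lambda>\<xi>. q (Y \<xi>))"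
  proof (rule jensens_inequality[where I="{0<..}"])
    show "convex_on {0<..} q" unfolding q_def by (rule convex_on_log_ratio[OF a])
  qed (use intY Ypos intq in auto)
  also have "\<dots> = expectation (\<lambda>\<xi>. log 2 (1 + (1 - a) * S \<xi> / (interference \<xi> + c + a * S \<xi>)))"
    by (rule integral_cong_AE) (use eq in \<open>auto simp: q_def elim!: eventually_mono\<close>)
  finally show ?thesis by (simp only: q_def)
qed

end

theorem proposition1:
  fixes M :: "'w measure"
    and lam \<alpha> \<omega> \<sigma> \<rho> \<epsilon> :: real
    and \<Psi> :: "'w \<Rightarrow> (real^2) set"
    and X :: "nat \<Rightarrow> 'w \<Rightarrow> real^2"
    and U :: "nat \<Rightarrow> 'k::finite \<Rightarrow> 'w \<Rightarrow> real^2"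
    and k :: 'k
    and h :: "nat \<Rightarrow> 'w \<Rightarrow> complex^'m::finite"
    and H :: "nat \<Rightarrow> 'w \<Rightarrow> complex^'m^'k"
    and \<gamma> :: "real \<Rightarrow> real"
  assumes "lam > 0" and "\<alpha> > 2" and "\<omega> > 0" and "\<sigma>\<^sup>2 > 0" and "\<rho> > 0"
    and "0 \<le> \<epsilon>" and "\<epsilon> < 1"
    and "CARD('m) \<ge> CARD('k) + 1"
    and "poisson_zf_network M lam \<alpha> \<omega> \<Psi> X U k h H \<gamma>"
  shows "prob_space.expectation M (\<lambda>\<xi>.
           log 2 (1 + (1 - \<epsilon>\<^sup>2) * (cmod (hdot (h 0 \<xi>) (column k (zf_matrix (H 0 \<xi>)))))\<^sup>2 /
             ((\<Sum>\<^sub>\<infinity>i\<in>UNIV - {0}. (norm (hrow (h i \<xi>) (zf_matrix (H i \<xi>))))\<^sup>2)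
              + \<epsilon>\<^sup>2 * (cmod (hdot (h 0 \<xi>) (column k (zf_matrix (H 0 \<xi>)))))\<^sup>2
              + \<sigma>\<^sup>2 / \<rho>)))
         \<ge> log 2 (1 + (1 - \<epsilon>\<^sup>2) * (real CARD('m) - real CARD('k)) /
             (2 * real CARD('k) / (\<alpha> - 2)
              + \<epsilon>\<^sup>2 * (real CARD('m) - real CARD('k))
              + Gamma (\<alpha> / 2 + 1) / (pi * lam) powr (\<alpha> / 2) * (\<omega> * \<sigma>\<^sup>2 / \<rho>)))"
proof -
  interpret poisson_zf_network M lam \<alpha> \<omega> \<Psi> X U k h H \<gamma> by fact
  define a c where "a = \<epsilon>\<^sup>2" and "c = \<sigma>\<^sup>2 / \<rho>"
  have a: "0 \<le> a" "a < 1" using assms(6,7) by (simp_all add: a_def power_less_one_iff)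
  have c: "c > 0" using assms(4,5) by (simp add: c_def)
  let ?n = "real CARD('m) - real CARD('k)"
  let ?N = "2 * real CARD('k) / (\<alpha> - 2) + Gamma (\<alpha> / 2 + 1) / (pi * lam) powr (\<alpha> / 2) * (\<omega> * c)"
  have n: "?n > 0" using assms(8) by simp
  have "Gamma (\<alpha> / 2 + 1) > 0" using assms(2) by (intro Gamma_real_pos) simp
  then have N: "?N > 0" using assms(1-3) c by (intro add_pos_pos mult_pos_pos divide_pos_pos) auto
  have "log 2 (1 + (1 - \<epsilon>\<^sup>2) * ?n / (2 * real CARD('k) / (\<alpha> - 2) + \<epsilon>\<^sup>2 * ?n
              + Gamma (\<alpha> / 2 + 1) / (pi * lam) powr (\<alpha> / 2) * (\<omega> * \<sigma>\<^sup>2 / \<rho>))) =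
        log 2 (1 + (1 - a) * ?n / (?N + a * ?n))"
    by (simp add: a_def c_def add_ac)
  \<comment> \<open>The closed formula has the shape of a single efficiency with signal
    \<open>?n\<close> and noise \<open>?N\<close>, so it is the value of the convex function at the
    bound for the mean of (I + c) / S.\<close>
  also have "\<dots> = (ln (?N / ?n + 1) - ln (?N / ?n + a)) / ln 2"
    by (rule log_ratio_eq[OF a n N])
  also have "\<dots> \<le> expectation (\<lambda>\<xi>. log 2 (1 + (1 - a) * S \<xi> / (interference \<xi> + c + a * S \<xi>)))"
    by (rule expectation_log_ratio[OF assms(1-3,8) c a])
  also have "\<dots> = expectation (\<lambda>\<xi>. log 2 (1 + (1 - \<epsilon>\<^sup>2) * (cmod (hdot (h 0 \<xi>) (column k (zf_matrix (H 0 \<xi>)))))\<^sup>2 /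
             ((\<Sum>\<^sub>\<infinity>i\<in>UNIV - {0}. (norm (hrow (h i \<xi>) (zf_matrix (H i \<xi>))))\<^sup>2)
              + \<epsilon>\<^sup>2 * (cmod (hdot (h 0 \<xi>) (column k (zf_matrix (H 0 \<xi>)))))\<^sup>2
              + \<sigma>\<^sup>2 / \<rho>)))"
  proof (rule integral_cong_AE)
    have J: "(\<Sum>\<^sub>\<infinity>i\<in>UNIV - {0}. (norm (hrow (h i \<xi>) (zf_matrix (H i \<xi>))))\<^sup>2) = interference \<xi>" for \<xi>
      unfolding interference_def I_def by (rule infsum_eq_enn2real) simp
    show "(\<lambda>\<xi>. log 2 (1 + (1 - \<epsilon>\<^sup>2) * (cmod (hdot (h 0 \<xi>) (column k (zf_matrix (H 0 \<xi>)))))\<^sup>2 /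
             ((\<Sum>\<^sub>\<infinity>i\<in>UNIV - {0}. (norm (hrow (h i \<xi>) (zf_matrix (H i \<xi>))))\<^sup>2)
              + \<epsilon>\<^sup>2 * (cmod (hdot (h 0 \<xi>) (column k (zf_matrix (H 0 \<xi>)))))\<^sup>2
              + \<sigma>\<^sup>2 / \<rho>))) \<in> borel_measurable M"
      unfolding J column_zf_matrix by measurable
    show "AE \<xi> in M. log 2 (1 + (1 - a) * S \<xi> / (interference \<xi> + c + a * S \<xi>)) =
        log 2 (1 + (1 - \<epsilon>\<^sup>2) * (cmod (hdot (h 0 \<xi>) (column k (zf_matrix (H 0 \<xi>)))))\<^sup>2 /
             ((\<Sum>\<^sub>\<infinity>i\<in>UNIV - {0}. (norm (hrow (h i \<xi>) (zf_matrix (H i \<xi>))))\<^sup>2)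
              + \<epsilon>\<^sup>2 * (cmod (hdot (h 0 \<xi>) (column k (zf_matrix (H 0 \<xi>)))))\<^sup>2
              + \<sigma>\<^sup>2 / \<rho>))"
      using S_eq by eventually_elim (simp add: J a_def c_def add_ac)
  qed measurable
  finally show ?thesis .
qed

end
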